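(* Let $\Gamma\subset PSL(3,\mathbb{C})$ be a discrete subgroup and let $\Omega\subset\mathbb{P}^2_{\mathbb{C}}$ be either $Eq(\Gamma)$, or $\Omega(\Gamma)$, or a maximal region where $\Gamma$ acts properly discontinuously. Then $Li(\Omega)=1,2,3$ or $\infty$.
   Context: $PSL(3,\mathbb{C})$ acts on the complex projective plane $\mathbb{P}^2_{\mathbb{C}}$ by projective transformations; a complex line is the image in $\mathbb{P}^2_{\mathbb{C}}$ of a 2-dimensional complex linear subspace of $\mathbb{C}^3$ (minus $0$). Region of proper discontinuity: a non-empty open set $\Omega\subset\mathbb{P}^2_{\mathbb{C}}$ is a region where $\Gamma$ acts properly discontinuously if $\Gamma\Omega=\Omega$ and for each compact $K\subset\Omega$ the set $\{\gamma\in\Gamma:\gamma(K)\cap K\neq\emptyset\}$ is finite. It is maximal if it is not properly contained in another such region. Equicontinuity set: $Eq(\Gamma)$ is the set of points $z\in\mathbb{P}^2_{\mathbb{C}}$ having an open neighborhood $U$ such that $\{\gamma|_U:\gamma\in\Gamma\}$ is a normal family (every sequence has a subsequence converging uniformly on compact subsets of $U$). Kulkarni limit set: a cluster point of a family $\{\gamma A\}_{\gamma\in\Gamma}$ ($A\subset\mathbb{P}^2_{\mathbb{C}}$) is a point each of whose neighborhoods meets $\gamma A$ for infinitely many $\gamma\in\Gamma$. $L_0(\Gamma)$ is the closure of the set of points with infinite isotropy group in $\Gamma$; $L_1(\Gamma)$ is the closure of the set of cluster points of $\Gamma z$, $z$ running over $\mathbb{P}^2_{\mathbb{C}}\setminus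 L_0(\Gamma)$; $L_2(\Gamma)$ is the closure of the set of cluster points of $\Gamma K$, $K$ running over the compact subsets of $\mathbb{P}^2_{\mathbb{C}}\setminus(L_0(\Gamma)\cup L_1(\Gamma))$. $\Lambda(\Gamma)=L_0(\Gamma)\cup L_1(\Gamma)\cup L_2(\Gamma)$ and $\Omega(\Gamma)=\mathbb{P}^2_{\mathbb{C}}\setminus\Lambda(\Gamma)$. For a non-empty open $\Omega\subset\mathbb{P}^2_{\mathbb{C}}$, $Li(\Omega)$ denotes the number of complex lines contained in $\mathbb{P}^2_{\mathbb{C}}\setminus\Omega$ ($\infty$ if there are infinitely many).
   Formalization: The discrete subgroup Γ is assumed to be infinite; for every finite Γ all three kinds of Ω equal the whole projective plane, so Li(Ω) = 0 and the claim as stated fails. *)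

theory Defs
  imports "HOL-Analysis.Analysis" "HOL-Algebra.Group"
begin

section \<open>The complex projective plane\<close>

definition cp2_rel :: "complex ^ 3 \<Rightarrow> complex ^ 3 \<Rightarrow> bool" where
  "cp2_rel u v \<longleftrightarrow> u \<noteq> 0 \<and> v \<noteq> 0 \<and> (\<exists>c. v = c *s u)"

quotient_type cp2 = "complex ^ 3" / partial: cp2_rel
proof (rule part_equivpI)
  show "\<exists>x. cp2_rel x x"
    by (rule exI[of _ "axis 1 1"]) (auto simp: cp2_rel_def axis_eq_0_iff intro: exI[of _ 1])
  show "symp cp2_rel"
  proof (rule sympI)
    fix u v assume "cp2_rel u v"
    then obtain c where "u \<noteq> 0" "v \<noteq> 0" "v = c *s u" by (auto simp: cp2_rel_def)
    moreover from this have "c \<noteq> 0" by auto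
    ultimately have "u = inverse c *s v" by (simp add: vec_eq_iff)
    then show "cp2_rel v u" using \<open>u \<noteq> 0\<close> \<open>v \<noteq> 0\<close> by (auto simp: cp2_rel_def)
  qed
  show "transp cp2_rel"
    by (rule transpI) (auto simp: cp2_rel_def vector_smult_assoc)
qed

text \<open>The class of a nonzero vector; the value at \<open>0\<close> is irrelevant.\<close>

definition proj :: "complex ^ 3 \<Rightarrow> cp2" where
  "proj v = abs_cp2 v"

lemma proj_eq_iff:
  "u \<noteq> 0 \<Longrightarrow> v \<noteq> 0 \<Longrightarrow> proj u = proj v \<longleftrightarrow> (\<exists>c. v = c *s u)"
  using Quotient_rel[OF Quotient_cp2, of u v]
  by (auto simp: proj_def cp2_rel_def intro: exI[of _ 1])

lemma proj_surj: "\<exists>v. v \<noteq> 0 \<and> proj v = x"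
proof -
  have "cp2_rel (rep_cp2 x) (rep_cp2 x)"
    using Quotient_rep_reflp[OF Quotient_cp2] .
  moreover have "abs_cp2 (rep_cp2 x) = x"
    using Quotient_abs_rep[OF Quotient_cp2] .
  ultimately show ?thesis
    unfolding proj_def cp2_rel_def by blast
qed

text \<open>The orthogonal projection of \<open>\<complex>\<^sup>3\<close> onto the line spanned by \<open>v\<close>.\<close>

definition line_projector :: "complex ^ 3 \<Rightarrow> complex ^ 3 ^ 3" where
  "line_projector v = (\<chi> i j. v $ i * cnj (v $ j) / (\<Sum>k\<in>UNIV. v $ k * cnj (v $ k)))"

lemma hermitian_square_eq:
  "(\<Sum>k\<in>UNIV. v $ k * cnj (v $ k)) = of_real (\<Sum>k\<in>UNIV. (cmod (v $ k))\<^sup>2)"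
  for v :: "complex ^ 3"
  unfolding of_real_sum by (intro sum.cong refl) (rule complex_norm_square [symmetric])

lemma hermitian_square_nonzero:
  fixes v :: "complex ^ 3"
  assumes "v \<noteq> 0"
  shows "(\<Sum>k\<in>UNIV. v $ k * cnj (v $ k)) \<noteq> 0"
proof
  assume "(\<Sum>k\<in>UNIV. v $ k * cnj (v $ k)) = 0"
  then have "(\<Sum>k\<in>UNIV. (cmod (v $ k))\<^sup>2) = 0"
    unfolding hermitian_square_eq using of_real_eq_0_iff by blast
  then have "\<forall>k. v $ k = 0"
    by (simp add: sum_nonneg_eq_0_iff)
  then show False using assms by (simp add: vec_eq_iff)
qed

lemma line_projector_apply:
  "line_projector v *v w =
     ((\<Sum>j\<in>UNIV. cnj (v $ j) * w $ j) / (\<Sum>k\<in>UNIV. v $ k * cnj (v $ k))) *s v"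
  by (simp add: line_projector_def vec_eq_iff matrix_vector_mult_def sum_distrib_left
        sum_distrib_right sum_divide_distrib mult_ac)

lemma line_projector_self: "v \<noteq> 0 \<Longrightarrow> line_projector v *v v = v"
  using hermitian_square_nonzero[of v]
  by (simp add: line_projector_apply mult.commute)

lift_definition cp2_projector :: "cp2 \<Rightarrow> complex ^ 3 ^ 3" is line_projector
proof -
  fix u v assume "cp2_rel u v"
  then obtain c where c: "v = c *s u" "u \<noteq> 0" "v \<noteq> 0" by (auto simp: cp2_rel_def)
  then have "c \<noteq> 0" by auto
  have "(\<Sum>k\<in>UNIV. v $ k * cnj (v $ k)) = (c * cnj c) * (\<Sum>k\<in>UNIV. u $ k * cnj (u $ k))"
    by (simp add: c sum_distrib_left mult_ac)
  then show "line_projector u = line_projector v"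
    using \<open>c \<noteq> 0\<close> by (simp add: line_projector_def c vec_eq_iff divide_simps mult_ac)
qed

lemma cp2_projector_proj: "v \<noteq> 0 \<Longrightarrow> cp2_projector (proj v) = line_projector v"
  unfolding proj_def by (rule cp2_projector.abs_eq) (auto simp: cp2_rel_def intro: exI[of _ 1])

lemma cp2_projector_inject:
  assumes "cp2_projector x = cp2_projector y" shows "x = y"
proof -
  obtain u v where uv: "u \<noteq> 0" "proj u = x" "v \<noteq> 0" "proj v = y"
    using proj_surj by metis
  then have "line_projector u = line_projector v"
    using assms cp2_projector_proj by metis
  then have "v = line_projector u *v v"
    using line_projector_self[OF uv(3)] by simp
  then show ?thesis
    using uv proj_eq_iff[OF uv(1) uv(3)] unfolding line_projector_apply by metis
qed

lemma continuous_on_line_projector: "continuous_on (- {0}) line_projector"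
  unfolding line_projector_def
  by (intro continuous_on_vec_lambda continuous_intros) (use hermitian_square_nonzero in auto)

text \<open>
  The open sets are those of the quotient topology of \<open>\<complex>\<^sup>3 - {0}\<close>. The distance, needed to speak of
  uniform convergence, is \<open>sqrt 2\<close> times the sine of the Fubini--Study angle; any other metric
  inducing the topology gives the same uniform structure, as the plane is compact.
\<close>

instantiation cp2 :: metric_space
begin

definition dist_cp2 :: "cp2 \<Rightarrow> cp2 \<Rightarrow> real" where
  "dist_cp2 x y = dist (cp2_projector x) (cp2_projector y)"

definition uniformity_cp2 :: "(cp2 \<times> cp2) filter" where
  "uniformity_cp2 = (INF e\<in>{0 <..}. principal {(x, y). dist x y < e})"

definition open_cp2 :: "cp2 set \<Rightarrow> bool" where
  "open_cp2 U \<longleftrightarrow> open {v. v \<noteq> 0 \<and> proj v \<in> U}"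

instance
proof
  show "uniformity = (INF e\<in>{0 <..}. principal {(x, y :: cp2). dist x y < e})"
    by (rule uniformity_cp2_def)
  show "dist x y = 0 \<longleftrightarrow> x = y" for x y :: cp2
    by (auto simp: dist_cp2_def dest: cp2_projector_inject)
  show "dist x y \<le> dist x z + dist y z" for x y z :: cp2
    by (simp add: dist_cp2_def dist_triangle2)
  show "open U \<longleftrightarrow> (\<forall>x\<in>U. \<forall>\<^sub>F (x', y) in uniformity. x' = x \<longrightarrow> y \<in> U)" for U :: "cp2 set"
  proof -
    let ?S = "{v. v \<noteq> 0 \<and> proj v \<in> U}"
    have "(\<forall>\<^sub>F (x', y) in uniformity. x' = x \<longrightarrow> y \<in> U) \<longleftrightarrow> (\<exists>e>0. \<forall>y. dist x y < e \<longrightarrow> y \<in> U)" for x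
    proof -
      have "(\<forall>\<^sub>F p in uniformity. P p) \<longleftrightarrow> (\<exists>e>0. \<forall>x y :: cp2. dist x y < e \<longrightarrow> P (x, y))" for P
        unfolding uniformity_cp2_def
        by (subst eventually_INF_base)
           (auto simp: eventually_principal subset_eq intro: bexI[of _ "min _ _"])
      then show ?thesis by auto
    qed
    moreover have "open ?S \<longleftrightarrow> (\<forall>x\<in>U. \<exists>e>0. \<forall>y. dist x y < e \<longrightarrow> y \<in> U)"
    proof
      assume S: "open ?S"
      show "\<forall>x\<in>U. \<exists>e>0. \<forall>y. dist x y < e \<longrightarrow> y \<in> U"
      proof
        fix x assume "x \<in> U"
        obtain v where v: "v \<noteq> 0" "proj v = x" using proj_surj by blast
        have "isCont (\<lambda>A :: complex ^ 3 ^ 3. A *v v) A" for A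
          unfolding matrix_vector_mult_def isCont_def by (intro tendsto_intros)
        then have "((\<lambda>A. A *v v) \<longlongrightarrow> v) (at (line_projector v))"
          using line_projector_self[OF v(1)] by (metis isCont_def)
        moreover have "v \<in> ?S" using v \<open>x \<in> U\<close> by simp
        ultimately have "\<forall>\<^sub>F A in at (line_projector v). A *v v \<in> ?S"
          using S topological_tendstoD by blast
        then obtain e where e: "e > 0"
          "\<And>A. A \<noteq> line_projector v \<Longrightarrow> dist A (line_projector v) < e \<Longrightarrow> A *v v \<in> ?S"
          unfolding eventually_at by blast
        have "y \<in> U" if y: "dist x y < e" for y
        proof -
          obtain w where w: "w \<noteq> 0" "proj w = y" using proj_surj by blast
          have "dist (line_projector w) (line_projector v) < e"
            using y v w by (metis cp2_projector_proj dist_commute dist_cp2_def)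
          then have "line_projector w *v v \<in> ?S"
            using e(2) \<open>v \<in> ?S\<close> line_projector_self[OF v(1)] by metis
          then obtain c where c: "c *s w \<noteq> 0" "proj (c *s w) \<in> U"
            unfolding line_projector_apply by blast
          then have "proj w = proj (c *s w)"
            using proj_eq_iff[OF w(1)] by blast
          then show ?thesis using c w by simp
        qed
        then show "\<exists>e>0. \<forall>y. dist x y < e \<longrightarrow> y \<in> U" using e(1) by blast
      qed
    next
      assume U: "\<forall>x\<in>U. \<exists>e>0. \<forall>y. dist x y < e \<longrightarrow> y \<in> U"
      show "open ?S"
        unfolding open_dist
      proof
        fix v assume "v \<in> ?S"
        then have v: "v \<noteq> 0" "proj v \<in> U" by auto
        then obtain e where e: "e > 0" "\<And>y. dist (proj v) y < e \<Longrightarrow> y \<in> U" using U by blast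
        have "isCont line_projector v"
          using continuous_on_line_projector v(1)
          by (simp add: continuous_on_eq_continuous_at open_Compl)
        then obtain d where d: "d > 0"
          "\<And>w. dist w v < d \<Longrightarrow> dist (line_projector w) (line_projector v) < e"
          using e(1) unfolding continuous_at_eps_delta by blast
        have "w \<in> ?S" if w: "dist w v < min d (norm v)" for w
        proof -
          have "w \<noteq> 0" using w by auto
          then have "dist (proj v) (proj w) < e"
            using d(2)[of w] w v by (simp add: dist_cp2_def cp2_projector_proj dist_commute)
          then show ?thesis using e(2) \<open>w \<noteq> 0\<close> by blast
        qed
        then show "\<exists>e>0. \<forall>w. dist w v < e \<longrightarrow> w \<in> ?S"
          using d(1) v(1) by (intro exI[of _ "min d (norm v)"]) auto
      qed
    qed
    ultimately show ?thesis unfolding open_cp2_def by simp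
  qed
qed

end

definition complex_line :: "cp2 set \<Rightarrow> bool" where
  "complex_line l \<longleftrightarrow> (\<exists>W. vec.subspace W \<and> vec.dim W = 2 \<and> l = proj ` (W - {0}))"


section \<open>The group \<open>PSL(3,\<complex>)\<close>\<close>

definition psl3_rel :: "complex ^ 3 ^ 3 \<Rightarrow> complex ^ 3 ^ 3 \<Rightarrow> bool" where
  "psl3_rel A B \<longleftrightarrow> det A = 1 \<and> det B = 1 \<and> (\<exists>c. c ^ 3 = 1 \<and> B = mat c ** A)"

lemma mat_mult_nth: "(mat c ** A) $ i $ j = c * A $ i $ j"
  for A :: "complex ^ 3 ^ 3"
  by (simp add: matrix_matrix_mult_def mat_def if_distrib if_distribR cong: if_cong)

lemma mult_mat_nth: "(A ** mat c) $ i $ j = c * A $ i $ j"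
  for A :: "complex ^ 3 ^ 3"
  by (simp add: matrix_matrix_mult_def mat_def if_distrib if_distribR cong: if_cong)

lemma mat_mult_commute: "A ** mat c = mat c ** A"
  for A :: "complex ^ 3 ^ 3"
  by (simp add: vec_eq_iff mat_mult_nth mult_mat_nth)

lemma mat_mult_mat: "mat c ** (mat d :: complex ^ 3 ^ 3) = mat (c * d)"
  by (simp add: vec_eq_iff mat_mult_nth) (simp add: mat_def)

lemma mat_mult_vec: "(mat c ** A) *v v = c *s (A *v v)"
  for A :: "complex ^ 3 ^ 3"
  by (simp add: vec_eq_iff matrix_vector_mult_def mat_mult_nth sum_distrib_left mult_ac)

quotient_type psl3 = "complex ^ 3 ^ 3" / partial: psl3_rel
proof (rule part_equivpI)
  show "\<exists>A. psl3_rel A A"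
    by (rule exI[of _ "mat 1"]) (auto simp: psl3_rel_def intro: exI[of _ 1])
  show "symp psl3_rel"
  proof (rule sympI)
    fix A B assume "psl3_rel A B"
    then obtain c where c: "det A = 1" "det B = 1" "c ^ 3 = 1" "B = mat c ** A"
      by (auto simp: psl3_rel_def)
    then have "c \<noteq> 0" by auto
    then have "A = mat (inverse c) ** B"
      by (simp add: c(4) matrix_mul_assoc mat_mult_mat)
    moreover have "inverse c ^ 3 = 1" using c(3) by (simp add: power_inverse)
    ultimately show "psl3_rel B A" using c by (auto simp: psl3_rel_def)
  qed
  show "transp psl3_rel"
  proof (rule transpI)
    fix A B C assume "psl3_rel A B" "psl3_rel B C"
    then obtain c d where "det A = 1" "det C = 1" "c ^ 3 = 1" "d ^ 3 = 1"
      "C = mat (d * c) ** A"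
      by (auto simp: psl3_rel_def matrix_mul_assoc mat_mult_mat)
    then show "psl3_rel A C"
      by (auto simp: psl3_rel_def power_mult_distrib intro!: exI[of _ "d * c"])
  qed
qed

lift_definition psl3_one :: psl3 is "mat 1"
  by (auto simp: psl3_rel_def intro: exI[of _ 1])

lift_definition psl3_mult :: "psl3 \<Rightarrow> psl3 \<Rightarrow> psl3" is "(**)"
proof -
  fix A A' B B' assume "psl3_rel A A'" "psl3_rel B B'"
  then obtain c d where c: "det A = 1" "det A' = 1" "c ^ 3 = 1" "A' = mat c ** A"
    and d: "det B = 1" "det B' = 1" "d ^ 3 = 1" "B' = mat d ** B"
    by (auto simp: psl3_rel_def)
  have "A' ** B' = mat c ** (A ** mat d) ** B"
    by (simp add: c d matrix_mul_assoc)
  also have "\<dots> = mat (c * d) ** (A ** B)"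
    unfolding mat_mult_commute[of A] by (simp add: matrix_mul_assoc mat_mult_mat)
  finally show "psl3_rel (A ** B) (A' ** B')"
    unfolding psl3_rel_def
    using c(1,2,3) d(1,2,3)
    by (metis det_mul mult.right_neutral power_mult_distrib)
qed

definition PSL3 :: "psl3 monoid" where
  "PSL3 = \<lparr>carrier = UNIV, mult = psl3_mult, one = psl3_one\<rparr>"

lemma group_PSL3: "group PSL3"
proof (rule groupI)
  show "x \<otimes>\<^bsub>PSL3\<^esub> y \<otimes>\<^bsub>PSL3\<^esub> z = x \<otimes>\<^bsub>PSL3\<^esub> (y \<otimes>\<^bsub>PSL3\<^esub> z)" for x y z
    unfolding PSL3_def monoid.simps
    by transfer (auto simp: psl3_rel_def det_mul matrix_mul_assoc intro!: exI[of _ 1])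
  show "\<one>\<^bsub>PSL3\<^esub> \<otimes>\<^bsub>PSL3\<^esub> x = x" for x
    unfolding PSL3_def monoid.simps
    by transfer (auto simp: psl3_rel_def)
  have "\<exists>y. psl3_mult y x = psl3_one" for x
  proof -
    obtain A where A: "psl3_rel A A" "x = abs_psl3 A"
      by (metis Quotient_psl3 Quotient_abs_rep Quotient_rep_reflp)
    then have "det A = 1" by (simp add: psl3_rel_def)
    then obtain B where B: "B ** A = mat 1"
      by (metis invertible_det_nz invertible_def one_neq_zero)
    then have "det B = 1" using \<open>det A = 1\<close> by (metis det_I det_mul mult.right_neutral)
    then have "psl3_rel B B" by (auto simp: psl3_rel_def intro!: exI[of _ 1])
    then have "psl3_mult (abs_psl3 B) x = psl3_one"
      using A B psl3_mult.abs_eq by (metis psl3_one.abs_eq)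
    then show ?thesis by blast
  qed
  then show "\<exists>y\<in>carrier PSL3. y \<otimes>\<^bsub>PSL3\<^esub> x = \<one>\<^bsub>PSL3\<^esub>" for x
    by (simp add: PSL3_def)
qed (auto simp: PSL3_def)

text \<open>The quotient topology of \<open>SL(3,\<complex>)\<close>.\<close>

instantiation psl3 :: topological_space
begin

definition open_psl3 :: "psl3 set \<Rightarrow> bool" where
  "open_psl3 U \<longleftrightarrow> openin (top_of_set {A. det A = 1}) {A. det A = 1 \<and> abs_psl3 A \<in> U}"

instance
proof
  show "open (UNIV :: psl3 set)"
    using openin_topspace[of "top_of_set {A :: complex ^ 3 ^ 3. det A = 1}"]
    by (simp add: open_psl3_def)
  show "open (S \<inter> T)" if "open S" "open T" for S T :: "psl3 set"
  proof -
    have eq: "{A. det A = 1 \<and> abs_psl3 A \<in> S \<inter> T} =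
        {A. det A = 1 \<and> abs_psl3 A \<in> S} \<inter> {A. det A = 1 \<and> abs_psl3 A \<in> T}" by blast
    show ?thesis
      using that unfolding open_psl3_def eq by (rule openin_Int)
  qed
  show "open (\<Union>K)" if "\<forall>S\<in>K. open S" for K :: "psl3 set set"
  proof -
    have eq: "{A. det A = 1 \<and> abs_psl3 A \<in> \<Union>K} =
        (\<Union>S\<in>K. {A. det A = 1 \<and> abs_psl3 A \<in> S})" by blast
    show ?thesis
      using that unfolding open_psl3_def eq by (intro openin_Union) blast
  qed
qed

end

lift_definition psl3_act :: "psl3 \<Rightarrow> cp2 \<Rightarrow> cp2" is "(*v)"
proof -
  fix A B :: "complex ^ 3 ^ 3" and u v
  assume "psl3_rel A B" "cp2_rel u v"
  then obtain c d where c: "det A = 1" "det B = 1" "c ^ 3 = 1" "B = mat c ** A"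
    and d: "u \<noteq> 0" "v \<noteq> 0" "v = d *s u"
    by (auto simp: psl3_rel_def cp2_rel_def)
  have nz: "M *v w \<noteq> 0" if "det M = 1" "w \<noteq> 0" for M :: "complex ^ 3 ^ 3" and w
    using that by (metis invertible_det_nz invertible_def matrix_left_invertible_ker one_neq_zero)
  have "B *v v = (c * d) *s (A *v u)"
    by (simp add: c(4) d(3) mat_mult_vec vec.scale)
  then show "cp2_rel (A *v u) (B *v v)"
    using nz c d unfolding cp2_rel_def by blast
qed


section \<open>Equicontinuity set, Kulkarni limit set, regions of proper discontinuity\<close>

text \<open>
  The limit \<open>g\<close> is a map into the whole plane and only its values on \<open>U\<close> matter; it need not belong
  to the family.
\<close>

definition normal_family_on :: "cp2 set \<Rightarrow> (cp2 \<Rightarrow> cp2) set \<Rightarrow> bool" where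
  "normal_family_on U F \<longleftrightarrow>
     (\<forall>f :: nat \<Rightarrow> cp2 \<Rightarrow> cp2. range f \<subseteq> F \<longrightarrow>
        (\<exists>r g. strict_mono r \<and>
           (\<forall>K. compact K \<and> K \<subseteq> U \<longrightarrow> uniform_limit K (f \<circ> r) g sequentially)))"

definition Eq :: "psl3 set \<Rightarrow> cp2 set" where
  "Eq \<Gamma> = {z. \<exists>U. open U \<and> z \<in> U \<and> normal_family_on U (psl3_act ` \<Gamma>)}"

text \<open>Infinitely many group elements are required, not infinitely many distinct translates of \<open>A\<close>.\<close>

definition cluster_points :: "psl3 set \<Rightarrow> cp2 set \<Rightarrow> cp2 set" where
  "cluster_points \<Gamma> A =
     {p. \<forall>U. open U \<and> p \<in> U \<longrightarrow> infinite {\<gamma> \<in> \<Gamma>. U \<inter> psl3_act \<gamma> ` A \<noteq> {}}}"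

definition L0 :: "psl3 set \<Rightarrow> cp2 set" where
  "L0 \<Gamma> = closure {z. infinite {\<gamma> \<in> \<Gamma>. psl3_act \<gamma> z = z}}"

definition L1 :: "psl3 set \<Rightarrow> cp2 set" where
  "L1 \<Gamma> = closure (\<Union>z \<in> - L0 \<Gamma>. cluster_points \<Gamma> {z})"

definition L2 :: "psl3 set \<Rightarrow> cp2 set" where
  "L2 \<Gamma> = closure (\<Union>K \<in> {K. compact K \<and> K \<subseteq> - (L0 \<Gamma> \<union> L1 \<Gamma>)}. cluster_points \<Gamma> K)"

definition kulkarni_limit_set :: "psl3 set \<Rightarrow> cp2 set" where
  "kulkarni_limit_set \<Gamma> = L0 \<Gamma> \<union> L1 \<Gamma> \<union> L2 \<Gamma>"

definition kulkarni_region :: "psl3 set \<Rightarrow> cp2 set" where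
  "kulkarni_region \<Gamma> = - kulkarni_limit_set \<Gamma>"

definition prop_disc_region :: "psl3 set \<Rightarrow> cp2 set \<Rightarrow> bool" where
  "prop_disc_region \<Gamma> \<Omega> \<longleftrightarrow>
     \<Omega> \<noteq> {} \<and> open \<Omega> \<and> (\<Union>\<gamma>\<in>\<Gamma>. psl3_act \<gamma> ` \<Omega>) = \<Omega> \<and>
     (\<forall>K. compact K \<and> K \<subseteq> \<Omega> \<longrightarrow> finite {\<gamma> \<in> \<Gamma>. psl3_act \<gamma> ` K \<inter> K \<noteq> {}})"

definition maximal_prop_disc_region :: "psl3 set \<Rightarrow> cp2 set \<Rightarrow> bool" where
  "maximal_prop_disc_region \<Gamma> \<Omega> \<longleftrightarrow>
     prop_disc_region \<Gamma> \<Omega> \<and> \<not> (\<exists>\<Omega>'. prop_disc_region \<Gamma> \<Omega>' \<and> \<Omega> \<subset> \<Omega>')"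

definition lines_outside :: "cp2 set \<Rightarrow> cp2 set set" where
  "lines_outside \<Omega> = {l. complex_line l \<and> l \<subseteq> - \<Omega>}"

definition Li :: "cp2 set \<Rightarrow> enat" where
  "Li \<Omega> = (if finite (lines_outside \<Omega>) then enat (card (lines_outside \<Omega>)) else \<infinity>)"

end

theory Submission
  imports Defs
begin

text \<open>
  Suitably scaled lifts of a sequence of distinct elements of \<open>\<Gamma>\<close> and of their inverses converge,
  along a subsequence, to non-zero matrices \<open>A\<close> and \<open>B\<close>; discreteness forces \<open>A B = B A = 0\<close>, so one
  of them has rank one. From this, \<open>\<Gamma>\<close> acts properly discontinuously on each of the three kinds of
  \<open>\<Omega>\<close>, and every such region misses a line: the kernel of \<open>A\<close> (of rank one, say) or a limit of
  translates of a line meeting that kernel in a point of \<open>\<Omega>\<close>.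

  Suppose that \<open>\<Omega>\<close> misses at least four but finitely many lines. A subgroup of finite index fixes
  all of them. Four eigenlines, whether or not three are concurrent, make every element of it a
  homology or elation \<open>v \<mapsto> v + \<psi>(v) e\<close> with a common centre \<open>e\<close>. If it has elations with
  independent \<open>\<psi>\<close>, their products together with their powers fix infinitely many lines pointwise, so
  these lines consist of points with infinite isotropy and \<open>\<Omega>\<close> misses them. Otherwise, after
  passing to a finite index subgroup, all \<open>\<psi>\<close> are multiples of one \<open>\<psi>\<^sub>0\<close>, the set
  \<open>C = ker \<psi>\<^sub>0 \<union> {e}\<close> contains all limit kernels and its points have infinite isotropy, and
  \<open>\<Omega> = - C\<close> misses a single line.
\<close>

section \<open>Linear algebra of the projective plane\<close>

text \<open>A sequence of projective maps may have no limit in the group, but its lifts, rescaled to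
  norm one, subconverge to nonzero matrices, singular when the elements are distinct; hence the work
  with lifts. Discreteness enters through one device, quotients of consecutive terms: if lifts of
  them tended to a nonzero scalar, they would eventually be trivial. This yields
  \<open>A ** B = 0\<close>, and later shows that the forms of the elations make up a discrete
  additive group. The number four comes from the dual plane, where invariant lines are eigenvectors:
  three in general position only make a matrix diagonal, but a further one forces two eigenvalues to
  agree. The last passage to finite index rests on conjugation, which multiplies the form of an
  elation by the eigenvalue of the conjugating element at \<open>e\<close>; discreteness leaves
  finitely many such eigenvalues. Without nontrivial elations all commutators are trivial, and
  commuting homologies with centre \<open>e\<close> off their axes have proportional forms. Infinity
  of \<Gamma> drives the lower bound: for a finite group the whole plane is the region, and no line
  is missed.\<close>

definition dot :: "complex ^ 3 \<Rightarrow> complex ^ 3 \<Rightarrow> complex" where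
  "dot \<phi> v = (\<Sum>i\<in>UNIV. \<phi> $ i * v $ i)"

text \<open>Like \<open>dot\<close>, bilinear without conjugation. A vector thus doubles as a linear
  form, and \<open>cross u v\<close> is both the form that vanishes on the span of \<open>u\<close>,
  \<open>v\<close> and the common zero of the forms \<open>u\<close>, \<open>v\<close>.\<close>

definition cross :: "complex ^ 3 \<Rightarrow> complex ^ 3 \<Rightarrow> complex ^ 3" where
  "cross u v = vector [u $ 2 * v $ 3 - u $ 3 * v $ 2, u $ 3 * v $ 1 - u $ 1 * v $ 3,
     u $ 1 * v $ 2 - u $ 2 * v $ 1]"

definition outer :: "complex ^ 3 \<Rightarrow> complex ^ 3 \<Rightarrow> complex ^ 3 ^ 3" where
  "outer a \<phi> = (\<chi> i j. a $ i * \<phi> $ j)"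

lemma dot_3: "dot \<phi> v = \<phi> $ 1 * v $ 1 + \<phi> $ 2 * v $ 2 + \<phi> $ 3 * v $ 3"
  by (simp add: dot_def sum_3)

lemma cross_nth [simp]:
  "cross u v $ 1 = u $ 2 * v $ 3 - u $ 3 * v $ 2"
  "cross u v $ 2 = u $ 3 * v $ 1 - u $ 1 * v $ 3"
  "cross u v $ 3 = u $ 1 * v $ 2 - u $ 2 * v $ 1"
  by (simp_all add: cross_def)

lemma dot_commute: "dot \<phi> v = dot v \<phi>"
  by (simp add: dot_def mult.commute)

lemma dot_simps [simp]:
  "dot (\<phi> + \<psi>) v = dot \<phi> v + dot \<psi> v" "dot \<phi> (v + w) = dot \<phi> v + dot \<phi> w"
  "dot (\<phi> - \<psi>) v = dot \<phi> v - dot \<psi> v" "dot \<phi> (v - w) = dot \<phi> v - dot \<phi> w"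
  "dot (c *s \<phi>) v = c * dot \<phi> v" "dot \<phi> (c *s v) = c * dot \<phi> v"
  "dot 0 v = 0" "dot \<phi> 0 = 0" "dot (- \<phi>) v = - dot \<phi> v" "dot \<phi> (- v) = - dot \<phi> v"
  by (simp_all add: dot_3 algebra_simps)

lemma dot_matrix_vector: "dot \<phi> (A *v v) = dot (\<phi> v* A) v"
  by (simp add: dot_3 matrix_vector_mult_def vector_matrix_mult_def sum_3 algebra_simps)

lemma outer_mult_vec: "outer a \<phi> *v v = dot \<phi> v *s a"
  by (simp add: vec_eq_iff outer_def matrix_vector_mult_def dot_def sum_distrib_left
      sum_distrib_right mult_ac)

lemma tendsto_dot [tendsto_intros]:
  "(f \<longlongrightarrow> a) F \<Longrightarrow> (g \<longlongrightarrow> b) F \<Longrightarrow> ((\<lambda>x. dot (f x) (g x)) \<longlongrightarrow> dot a b) F"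
  unfolding dot_def by (intro tendsto_intros)

lemma tendsto_matrix_vector [tendsto_intros]:
  fixes A :: "'b \<Rightarrow> complex ^ 3 ^ 3"
  shows "(A \<longlongrightarrow> a) F \<Longrightarrow> (g \<longlongrightarrow> b) F \<Longrightarrow> ((\<lambda>x. A x *v g x) \<longlongrightarrow> a *v b) F"
  unfolding matrix_vector_mult_def by (intro tendsto_intros)

lemma tendsto_matrix_matrix [tendsto_intros]:
  fixes A :: "'b \<Rightarrow> complex ^ 3 ^ 3"
  shows "(A \<longlongrightarrow> a) F \<Longrightarrow> (g \<longlongrightarrow> b) F \<Longrightarrow> ((\<lambda>x. A x ** g x) \<longlongrightarrow> a ** b) F"
  unfolding matrix_matrix_mult_def by (intro tendsto_intros)

lemma tendsto_vector_matrix [tendsto_intros]: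
  fixes A :: "'b \<Rightarrow> complex ^ 3 ^ 3"
  shows "(A \<longlongrightarrow> a) F \<Longrightarrow> (g \<longlongrightarrow> b) F \<Longrightarrow> ((\<lambda>x. g x v* A x) \<longlongrightarrow> b v* a) F"
  unfolding vector_matrix_mult_def by (intro tendsto_intros)

lemma tendsto_smult [tendsto_intros]:
  fixes g :: "'b \<Rightarrow> complex ^ 3"
  shows "(c \<longlongrightarrow> k) F \<Longrightarrow> (g \<longlongrightarrow> b) F \<Longrightarrow> ((\<lambda>x. c x *s g x) \<longlongrightarrow> k *s b) F"
  unfolding vector_scalar_mult_def by (intro tendsto_intros)

lemma tendsto_mat [tendsto_intros]:
  fixes c :: "'b \<Rightarrow> complex"
  assumes "(c \<longlongrightarrow> k) F" shows "((\<lambda>x. mat (c x) :: complex ^ 3 ^ 3) \<longlongrightarrow> mat k) F"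
proof (intro vec_tendstoI)
  show "((\<lambda>x. (mat (c x) :: complex ^ 3 ^ 3) $ i $ j) \<longlongrightarrow> mat k $ i $ j) F" for i j
    using assms by (cases "i = j") (auto simp: mat_def)
qed

lemma dot_separates:
  assumes "v \<noteq> 0" obtains \<phi> where "dot \<phi> v = 1"
proof -
  obtain i where i: "v $ i \<noteq> 0" using assms by (auto simp: vec_eq_iff)
  have "dot (axis i (1 / v $ i)) v = 1"
    using i by (simp add: dot_def axis_def if_distrib if_distribR cong: if_cong)
  then show ?thesis using that by blast
qed

lemma dot_ext: "(\<And>\<phi>. dot \<phi> v = 0) \<Longrightarrow> v = 0"
  using dot_separates zero_neq_one by metis

lemma dot_cross_triple: "dot (cross u v) w = dot u (cross v w)"
  by (simp add: dot_3 algebra_simps)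

lemma dot_cross_self [simp]: "dot (cross u v) u = 0" "dot (cross u v) v = 0"
  "dot u (cross u v) = 0" "dot v (cross u v) = 0"
  by (simp_all add: dot_3 algebra_simps)

lemma cross_cross: "cross u (cross v w) = dot u w *s v - dot u v *s w"
  by (simp add: vec_eq_iff forall_3 dot_3 algebra_simps)

lemma cross_eq_0:
  assumes "cross u v = 0" "u \<noteq> 0" shows "\<exists>c. v = c *s u"
proof -
  obtain w where w: "dot w u = 1" using dot_separates assms(2) by blast
  have "cross w (cross u v) = 0" using assms by (simp add: vec_eq_iff forall_3)
  then have "dot w v *s u = v" unfolding cross_cross w by simp
  then show ?thesis by metis
qed

lemma separate:
  assumes "e \<noteq> 0" "\<And>c. v \<noteq> c *s e"
  obtains \<phi> where "dot \<phi> e = 0" "dot \<phi> v = 1"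
proof -
  have "cross e v \<noteq> 0" using cross_eq_0 assms by blast
  then obtain \<eta> where "dot \<eta> (cross e v) = 1" using dot_separates by blast
  then have "dot (cross \<eta> e) v = 1" by (simp add: dot_cross_triple)
  then show ?thesis by (intro that[of "cross \<eta> e"]) simp_all
qed

lemma proportional:
  assumes "\<phi> \<noteq> 0" "\<And>v. dot \<phi> v = 0 \<Longrightarrow> dot \<eta> v = 0"
  shows "\<exists>c. \<eta> = c *s \<phi>"
proof (rule ccontr)
  assume "\<not> ?thesis"
  then obtain v where "dot v \<phi> = 0" "dot v \<eta> = 1" using separate assms(1) by metis
  then show False using assms(2)[of v] by (simp add: dot_commute)
qed

lemma orthogonal_to_two:
  assumes "cross u v \<noteq> 0" "dot \<eta> u = 0" "dot \<eta> v = 0"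
  shows "\<exists>c. \<eta> = c *s cross u v"
proof -
  have "cross \<eta> (cross u v) = 0" by (simp add: cross_cross assms)
  then have "cross (cross u v) \<eta> = 0" by (simp add: vec_eq_iff forall_3 algebra_simps)
  then show ?thesis using cross_eq_0 assms(1) by blast
qed

lemma in_span_of_two:
  assumes "cross u v \<noteq> 0" "dot (cross u v) w = 0"
  obtains a b where "w = a *s u + b *s v"
proof -
  obtain c where c: "dot c (cross u v) = 1" using dot_separates assms(1) by blast
  \<comment> \<open>Cramer's rule for the basis \<open>u\<close>, \<open>v\<close>,
    \<open>c\<close>: the coefficient of \<open>c\<close> vanishes by assumption.\<close>
  have "dot (cross u v) c *s w =
      dot (cross w v) c *s u + dot (cross u w) c *s v + dot (cross u v) w *s c"
    by (simp add: vec_eq_iff forall_3 dot_3 algebra_simps)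
  then show ?thesis using that c assms(2) by (simp add: dot_commute)
qed

text \<open>The rows of \<open>A\<close> annihilate the columns of \<open>B\<close>. Either these
  columns are all multiples of one, or two of them are independent and then the rows of
  \<open>A\<close> are multiples of their cross product.\<close>

lemma rank_one_of_product_zero:
  fixes A B :: "complex ^ 3 ^ 3"
  assumes "A \<noteq> 0" "B \<noteq> 0" "A ** B = 0"
  shows "(\<exists>a \<phi>. a \<noteq> 0 \<and> \<phi> \<noteq> 0 \<and> A = outer a \<phi>) \<or> (\<exists>b \<phi>. b \<noteq> 0 \<and> \<phi> \<noteq> 0 \<and> B = outer b \<phi>)"
proof -
  obtain i j where "B $ i $ j \<noteq> 0" using assms(2) by (auto simp: vec_eq_iff)
  then have b: "column j B \<noteq> 0" by (auto simp: vec_eq_iff column_def)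
  have orth: "dot (row k A) (column l B) = 0" for k l
  proof -
    have "dot (row k A) (column l B) = (A ** B) $ k $ l"
      by (simp add: dot_def row_def column_def matrix_matrix_mult_def)
    then show ?thesis using assms(3) by simp
  qed
  show ?thesis
  proof (cases "\<forall>l. \<exists>c. column l B = c *s column j B")
    case True
    then obtain c where c: "\<And>l. column l B = c l *s column j B" by metis
    have "B $ i $ l = column j B $ i * c l" for i l
      using arg_cong[OF c[of l], of "\<lambda>x. x $ i"] by (simp add: column_def mult.commute)
    then have "B = outer (column j B) (\<chi> l. c l)"
      by (simp add: vec_eq_iff outer_def)
    moreover from this assms(2) have "(\<chi> l. c l) \<noteq> 0"
      by (auto simp: outer_def vec_eq_iff)
    ultimately show ?thesis using b by blast
  next
    case False
    then obtain l where "\<And>c. column l B \<noteq> c *s column j B" by blast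
    then have n: "cross (column j B) (column l B) \<noteq> 0" using cross_eq_0 b by blast
    obtain c where c: "\<And>k. row k A = c k *s cross (column j B) (column l B)"
      using orthogonal_to_two[OF n orth orth] by metis
    have "A $ k $ l' = c k * cross (column j B) (column l B) $ l'" for k l'
      using arg_cong[OF c[of k], of "\<lambda>x. x $ l'"] by (simp add: row_def)
    then have "A = outer (\<chi> k. c k) (cross (column j B) (column l B))"
      by (simp add: vec_eq_iff outer_def)
    moreover from this assms(1) have "(\<chi> k. c k) \<noteq> 0"
      by (auto simp: outer_def vec_eq_iff)
    ultimately show ?thesis using n by blast
  qed
qed

section \<open>Complex lines as kernels of linear forms\<close>

definition pline :: "complex ^ 3 \<Rightarrow> cp2 set" where
  "pline \<phi> = {proj v |v. v \<noteq> 0 \<and> dot \<phi> v = 0}"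

lemma proj_smult: "c \<noteq> 0 \<Longrightarrow> v \<noteq> 0 \<Longrightarrow> proj (c *s v) = proj v"
  using proj_eq_iff[of v "c *s v"] by (auto simp: vec_eq_iff)

lemma proj_in_pline:
  assumes "v \<noteq> 0" shows "proj v \<in> pline \<phi> \<longleftrightarrow> dot \<phi> v = 0"
proof
  assume "proj v \<in> pline \<phi>"
  then obtain w where w: "w \<noteq> 0" "dot \<phi> w = 0" "proj w = proj v"
    unfolding pline_def by auto
  then obtain c where "v = c *s w" using proj_eq_iff assms by blast
  then show "dot \<phi> v = 0" using w by simp
qed (use assms in \<open>auto simp: pline_def\<close>)

lemma pline_smult: "c \<noteq> 0 \<Longrightarrow> pline (c *s \<phi>) = pline \<phi>"
  by (simp add: pline_def)

lemma pline_eqD: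
  assumes "pline \<phi> \<subseteq> pline \<psi>" "\<phi> \<noteq> 0"
  shows "\<exists>c. \<psi> = c *s \<phi>"
proof (rule proportional[OF assms(2)])
  show "dot \<psi> v = 0" if "dot \<phi> v = 0" for v
    using that assms proj_in_pline[of v] by (cases "v = 0") auto
qed

lemma complementary_vectors:
  assumes "\<phi> \<noteq> 0" obtains u v where "cross u v = \<phi>"
proof -
  obtain \<eta> where c: "dot \<eta> \<phi> = 1" using dot_separates assms by blast
  have "cross \<phi> (axis 1 1) \<noteq> 0 \<or> cross \<phi> (axis 2 1) \<noteq> 0"
    using assms by (auto simp: vec_eq_iff forall_3 axis_def)
  then obtain a where "cross \<phi> a \<noteq> 0" by blast
  then obtain \<eta> where x: "dot \<eta> (cross \<phi> a) = 1" using dot_separates by blast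
  \<comment> \<open>The double cross product is a multiple of \<phi>, with factor
    \<open>dot (cross \<phi> a) \<eta>\<close>; the choice of \<eta> makes it 1.\<close>
  have "cross (cross \<phi> a) (cross \<phi> \<eta>) = \<phi>"
    unfolding cross_cross using x by (simp add: dot_commute)
  then show ?thesis using that by blast
qed

text \<open>A plane in the vector space is traded for its annihilator, so that lines can be moved
  and passed to the limit as vectors.\<close>

lemma complex_line_iff: "complex_line l \<longleftrightarrow> (\<exists>\<phi>. \<phi> \<noteq> 0 \<and> l = pline \<phi>)"
proof
  assume "complex_line l"
  then obtain W where W: "vec.subspace W" "vec.dim W = 2" "l = proj ` (W - {0})"
    unfolding complex_line_def by blast
  obtain B where B: "B \<subseteq> W" "vec.independent B" "W \<subseteq> vec.span B" "card B = 2"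
    using vec.basis_exists[of W] W(2) by metis
  obtain u v where uv: "B = {u, v}" "u \<noteq> v" using B(4) by (meson card_2_iff)
  have "u \<noteq> 0" using B(2) uv vec.dependent_zero by blast
  have "cross u v \<noteq> 0"
  proof
    assume "cross u v = 0"
    then obtain c where "v = c *s u" using cross_eq_0 \<open>u \<noteq> 0\<close> by blast
    then have "v \<in> vec.span (B - {v})" using uv by (auto intro: vec.span_scale vec.span_base)
    then show False using B(2) uv unfolding vec.dependent_def by blast
  qed
  moreover have "W = {w. dot (cross u v) w = 0}"
  proof (intro equalityI subsetI)
    fix w assume "w \<in> W"
    then have "w \<in> vec.span {u, v}" using B uv by blast
    then show "w \<in> {w. dot (cross u v) w = 0}"
      by (auto simp: vec.span_insert) (metis add_cancel_right_right cancel_comm_monoid_add_class.diff_cancel diff_eq_eq dot_cross_self dot_simps(2,6) mult_zero_right)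
  next
    fix w assume "w \<in> {w. dot (cross u v) w = 0}"
    then obtain a b where "w = a *s u + b *s v"
      using in_span_of_two calculation by blast
    then show "w \<in> W" using W(1) B(1) uv
      by (auto intro!: vec.subspace_add vec.subspace_scale)
  qed
  ultimately show "\<exists>\<phi>. \<phi> \<noteq> 0 \<and> l = pline \<phi>"
    using W(3) unfolding pline_def by (intro exI[of _ "cross u v"]) auto
next
  assume "\<exists>\<phi>. \<phi> \<noteq> 0 \<and> l = pline \<phi>"
  then obtain \<phi> where f: "\<phi> \<noteq> 0" "l = pline \<phi>" by blast
  obtain u v where uv: "cross u v = \<phi>" using complementary_vectors f by blast
  have nz: "u \<noteq> 0" "v \<noteq> 0" using uv f by (auto simp: vec_eq_iff forall_3)
  have nm: "v \<noteq> c *s u" for c using uv f by (auto simp: vec_eq_iff forall_3)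
  let ?W = "{w. dot \<phi> w = 0}"
  have W: "?W = vec.span {u, v}"
  proof (intro equalityI subsetI)
    fix w assume "w \<in> ?W"
    then obtain a b where "w = a *s u + b *s v"
      using in_span_of_two[of u v] f uv by blast
    moreover have "u \<in> vec.span {u, v}" "v \<in> vec.span {u, v}"
      by (simp_all add: vec.span_base)
    ultimately show "w \<in> vec.span {u, v}"
      by (simp add: vec.span_add vec.span_scale)
  next
    have "vec.subspace ?W" by (auto simp: vec.subspace_def)
    moreover have "{u, v} \<subseteq> ?W" using uv by auto
    ultimately show "w \<in> vec.span {u, v} \<Longrightarrow> w \<in> ?W" for w
      using vec.span_minimal by blast
  qed
  have "vec.independent {v, u}"
    by (rule vec.independent_insertI) (use nz nm in \<open>auto simp: vec.span_singleton vec.dependent_single\<close>)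
  moreover have "u \<noteq> v" using nm[of 1] by auto
  ultimately have "vec.dim ?W = 2"
    unfolding W by (subst vec.dim_span_eq_card_independent) (auto simp: insert_commute)
  moreover have "vec.subspace ?W" by (auto simp: vec.subspace_def)
  ultimately show "complex_line l"
    unfolding complex_line_def f(2) pline_def by (intro exI[of _ ?W]) auto
qed

section \<open>Lifts of group elements and their limits\<close>

text \<open>Lifts of any nonzero determinant are allowed: norm-one lifts can then converge to a
  singular nonzero matrix, which lifts of determinant 1 cannot.\<close>

definition represents :: "psl3 \<Rightarrow> complex ^ 3 ^ 3 \<Rightarrow> bool" where
  "represents \<gamma> X \<longleftrightarrow> (\<exists>A c. det A = 1 \<and> \<gamma> = abs_psl3 A \<and> c \<noteq> 0 \<and> X = mat c ** A)"

abbreviation pinv :: "psl3 \<Rightarrow> psl3" where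
  "pinv \<gamma> \<equiv> inv\<^bsub>PSL3\<^esub> \<gamma>"

lemma det_mat_mult: "det (mat c ** A) = c ^ 3 * det A" for A :: "complex ^ 3 ^ 3"
  by (simp add: det_3 mat_mult_nth power3_eq_cube algebra_simps)

lemma abs_psl3_eq_iff:
  "det A = 1 \<Longrightarrow> det B = 1 \<Longrightarrow> abs_psl3 A = abs_psl3 B \<longleftrightarrow> (\<exists>c. c ^ 3 = 1 \<and> B = mat c ** A)"
  using Quotient_rel[OF Quotient_psl3, of A B]
  by (auto simp: psl3_rel_def intro: exI[of _ 1])

lemma psl3_rel_refl: "det A = 1 \<Longrightarrow> psl3_rel A A"
  by (auto simp: psl3_rel_def intro: exI[of _ 1])

lemma ex_abs_psl3: "\<exists>A. det A = 1 \<and> \<gamma> = abs_psl3 A"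
  by (metis Quotient_abs_rep Quotient_psl3 Quotient_rep_reflp psl3_rel_def)

lemma represents_abs: "det A = 1 \<Longrightarrow> represents (abs_psl3 A) A"
  unfolding represents_def by (intro exI[of _ A] exI[of _ 1]) simp

lemma represents_exists: "\<exists>X. represents \<gamma> X"
  using ex_abs_psl3 represents_abs by metis

lemma represents_scale:
  assumes "represents \<gamma> X" "c \<noteq> 0" shows "represents \<gamma> (mat c ** X)"
proof -
  obtain A d where A: "det A = 1" "\<gamma> = abs_psl3 A" "d \<noteq> 0" "X = mat d ** A"
    using assms(1) unfolding represents_def by blast
  then have "mat c ** X = mat (c * d) ** A" by (simp add: matrix_mul_assoc mat_mult_mat)
  moreover have "c * d \<noteq> 0" using A assms(2) by simp
  ultimately show ?thesis using A(1,2) unfolding represents_def by blast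
qed

lemma represents_det: "represents \<gamma> X \<Longrightarrow> det X \<noteq> 0"
  unfolding represents_def by (auto simp: det_mat_mult)

text \<open>Any cube root \<open>k\<close> of the determinant serves, since two of them differ by a
  cube root of unity, which is trivial in the quotient.\<close>

lemma represents_normalize:
  assumes "represents \<gamma> X" "k ^ 3 = det X"
  shows "\<gamma> = abs_psl3 (mat (1 / k) ** X)" "det (mat (1 / k) ** X) = 1"
proof -
  obtain A d where A: "det A = 1" "\<gamma> = abs_psl3 A" "d \<noteq> 0" "X = mat d ** A"
    using assms(1) unfolding represents_def by blast
  have k: "k \<noteq> 0" "k ^ 3 = d ^ 3"
    using assms(2) A by (auto simp: det_mat_mult)
  show d: "det (mat (1 / k) ** X) = 1"
    using A k by (simp add: det_mat_mult power_divide)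
  have "mat (1 / k) ** X = mat (d / k) ** A"
    by (simp add: A(4) matrix_mul_assoc mat_mult_mat)
  moreover have "(d / k) ^ 3 = 1" using k A(3) by (simp add: power_divide)
  ultimately show "\<gamma> = abs_psl3 (mat (1 / k) ** X)"
    unfolding A(2) using abs_psl3_eq_iff[OF A(1) d] by blast
qed

lemma represents_mult:
  assumes "represents \<gamma> X" "represents \<delta> Y"
  shows "represents (psl3_mult \<gamma> \<delta>) (X ** Y)"
proof -
  obtain A c where A: "det A = 1" "\<gamma> = abs_psl3 A" "c \<noteq> 0" "X = mat c ** A"
    using assms(1) unfolding represents_def by blast
  obtain B d where B: "det B = 1" "\<delta> = abs_psl3 B" "d \<noteq> 0" "Y = mat d ** B"
    using assms(2) unfolding represents_def by blast
  have "psl3_mult \<gamma> \<delta> = abs_psl3 (A ** B)"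
    unfolding A B by (rule psl3_mult.abs_eq) (use A B psl3_rel_refl in auto)
  moreover have "X ** Y = mat (c * d) ** (A ** B)"
  proof -
    have "X ** Y = mat c ** (A ** mat d) ** B" by (simp add: A B matrix_mul_assoc)
    then show ?thesis unfolding mat_mult_commute[of A] by (simp add: matrix_mul_assoc mat_mult_mat)
  qed
  moreover have "det (A ** B) = 1" using A B by (simp add: det_mul)
  ultimately show ?thesis unfolding represents_def using A B
    by (intro exI[of _ "A ** B"] exI[of _ "c * d"]) auto
qed

lemma represents_unique:
  assumes "represents \<gamma> X" "represents \<gamma> Y" shows "\<exists>c. c \<noteq> 0 \<and> Y = mat c ** X"
proof -
  obtain A c where A: "det A = 1" "\<gamma> = abs_psl3 A" "c \<noteq> 0" "X = mat c ** A"
    using assms(1) unfolding represents_def by blast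
  obtain B d where B: "det B = 1" "\<gamma> = abs_psl3 B" "d \<noteq> 0" "Y = mat d ** B"
    using assms(2) unfolding represents_def by blast
  obtain k where k: "k ^ 3 = 1" "B = mat k ** A" using abs_psl3_eq_iff A B by metis
  then have "k \<noteq> 0" by auto
  moreover have "Y = mat (d * k / c) ** X"
    by (simp add: A(4) B(4) k(2) matrix_mul_assoc mat_mult_mat A(3))
  ultimately show ?thesis using A B by (intro exI[of _ "d * k / c"]) auto
qed

lemma represents_inj:
  assumes "represents \<gamma> X" "represents \<delta> X" shows "\<gamma> = \<delta>"
proof -
  obtain A c where A: "det A = 1" "\<gamma> = abs_psl3 A" "c \<noteq> 0" "X = mat c ** A"
    using assms(1) unfolding represents_def by blast
  have "c ^ 3 = det X" using A by (simp add: det_mat_mult)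
  then show ?thesis using represents_normalize(1) assms by metis
qed

lemma represents_one: "represents psl3_one X \<longleftrightarrow> (\<exists>c. c \<noteq> 0 \<and> X = mat c)"
proof -
  have "represents psl3_one (mat 1)"
    unfolding psl3_one.abs_eq by (rule represents_abs) simp
  then show ?thesis using represents_unique[of _ "mat 1"] represents_scale[of _ "mat 1"] by force
qed

lemma nonsingular_mult_vec: "det A \<noteq> 0 \<Longrightarrow> v \<noteq> 0 \<Longrightarrow> A *v v \<noteq> 0" for A :: "complex ^ 3 ^ 3"
  by (metis invertible_det_nz invertible_def matrix_left_invertible_ker)

lemma represents_act:
  assumes "represents \<gamma> X" "v \<noteq> 0"
  shows "X *v v \<noteq> 0" "psl3_act \<gamma> (proj v) = proj (X *v v)"
proof -
  obtain A c where A: "det A = 1" "\<gamma> = abs_psl3 A" "c \<noteq> 0" "X = mat c ** A"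
    using assms(1) unfolding represents_def by blast
  show "X *v v \<noteq> 0" using represents_det nonsingular_mult_vec assms by blast
  have "psl3_act \<gamma> (proj v) = proj (A *v v)"
    unfolding A(2) proj_def
    by (rule psl3_act.abs_eq) (use A assms psl3_rel_refl in \<open>auto simp: cp2_rel_def intro: exI[of _ 1]\<close>)
  also have "\<dots> = proj (X *v v)"
    using A assms nonsingular_mult_vec[of A v] by (simp add: mat_mult_vec proj_smult)
  finally show "psl3_act \<gamma> (proj v) = proj (X *v v)" .
qed

section \<open>The group action and compactness of the plane\<close>

interpretation PSL3: group PSL3
  by (rule group_PSL3)

lemma psl3_group_simps [simp]:
  "psl3_mult \<gamma> (pinv \<gamma>) = psl3_one" "psl3_mult (pinv \<gamma>) \<gamma> = psl3_one"
  "psl3_mult \<gamma> psl3_one = \<gamma>" "psl3_mult psl3_one \<gamma> = \<gamma>"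
  "psl3_mult (pinv \<gamma>) (psl3_mult \<gamma> \<delta>) = \<delta>" "psl3_mult \<gamma> (psl3_mult (pinv \<gamma>) \<delta>) = \<delta>"
  "pinv (pinv \<gamma>) = \<gamma>"
  using PSL3.r_inv[of \<gamma>] PSL3.l_inv[of \<gamma>] PSL3.r_one[of \<gamma>] PSL3.l_one[of \<gamma>] PSL3.inv_inv[of \<gamma>]
    PSL3.m_assoc[of "pinv \<gamma>" \<gamma> \<delta>] PSL3.m_assoc[of \<gamma> "pinv \<gamma>" \<delta>] PSL3.l_one[of \<delta>]
  by (simp_all add: PSL3_def)

lemma psl3_mult_cancel: "psl3_mult \<gamma> \<delta> = psl3_mult \<gamma> \<delta>' \<longleftrightarrow> \<delta> = \<delta>'"
  by (metis psl3_group_simps(5))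

lemma psl3_mult_cancel_right: "psl3_mult \<delta> \<gamma> = psl3_mult \<delta>' \<gamma> \<longleftrightarrow> \<delta> = \<delta>'"
  using PSL3.right_cancel[of \<gamma> \<delta> \<delta>'] by (simp add: PSL3_def)

lemma inj_pinv: "inj pinv"
  by (metis injI psl3_group_simps(7))

lemma psl3_act_mult: "psl3_act (psl3_mult \<gamma> \<delta>) z = psl3_act \<gamma> (psl3_act \<delta> z)"
proof -
  obtain X Y where r: "represents \<gamma> X" "represents \<delta> Y" using represents_exists by metis
  obtain v where v: "v \<noteq> 0" "proj v = z" using proj_surj by blast
  show ?thesis
    using represents_act[OF represents_mult[OF r] v(1)] represents_act[OF r(2) v(1)]
      represents_act(2)[OF r(1), of "Y *v v"] v(2)
    by (simp add: matrix_vector_mul_assoc)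
qed

lemma psl3_act_one [simp]: "psl3_act psl3_one z = z"
proof -
  obtain v where v: "v \<noteq> 0" "proj v = z" using proj_surj by blast
  have "represents psl3_one (mat 1)" unfolding represents_one by (intro exI[of _ 1]) simp
  from represents_act(2)[OF this v(1)] show ?thesis using v(2) by simp
qed

lemma psl3_act_inv [simp]: "psl3_act (pinv \<gamma>) (psl3_act \<gamma> z) = z" "psl3_act \<gamma> (psl3_act (pinv \<gamma>) z) = z"
  by (simp_all flip: psl3_act_mult)

lemma represents_inverse:
  assumes "represents \<gamma> X" "represents (pinv \<gamma>) Y"
  shows "\<exists>c. c \<noteq> 0 \<and> X ** Y = mat c" "\<exists>c. c \<noteq> 0 \<and> Y ** X = mat c"
  using represents_mult[OF assms] represents_mult[OF assms(2,1)] represents_one by simp_all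

lemma represents_unit: "\<exists>X. represents \<gamma> X \<and> norm X = 1"
proof -
  obtain X where X: "represents \<gamma> X" using represents_exists by blast
  then have "X \<noteq> 0" using represents_det[OF X] by (auto simp: det_3)
  have eq: "mat (of_real (1 / norm X)) ** X = (1 / norm X) *\<^sub>R X"
    by (simp add: vec_eq_iff mat_mult_nth scaleR_conv_of_real[where 'a = complex])
  have "represents \<gamma> ((1 / norm X) *\<^sub>R X)"
    unfolding eq[symmetric] by (rule represents_scale[OF X]) (use \<open>X \<noteq> 0\<close> in simp)
  moreover have "norm ((1 / norm X) *\<^sub>R X) = 1" using \<open>X \<noteq> 0\<close> by simp
  ultimately show ?thesis by blast
qed

lemma proj_unit: "\<exists>v. norm v = 1 \<and> proj v = z"
proof -
  obtain v where v: "v \<noteq> 0" "proj v = z" using proj_surj by blast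
  have "complex_of_real (1 / norm v) *s v = (1 / norm v) *\<^sub>R v"
    by (simp add: vec_eq_iff scaleR_conv_of_real[where 'a = complex])
  then have "proj ((1 / norm v) *\<^sub>R v) = z"
    using proj_smult[of "complex_of_real (1 / norm v)" v] v by simp
  moreover have "norm ((1 / norm v) *\<^sub>R v) = 1" using v by simp
  ultimately show ?thesis by blast
qed

lemma tendsto_proj:
  assumes "(f \<longlongrightarrow> v) F" "v \<noteq> 0" shows "((\<lambda>x. proj (f x)) \<longlongrightarrow> proj v) F"
proof (rule topological_tendstoI)
  fix S assume S: "open S" "proj v \<in> S"
  then have "open {v. v \<noteq> 0 \<and> proj v \<in> S}" by (simp add: open_cp2_def)
  then have "\<forall>\<^sub>F x in F. f x \<in> {v. v \<noteq> 0 \<and> proj v \<in> S}"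
    by (rule topological_tendstoD[OF assms(1)]) (use S assms in simp)
  then show "\<forall>\<^sub>F x in F. proj (f x) \<in> S" by (rule eventually_mono) simp
qed

lemma compact_UNIV_cp2: "compact (UNIV :: cp2 set)"
proof -
  have "continuous_on (sphere 0 1) proj"
    unfolding continuous_on_def by (intro ballI tendsto_proj tendsto_ident_at) auto
  then have "compact (proj ` sphere 0 1)"
    by (rule compact_continuous_image) simp
  moreover have "z \<in> proj ` sphere 0 1" for z
    using proj_unit[of z] by (auto simp: image_iff)
  ultimately show ?thesis by (metis UNIV_eq_I)
qed

lemma compact_cp2: "closed K \<Longrightarrow> compact K" for K :: "cp2 set"
  using compact_Int_closed[OF compact_UNIV_cp2, of K] by simp

lemma unit_subsequence:
  fixes v :: "nat \<Rightarrow> 'a::euclidean_space"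
  assumes "\<And>n. norm (v n) = 1"
  obtains r w where "strict_mono r" "norm w = 1" "(\<lambda>n. v (r n)) \<longlonglongrightarrow> w"
proof -
  have "\<exists>w\<in>sphere 0 1. \<exists>r. strict_mono r \<and> (v \<circ> r) \<longlonglongrightarrow> w"
    using seq_compactE[OF compact_imp_seq_compact[OF compact_sphere[of 0 1]], of v] assms by force
  then show ?thesis using that by (auto simp: o_def)
qed

lemma continuous_on_psl3_act: "continuous_on S (psl3_act \<gamma>)"
proof -
  have "(psl3_act \<gamma> \<longlongrightarrow> psl3_act \<gamma> z) (at z)" for z
  proof (rule topological_tendstoI)
    fix U assume U: "open U" "psl3_act \<gamma> z \<in> U"
    obtain X where X: "represents \<gamma> X" using represents_exists by blast
    have "v \<noteq> 0 \<and> psl3_act \<gamma> (proj v) \<in> U \<longleftrightarrow> X *v v \<noteq> 0 \<and> proj (X *v v) \<in> U" for v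
      using represents_act[OF X, of v] by (cases "v = 0") simp_all
    then have eq: "{v. v \<noteq> 0 \<and> proj v \<in> psl3_act \<gamma> -` U} = (\<lambda>v. X *v v) -` {v. v \<noteq> 0 \<and> proj v \<in> U}"
      by (simp add: vimage_def)
    have "continuous_on UNIV (\<lambda>v. X *v v)"
      unfolding continuous_on_def by (intro ballI tendsto_intros tendsto_ident_at)
    moreover have "open {v. v \<noteq> 0 \<and> proj v \<in> U}" using U(1) by (simp add: open_cp2_def)
    ultimately have "open (psl3_act \<gamma> -` U)"
      unfolding open_cp2_def eq by (intro open_vimage)
    then show "\<forall>\<^sub>F w in at z. psl3_act \<gamma> w \<in> U"
      using U(2) unfolding eventually_at_topological by (intro exI[of _ "psl3_act \<gamma> -` U"]) auto
  qed
  then show ?thesis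
    by (meson continuous_at_imp_continuous_on isCont_def)
qed

lemma open_psl3_act:
  assumes "open U" shows "open (psl3_act \<gamma> ` U)"
proof -
  have "psl3_act \<gamma> ` U = psl3_act (pinv \<gamma>) -` U"
    by (auto intro: image_eqI[of _ _ "psl3_act (pinv \<gamma>) _"])
  then show ?thesis using assms continuous_on_psl3_act[of UNIV] by (simp add: open_vimage)
qed

text \<open>These are the pseudo-projective maps arising from \<Gamma>: away from the kernel of
  \<open>A\<close> the maps \<open>\<gamma> n\<close> converge to the one induced by
  \<open>A\<close>. Injectivity excludes constant sequences, whose limits are invertible.\<close>

definition limit_matrix :: "psl3 set \<Rightarrow> complex ^ 3 ^ 3 \<Rightarrow> bool" where
  "limit_matrix \<Gamma> A \<longleftrightarrow> A \<noteq> 0 \<and>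
     (\<exists>\<gamma> X. inj \<gamma> \<and> range \<gamma> \<subseteq> \<Gamma> \<and> (\<forall>n::nat. represents (\<gamma> n) (X n)) \<and> X \<longlonglongrightarrow> A)"

section \<open>Consequences of discreteness\<close>

locale discrete_subgroup =
  fixes \<Gamma> :: "psl3 set"
  assumes subgroup: "subgroup \<Gamma> PSL3" and discrete: "discrete \<Gamma>"
begin

lemma one_mem: "psl3_one \<in> \<Gamma>"
  using subgroup.one_closed[OF subgroup] by (simp add: PSL3_def)

lemma mult_mem: "\<gamma> \<in> \<Gamma> \<Longrightarrow> \<delta> \<in> \<Gamma> \<Longrightarrow> psl3_mult \<gamma> \<delta> \<in> \<Gamma>"
  using subgroup.m_closed[OF subgroup] by (simp add: PSL3_def)

lemma inv_mem: "\<gamma> \<in> \<Gamma> \<Longrightarrow> pinv \<gamma> \<in> \<Gamma>"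
  using subgroup.m_inv_closed[OF subgroup] by simp

text \<open>Discreteness speaks of the quotient topology, that is, of lifts of determinant 1.
  Dividing \<open>Y n\<close> by a cube root of its determinant produces such lifts, still tending
  to the identity.\<close>

lemma eventually_one:
  assumes "\<And>n. \<delta> n \<in> \<Gamma>" "\<And>n. represents (\<delta> n) (Y n)" "Y \<longlonglongrightarrow> mat 1"
  shows "\<forall>\<^sub>F n in sequentially. \<delta> n = psl3_one"
proof -
  obtain U where U: "open U" "U \<inter> \<Gamma> = {psl3_one}"
    using discrete one_mem unfolding discrete_def isolated_in_def by blast
  then obtain T where T: "open T" "{A. det A = 1 \<and> abs_psl3 A \<in> U} = {A. det A = 1} \<inter> T"
    unfolding open_psl3_def openin_open by blast
  have "mat 1 \<in> T" using T(2) U(2) psl3_one.abs_eq by force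
  \<comment> \<open>The principal branch is continuous at the limit determinant 1, so
    \<open>k\<close> tends to 1.\<close>
  define k where "k n = exp (Ln (det (Y n)) / 3)" for n
  have k: "k n ^ 3 = det (Y n)" for n
    using represents_det[OF assms(2)[of n]] unfolding k_def
    by (simp flip: exp_of_nat_mult)
  have "(\<lambda>n. det (Y n)) \<longlonglongrightarrow> det (mat 1 :: complex ^ 3 ^ 3)"
    unfolding det_3 by (intro tendsto_intros assms(3))
  then have "(\<lambda>n. det (Y n)) \<longlonglongrightarrow> 1" by simp
  then have "k \<longlonglongrightarrow> exp (Ln 1 / 3)"
    unfolding k_def by (intro tendsto_intros) auto
  then have "(\<lambda>n. mat (1 / k n) ** Y n) \<longlonglongrightarrow> mat (1 / 1) ** mat 1"
    by (intro tendsto_intros assms(3)) auto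
  then have "\<forall>\<^sub>F n in sequentially. mat (1 / k n) ** Y n \<in> T"
    using topological_tendstoD[OF _ T(1)] \<open>mat 1 \<in> T\<close> by fastforce
  then show ?thesis
  proof (rule eventually_mono)
    fix n assume "mat (1 / k n) ** Y n \<in> T"
    then have "\<delta> n \<in> U"
      using represents_normalize[OF assms(2) k, of n] T(2) by auto
    then show "\<delta> n = psl3_one" using U(2) assms(1) by blast
  qed
qed

lemma scalar_limit_zero:
  assumes "\<And>n. \<delta> n \<in> \<Gamma>" "\<And>n. represents (\<delta> n) (Y n)" "Y \<longlonglongrightarrow> mat k"
    "\<And>n. \<delta> n \<noteq> psl3_one"
  shows "k = 0"
proof (rule ccontr)
  assume "k \<noteq> 0"
  have "\<forall>\<^sub>F n in sequentially. \<delta> n = psl3_one"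
  proof (rule eventually_one)
    show "represents (\<delta> n) (mat (1 / k) ** Y n)" for n
      using represents_scale[OF assms(2)] \<open>k \<noteq> 0\<close> by simp
    have "(\<lambda>n. mat (1 / k) ** Y n) \<longlonglongrightarrow> mat (1 / k) ** mat k"
      by (intro tendsto_intros assms(3))
    then show "(\<lambda>n. mat (1 / k) ** Y n) \<longlonglongrightarrow> mat 1"
      using \<open>k \<noteq> 0\<close> by (simp add: mat_mult_mat)
  qed (rule assms)
  then show False using assms(4) by simp
qed

text \<open>\<open>X n ** Y n\<close> is scalar, hence so is \<open>A ** B\<close>. The shifted
  product \<open>X n ** Y (Suc n)\<close> has the same limit but represents a quotient of two
  distinct elements, so \<open>scalar_limit_zero\<close> makes the scalar 0. The other order is
  symmetric.\<close>

lemma limit_pair: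
  assumes "inj \<gamma>" "range \<gamma> \<subseteq> \<Gamma>"
  obtains r :: "nat \<Rightarrow> nat" and X Y A B where "strict_mono r"
    "\<And>n. represents (\<gamma> (r n)) (X n)" "\<And>n. represents (pinv (\<gamma> (r n))) (Y n)"
    "X \<longlonglongrightarrow> A" "Y \<longlonglongrightarrow> B" "A \<noteq> 0" "B \<noteq> 0" "A ** B = 0" "B ** A = 0"
    "limit_matrix \<Gamma> A" "limit_matrix \<Gamma> B"
proof -
  obtain X0 where X0: "\<And>n. represents (\<gamma> n) (X0 n)" "\<And>n. norm (X0 n) = 1"
    using choice[of "\<lambda>n X. represents (\<gamma> n) X \<and> norm X = 1"] represents_unit by blast
  obtain Y0 where Y0: "\<And>n. represents (pinv (\<gamma> n)) (Y0 n)" "\<And>n. norm (Y0 n) = 1"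
    using choice[of "\<lambda>n X. represents (pinv (\<gamma> n)) X \<and> norm X = 1"] represents_unit by blast
  obtain r A where r: "strict_mono r" "norm A = 1" "(\<lambda>n. X0 (r n)) \<longlonglongrightarrow> A"
    using unit_subsequence X0(2) by metis
  obtain s B where s: "strict_mono s" "norm B = 1" "(\<lambda>n. Y0 (r (s n))) \<longlonglongrightarrow> B"
    using unit_subsequence[of "\<lambda>n. Y0 (r n)"] Y0(2) by metis
  define X where "X n = X0 (r (s n))" for n
  define Y where "Y n = Y0 (r (s n))" for n
  let ?g = "\<lambda>n. \<gamma> (r (s n))"
  have rs: "strict_mono (\<lambda>n. r (s n))" using r s by (simp add: strict_mono_def)
  have X: "represents (?g n) (X n)" and Y: "represents (pinv (?g n)) (Y n)" for n
    using X0 Y0 by (auto simp: X_def Y_def)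
  have XA: "X \<longlonglongrightarrow> A"
    using LIMSEQ_subseq_LIMSEQ[OF r(3) s(1)] by (simp add: X_def[abs_def] o_def)
  have YB: "Y \<longlonglongrightarrow> B" using s(3) by (simp add: Y_def[abs_def])
  have scalar: "P = mat (P $ 1 $ 1)"
    if scal: "\<And>n. \<exists>c. c \<noteq> 0 \<and> Z n = mat c" and lim: "Z \<longlonglongrightarrow> P" for Z :: "nat \<Rightarrow> complex ^ 3 ^ 3" and P
  proof (rule LIMSEQ_unique[OF lim])
    have "Z n = mat (Z n $ 1 $ 1)" for n
    proof -
      obtain c where "Z n = mat c" using scal by blast
      moreover have "(mat c :: complex ^ 3 ^ 3) $ 1 $ 1 = c" by (simp add: mat_def)
      ultimately show ?thesis by simp
    qed
    then have "Z = (\<lambda>n. mat (Z n $ 1 $ 1))" by blast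
    moreover have "(\<lambda>n. mat (Z n $ 1 $ 1) :: complex ^ 3 ^ 3) \<longlonglongrightarrow> mat (P $ 1 $ 1)"
      by (intro tendsto_intros lim)
    ultimately show "Z \<longlonglongrightarrow> mat (P $ 1 $ 1)" by simp
  qed
  have mem: "?g n \<in> \<Gamma>" for n using assms(2) by blast
  have ne: "?g n \<noteq> ?g (Suc n)" for n
    using assms(1) rs by (metis inj_eq n_not_Suc_n strict_mono_eq)
  have "A ** B = mat ((A ** B) $ 1 $ 1)"
    by (rule scalar[of "\<lambda>n. X n ** Y n"]) (use represents_inverse[OF X Y] XA YB in \<open>auto intro: tendsto_intros\<close>)
  moreover have "(A ** B) $ 1 $ 1 = 0"
  proof (rule scalar_limit_zero)
    show "psl3_mult (?g n) (pinv (?g (Suc n))) \<in> \<Gamma>" for n using mem mult_mem inv_mem by blast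
    show "represents (psl3_mult (?g n) (pinv (?g (Suc n)))) (X n ** Y (Suc n))" for n
      by (rule represents_mult[OF X Y])
    have "(\<lambda>n. X n ** Y (Suc n)) \<longlonglongrightarrow> A ** B"
      by (intro tendsto_intros XA LIMSEQ_Suc[OF YB])
    then show "(\<lambda>n. X n ** Y (Suc n)) \<longlonglongrightarrow> mat ((A ** B) $ 1 $ 1)" using calculation by simp
    show "psl3_mult (?g n) (pinv (?g (Suc n))) \<noteq> psl3_one" for n
      using ne[of n] psl3_mult_cancel_right[of "?g n" "pinv (?g (Suc n))" "?g (Suc n)"] by simp
  qed
  ultimately have AB: "A ** B = 0" by (simp add: mat_0)
  have "B ** A = mat ((B ** A) $ 1 $ 1)"
    by (rule scalar[of "\<lambda>n. Y n ** X n"]) (use represents_inverse[OF X Y] XA YB in \<open>auto intro: tendsto_intros\<close>)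
  moreover have "(B ** A) $ 1 $ 1 = 0"
  proof (rule scalar_limit_zero)
    show "psl3_mult (pinv (?g n)) (?g (Suc n)) \<in> \<Gamma>" for n using mem mult_mem inv_mem by blast
    show "represents (psl3_mult (pinv (?g n)) (?g (Suc n))) (Y n ** X (Suc n))" for n
      by (rule represents_mult[OF Y X])
    have "(\<lambda>n. Y n ** X (Suc n)) \<longlonglongrightarrow> B ** A"
      by (intro tendsto_intros YB LIMSEQ_Suc[OF XA])
    then show "(\<lambda>n. Y n ** X (Suc n)) \<longlonglongrightarrow> mat ((B ** A) $ 1 $ 1)" using calculation by simp
    show "psl3_mult (pinv (?g n)) (?g (Suc n)) \<noteq> psl3_one" for n
      using ne[of n] psl3_mult_cancel[of "pinv (?g n)" "?g n" "?g (Suc n)"] by simp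
  qed
  ultimately have BA: "B ** A = 0" by (simp add: mat_0)
  have "A \<noteq> 0" "B \<noteq> 0" using r s by auto
  moreover have inj: "inj ?g"
    using inj_compose[OF assms(1) strict_mono_imp_inj_on[OF rs]] by (simp add: o_def)
  then have "limit_matrix \<Gamma> A"
    unfolding limit_matrix_def using \<open>A \<noteq> 0\<close> mem X XA by blast
  moreover have "inj (\<lambda>n. pinv (?g n))" using inj inj_pinv by (simp add: inj_def)
  then have "limit_matrix \<Gamma> B"
    unfolding limit_matrix_def using \<open>B \<noteq> 0\<close> mem inv_mem Y YB
    by (intro conjI exI[of _ "\<lambda>n. pinv (?g n)"] exI[of _ Y]) auto
  ultimately show ?thesis using that[OF rs X Y XA YB _ _ AB BA] by blast
qed

end

section \<open>Proper discontinuity\<close>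

lemma closed_pline: "closed (pline \<phi>)"
proof -
  have "{v. v \<noteq> 0 \<and> proj v \<in> - pline \<phi>} = {v. dot \<phi> v \<noteq> 0}"
  proof (intro Collect_cong)
    show "v \<noteq> 0 \<and> proj v \<in> - pline \<phi> \<longleftrightarrow> dot \<phi> v \<noteq> 0" for v
      using proj_in_pline[of v \<phi>] by (cases "v = 0") auto
  qed
  moreover have "continuous_on UNIV (dot \<phi>)"
    unfolding continuous_on_def by (intro ballI tendsto_intros tendsto_ident_at)
  then have "open (dot \<phi> -` (- {0}))" by (intro open_vimage) auto
  ultimately show ?thesis
    unfolding closed_def open_cp2_def by (simp add: vimage_def)
qed

text \<open>Each point of a limit line is a limit of points on the approximating lines: correct
  \<open>v\<close> along a fixed \<open>c\<close> on which the limit form is 1.\<close>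

lemma perturb_into_kernel:
  assumes "\<psi> \<longlonglongrightarrow> \<phi>" "\<phi> \<noteq> 0" "dot \<phi> v = 0"
  obtains x where "x \<longlonglongrightarrow> v" "\<forall>\<^sub>F n in sequentially. dot (\<psi> n) (x n) = 0"
proof -
  obtain c where c: "dot c \<phi> = 1" using dot_separates assms(2) by blast
  have lim: "(\<lambda>n. dot (\<psi> n) c) \<longlonglongrightarrow> 1"
    using tendsto_dot[OF assms(1) tendsto_const[of c]] c by (simp add: dot_commute)
  then have ev: "\<forall>\<^sub>F n in sequentially. dot (\<psi> n) c \<noteq> 0"
    by (rule tendsto_imp_eventually_ne) simp
  let ?x = "\<lambda>n. v - (dot (\<psi> n) v / dot (\<psi> n) c) *s c"
  have "?x \<longlonglongrightarrow> v - (dot \<phi> v / 1) *s c"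
    by (intro tendsto_intros assms(1) lim) simp
  then have "?x \<longlonglongrightarrow> v" using assms(3) by simp
  moreover have "\<forall>\<^sub>F n in sequentially. dot (\<psi> n) (?x n) = 0"
    using ev by (rule eventually_mono) simp
  ultimately show ?thesis by (rule that)
qed

abbreviation properly_discontinuous_on :: "psl3 set \<Rightarrow> cp2 set \<Rightarrow> bool" where
  "properly_discontinuous_on \<Gamma> \<Omega> \<equiv>
     \<forall>K. compact K \<and> K \<subseteq> \<Omega> \<longrightarrow> finite {\<gamma> \<in> \<Gamma>. psl3_act \<gamma> ` K \<inter> K \<noteq> {}}"

text \<open>\<open>L0\<close> before taking the closure.\<close>

definition infinite_isotropy :: "psl3 set \<Rightarrow> cp2 set" where
  "infinite_isotropy \<Gamma> = {z. infinite {\<gamma> \<in> \<Gamma>. psl3_act \<gamma> z = z}}"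

lemma infinite_isotropy_outside:
  assumes "properly_discontinuous_on \<Gamma> \<Omega>"
  shows "infinite_isotropy \<Gamma> \<subseteq> - \<Omega>"
proof (intro subsetI ComplI)
  fix z assume z: "z \<in> infinite_isotropy \<Gamma>" "z \<in> \<Omega>"
  have "finite {\<gamma> \<in> \<Gamma>. psl3_act \<gamma> ` {z} \<inter> {z} \<noteq> {}}"
    using assms[THEN spec, of "{z}"] z(2) by simp
  then show False using z(1) by (simp add: infinite_isotropy_def eq_commute)
qed

text \<open>Enlarging \<open>K\<close> by a closed ball around a cluster point outside
  \<open>C\<close> would give a compact set that meets infinitely many of its translates.\<close>

lemma cluster_points_outside:
  assumes "closed C" "properly_discontinuous_on \<Gamma> (- C)" "compact K" "K \<subseteq> - C"
  shows "cluster_points \<Gamma> K \<subseteq> C"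
proof (rule ccontr)
  assume "\<not> ?thesis"
  then obtain p where p: "p \<in> cluster_points \<Gamma> K" "p \<in> - C" by blast
  obtain e where e: "e > 0" "cball p e \<subseteq> - C"
    using assms(1) p(2) open_contains_cball unfolding closed_def by blast
  have "compact (K \<union> cball p e)" using assms(3) compact_cp2 by blast
  then have "finite {\<gamma> \<in> \<Gamma>. psl3_act \<gamma> ` (K \<union> cball p e) \<inter> (K \<union> cball p e) \<noteq> {}}"
    using assms(2,4) e(2) by blast
  moreover have "{\<gamma> \<in> \<Gamma>. ball p e \<inter> psl3_act \<gamma> ` K \<noteq> {}} \<subseteq>
      {\<gamma> \<in> \<Gamma>. psl3_act \<gamma> ` (K \<union> cball p e) \<inter> (K \<union> cball p e) \<noteq> {}}"
    using ball_subset_cball[of p e] by blast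
  ultimately have "finite {\<gamma> \<in> \<Gamma>. ball p e \<inter> psl3_act \<gamma> ` K \<noteq> {}}"
    using finite_subset by blast
  moreover have "infinite {\<gamma> \<in> \<Gamma>. ball p e \<inter> psl3_act \<gamma> ` K \<noteq> {}}"
    using p(1) e(1) unfolding cluster_points_def by simp
  ultimately show False by simp
qed

text \<open>By proper discontinuity \<open>C\<close> is exactly the set of points with infinite
  isotropy, so \<open>L0\<close> is already \<open>C\<close>. The sets \<open>L1\<close> and
  \<open>L2\<close> then arise from compact sets off \<open>C\<close>, whose cluster points stay in
  \<open>C\<close>.\<close>

lemma kulkarni_region_eq:
  assumes "closed C" "C \<subseteq> infinite_isotropy \<Gamma>" "properly_discontinuous_on \<Gamma> (- C)"
  shows "kulkarni_region \<Gamma> = - C"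
proof -
  have "infinite_isotropy \<Gamma> = C" using infinite_isotropy_outside[OF assms(3)] assms(2) by blast
  then have "L0 \<Gamma> = C" using assms(1) unfolding L0_def infinite_isotropy_def by simp
  moreover have "L1 \<Gamma> \<subseteq> C"
    unfolding L1_def using cluster_points_outside[OF assms(1,3)] calculation
    by (intro closure_minimal assms(1)) (metis (no_types, lifting) UN_least compact_sing empty_subsetI insert_subset)
  moreover from calculation have "L2 \<Gamma> \<subseteq> C"
    unfolding L2_def using cluster_points_outside[OF assms(1,3)]
    by (intro closure_minimal assms(1)) blast
  ultimately show ?thesis unfolding kulkarni_region_def kulkarni_limit_set_def by blast
qed

text \<open>A compact \<open>K\<close> in the region is one of the sets whose cluster points go into
  \<open>L2\<close>, so no point of \<open>K\<close> is a cluster point of its translates. Finitely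
  many of the resulting neighbourhoods cover \<open>K\<close>.\<close>

lemma properly_discontinuous_on_kulkarni_region:
  "properly_discontinuous_on \<Gamma> (kulkarni_region \<Gamma>)"
proof (intro allI impI)
  fix K assume "compact K \<and> K \<subseteq> kulkarni_region \<Gamma>"
  then have K: "compact K" "K \<subseteq> - kulkarni_limit_set \<Gamma>" by (auto simp: kulkarni_region_def)
  have "cluster_points \<Gamma> K \<subseteq> L2 \<Gamma>"
    unfolding L2_def using K by (intro order.trans[OF _ closure_subset]) (auto simp: kulkarni_limit_set_def)
  then have "\<forall>p\<in>K. p \<notin> cluster_points \<Gamma> K"
    using K(2) unfolding kulkarni_limit_set_def by blast
  then have "\<forall>p\<in>K. \<exists>U. open U \<and> p \<in> U \<and> finite {\<gamma> \<in> \<Gamma>. U \<inter> psl3_act \<gamma> ` K \<noteq> {}}"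
    unfolding cluster_points_def by simp
  from bchoice[OF this] obtain U where
    "\<forall>p\<in>K. open (U p) \<and> p \<in> U p \<and> finite {\<gamma> \<in> \<Gamma>. U p \<inter> psl3_act \<gamma> ` K \<noteq> {}}" by blast
  then have U: "\<And>p. p \<in> K \<Longrightarrow> open (U p)" "\<And>p. p \<in> K \<Longrightarrow> p \<in> U p"
    "\<And>p. p \<in> K \<Longrightarrow> finite {\<gamma> \<in> \<Gamma>. U p \<inter> psl3_act \<gamma> ` K \<noteq> {}}"
    by simp_all
  obtain D where D: "D \<subseteq> K" "finite D" "K \<subseteq> (\<Union>p\<in>D. U p)"
  proof (rule compactE_image[OF K(1), of K U])
    show "K \<subseteq> (\<Union>p\<in>K. U p)" using U(2) by (intro subsetI UN_I)
  qed (use U in auto)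
  have "{\<gamma> \<in> \<Gamma>. psl3_act \<gamma> ` K \<inter> K \<noteq> {}} \<subseteq> (\<Union>p\<in>D. {\<gamma> \<in> \<Gamma>. U p \<inter> psl3_act \<gamma> ` K \<noteq> {}})"
  proof
    fix \<gamma> assume "\<gamma> \<in> {\<gamma> \<in> \<Gamma>. psl3_act \<gamma> ` K \<inter> K \<noteq> {}}"
    then obtain y where y: "\<gamma> \<in> \<Gamma>" "y \<in> psl3_act \<gamma> ` K" "y \<in> K" by fast
    then obtain p where "p \<in> D" "y \<in> U p" using D(3) by fast
    with y have "U p \<inter> psl3_act \<gamma> ` K \<noteq> {}" by (intro notI) auto
    with y(1) show "\<gamma> \<in> (\<Union>p\<in>D. {\<gamma> \<in> \<Gamma>. U p \<inter> psl3_act \<gamma> ` K \<noteq> {}})"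
      by (intro UN_I[OF \<open>p \<in> D\<close>]) simp
  qed
  moreover have "finite (\<Union>p\<in>D. {\<gamma> \<in> \<Gamma>. U p \<inter> psl3_act \<gamma> ` K \<noteq> {}})"
    using D U(3) by (intro finite_UN_I) auto
  ultimately show "finite {\<gamma> \<in> \<Gamma>. psl3_act \<gamma> ` K \<inter> K \<noteq> {}}" by (rule finite_subset)
qed

lemma act_closure:
  assumes "\<And>z. z \<in> S \<Longrightarrow> psl3_act \<gamma> z \<in> S" "z \<in> closure S"
  shows "psl3_act \<gamma> z \<in> closure S"
  using image_closure_subset[OF continuous_on_psl3_act closed_closure, of \<gamma> S S] assms closure_subset[of S]
  by blast

text \<open>Normality concerns arbitrary sequences, whereas \<open>limit_pair\<close> needs distinct
  elements; this bridges the gap.\<close>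

lemma constant_or_injective_subsequence:
  fixes \<gamma> :: "nat \<Rightarrow> 'a"
  obtains s c where "strict_mono s" "\<And>n::nat. \<gamma> (s n) = c"
  | s :: "nat \<Rightarrow> nat" where "strict_mono s" "inj (\<gamma> \<circ> s)"
proof (cases "finite (range \<gamma>)")
  case True
  then obtain k where "infinite {n \<in> UNIV. \<gamma> n = \<gamma> k}"
    using pigeonhole_infinite[of "UNIV :: nat set" \<gamma>] by auto
  then obtain s :: "nat \<Rightarrow> nat" where "strict_mono s" "\<And>n. s n \<in> {n \<in> UNIV. \<gamma> n = \<gamma> k}"
    using infinite_enumerate by blast
  then show ?thesis using that(1) by blast
next
  case False
  \<comment> \<open>The indices at which a value occurs for the first time.\<close>
  let ?F = "{n. \<forall>m<n. \<gamma> m \<noteq> \<gamma> n}"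
  have "range \<gamma> \<subseteq> \<gamma> ` ?F"
  proof (intro image_subsetI)
    fix n
    define m where "m = (LEAST m. \<gamma> m = \<gamma> n)"
    have "\<gamma> m = \<gamma> n" unfolding m_def by (rule LeastI) (rule refl)
    moreover have "\<gamma> k \<noteq> \<gamma> n" if "k < m" for k using that not_less_Least m_def by metis
    ultimately show "\<gamma> n \<in> \<gamma> ` ?F" by (intro image_eqI[of _ _ m]) auto
  qed
  then have "infinite ?F" using False finite_surj by blast
  then obtain s :: "nat \<Rightarrow> nat" where s: "strict_mono s" "\<And>n. s n \<in> ?F"
    using infinite_enumerate by blast
  have "inj (\<gamma> \<circ> s)"
  proof (rule linorder_injI)
    show "(\<gamma> \<circ> s) x \<noteq> (\<gamma> \<circ> s) y" if "x < y" for x y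
      using s that by (auto simp: strict_mono_def)
  qed
  then show ?thesis by (rule that(2)[OF s(1)])
qed

text \<open>If the given point is the forbidden one, it is moved slightly along the line, in a
  direction \<open>d\<close> independent of \<open>b\<close>; openness keeps it in the set.\<close>

lemma avoid_point:
  assumes "open \<Omega>" "x \<noteq> 0" "proj x \<in> \<Omega>" "\<phi> \<noteq> 0" "dot \<phi> x = 0" "b \<noteq> 0"
  obtains y where "y \<noteq> 0" "proj y \<in> \<Omega>" "dot \<phi> y = 0" "\<And>c. y \<noteq> c *s b"
proof (cases "\<exists>c. x = c *s b")
  case True
  then obtain c where c: "x = c *s b" by blast
  obtain p q where pq: "cross p q = \<phi>" using complementary_vectors assms(4) by blast
  have "\<not> ((\<exists>c. p = c *s b) \<and> (\<exists>c. q = c *s b))"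
    using pq assms(4) by (auto simp: vec_eq_iff forall_3)
  then obtain d where d: "dot \<phi> d = 0" "\<And>c. d \<noteq> c *s b"
    using pq by (metis dot_cross_self(1,2))
  let ?y = "\<lambda>n. x + complex_of_real (inverse (real (Suc n))) *s d"
  have "?y \<longlonglongrightarrow> x + complex_of_real 0 *s d"
    by (intro tendsto_intros LIMSEQ_inverse_real_of_nat)
  then have "?y \<longlonglongrightarrow> x" by simp
  then have "(\<lambda>n. proj (?y n)) \<longlonglongrightarrow> proj x" by (rule tendsto_proj) (rule assms)
  then have "\<forall>\<^sub>F n in sequentially. proj (?y n) \<in> \<Omega>"
    using topological_tendstoD assms(1,3) by blast
  then obtain n where n: "proj (?y n) \<in> \<Omega>" by (meson eventually_happens trivial_limit_sequentially)
  have "?y n \<noteq> k *s b" for k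
  proof
    assume "?y n = k *s b"
    then have "complex_of_real (inverse (real (Suc n))) *s d = (k - c) *s b"
      using c by (metis add_diff_cancel_left' vec.scale_left_diff_distrib)
    then have "complex_of_real (real (Suc n)) *s (complex_of_real (inverse (real (Suc n))) *s d) =
        complex_of_real (real (Suc n)) *s ((k - c) *s b)" by simp
    moreover have "complex_of_real (real (Suc n)) * complex_of_real (inverse (real (Suc n))) = 1"
      by (metis of_nat_neq_0 of_real_1 of_real_mult right_inverse)
    ultimately have "d = (complex_of_real (real (Suc n)) * (k - c)) *s b"
      by (simp only: vector_smult_assoc vector_smult_lid)
    then show False using d(2) by blast
  qed
  moreover from this[of 0] have "?y n \<noteq> 0" by simp
  ultimately show ?thesis using n d(1) assms(5) by (intro that[of "?y n"]) simp_all
qed (use assms that in blast)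

section \<open>Finiteness of translates, and the Kulkarni region as a region of proper
  discontinuity\<close>

context discrete_subgroup
begin

text \<open>Otherwise points of \<open>K\<close> tending to \<open>proj w\<close> have images in
  \<open>K\<close> tending to \<open>proj (A *v w)\<close>. As \<open>B ** A = 0\<close>, that limit
  lies in the kernel of the limit matrix \<open>B\<close>, which \<open>K\<close> avoids.\<close>

lemma finite_translates:
  assumes "closed K" "\<And>A v. limit_matrix \<Gamma> A \<Longrightarrow> v \<noteq> 0 \<Longrightarrow> proj v \<in> K \<Longrightarrow> A *v v \<noteq> 0"
  shows "finite {\<gamma> \<in> \<Gamma>. psl3_act \<gamma> ` K \<inter> K \<noteq> {}}" (is "finite ?S")
proof (rule ccontr)
  assume "infinite ?S"
  then obtain \<gamma> :: "nat \<Rightarrow> psl3" where g: "inj \<gamma>" "range \<gamma> \<subseteq> ?S"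
    using infinite_countable_subset by blast
  have "\<exists>v. norm v = 1 \<and> proj v \<in> K \<and> psl3_act (\<gamma> n) (proj v) \<in> K" for n
  proof -
    have "psl3_act (\<gamma> n) ` K \<inter> K \<noteq> {}" using g(2) by blast
    then obtain x where "x \<in> K" "psl3_act (\<gamma> n) x \<in> K" by blast
    then show ?thesis using proj_unit by metis
  qed
  then obtain v where v: "\<And>n. norm (v n) = 1" "\<And>n. proj (v n) \<in> K"
    "\<And>n. psl3_act (\<gamma> n) (proj (v n)) \<in> K" by metis
  have "range \<gamma> \<subseteq> \<Gamma>" using g(2) by blast
  from limit_pair[OF g(1) this] obtain r X Y A B where lp: "strict_mono r"
    "\<And>n. represents (\<gamma> (r n)) (X n)" "X \<longlonglongrightarrow> A" "B ** A = 0"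
    "limit_matrix \<Gamma> A" "limit_matrix \<Gamma> B" by metis
  obtain s w where s: "strict_mono s" "norm w = 1" "(\<lambda>n. v (r (s n))) \<longlonglongrightarrow> w"
    using unit_subsequence[of "\<lambda>n. v (r n)"] v(1) by metis
  have nz: "w \<noteq> 0" "v n \<noteq> 0" for n using s(2) v(1)[of n] by auto
  have "proj w \<in> K"
    by (rule closed_sequentially[OF assms(1) _ tendsto_proj[OF s(3) nz(1)]]) (rule v)
  then have Aw: "A *v w \<noteq> 0" using assms(2) lp(5) nz(1) by blast
  have "(\<lambda>n. X (s n)) \<longlonglongrightarrow> A"
    using LIMSEQ_subseq_LIMSEQ[OF lp(3) s(1)] by (simp add: o_def)
  then have lim: "(\<lambda>n. proj (X (s n) *v v (r (s n)))) \<longlonglongrightarrow> proj (A *v w)"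
    by (intro tendsto_proj tendsto_matrix_vector s(3) Aw)
  have "proj (X (s n) *v v (r (s n))) \<in> K" for n
    using v(3)[of "r (s n)"] unfolding represents_act(2)[OF lp(2) nz(2)] .
  then have "proj (A *v w) \<in> K"
    by (rule closed_sequentially[OF assms(1) _ lim])
  then have "B *v (A *v w) \<noteq> 0" using assms(2) lp(6) Aw by blast
  then show False using lp(4) by (simp add: matrix_vector_mul_assoc)
qed

lemma invariant_Union:
  assumes "\<And>\<gamma> z. \<gamma> \<in> \<Gamma> \<Longrightarrow> z \<in> \<Omega> \<Longrightarrow> psl3_act \<gamma> z \<in> \<Omega>"
  shows "(\<Union>\<gamma>\<in>\<Gamma>. psl3_act \<gamma> ` \<Omega>) = \<Omega>"
  using assms one_mem by force

text \<open>Conjugation by \<delta> carries the stabilizer of a point to that of its image.\<close>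

lemma act_infinite_isotropy:
  assumes "\<delta> \<in> \<Gamma>" "z \<in> infinite_isotropy \<Gamma>" shows "psl3_act \<delta> z \<in> infinite_isotropy \<Gamma>"
proof -
  let ?c = "\<lambda>\<gamma>. psl3_mult \<delta> (psl3_mult \<gamma> (pinv \<delta>))"
  have "inj_on ?c {\<gamma> \<in> \<Gamma>. psl3_act \<gamma> z = z}"
    by (simp add: inj_on_def psl3_mult_cancel psl3_mult_cancel_right)
  moreover have "?c ` {\<gamma> \<in> \<Gamma>. psl3_act \<gamma> z = z} \<subseteq>
      {\<gamma> \<in> \<Gamma>. psl3_act \<gamma> (psl3_act \<delta> z) = psl3_act \<delta> z}"
    using assms(1) by (auto simp: mult_mem inv_mem psl3_act_mult)
  ultimately show ?thesis
    using assms(2) infinite_super finite_imageD unfolding infinite_isotropy_def by blast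
qed

lemma act_cluster_points:
  assumes "\<delta> \<in> \<Gamma>" "p \<in> cluster_points \<Gamma> K" shows "psl3_act \<delta> p \<in> cluster_points \<Gamma> K"
  unfolding cluster_points_def
proof (intro CollectI allI impI)
  fix U assume U: "open U \<and> psl3_act \<delta> p \<in> U"
  let ?V = "psl3_act (pinv \<delta>) ` U"
  have "open ?V" using U open_psl3_act by blast
  moreover have "p \<in> ?V" using U by (metis image_eqI psl3_act_inv(1))
  ultimately have "infinite {\<gamma> \<in> \<Gamma>. ?V \<inter> psl3_act \<gamma> ` K \<noteq> {}}"
    using assms(2) unfolding cluster_points_def by blast
  then have "infinite (psl3_mult \<delta> ` {\<gamma> \<in> \<Gamma>. ?V \<inter> psl3_act \<gamma> ` K \<noteq> {}})"
    using finite_imageD by (metis (no_types, lifting) inj_onI psl3_mult_cancel)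
  moreover have "psl3_mult \<delta> ` {\<gamma> \<in> \<Gamma>. ?V \<inter> psl3_act \<gamma> ` K \<noteq> {}} \<subseteq>
      {\<gamma> \<in> \<Gamma>. U \<inter> psl3_act \<gamma> ` K \<noteq> {}}"
  proof (rule image_subsetI)
    fix \<gamma> assume "\<gamma> \<in> {\<gamma> \<in> \<Gamma>. ?V \<inter> psl3_act \<gamma> ` K \<noteq> {}}"
    then obtain u x where h: "\<gamma> \<in> \<Gamma>" "u \<in> U" "psl3_act (pinv \<delta>) u = psl3_act \<gamma> x" "x \<in> K"
      by auto
    have "psl3_act (psl3_mult \<delta> \<gamma>) x = u"
      using h(3) by (metis psl3_act_inv(2) psl3_act_mult)
    then have "U \<inter> psl3_act (psl3_mult \<delta> \<gamma>) ` K \<noteq> {}" using h by blast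
    then show "psl3_mult \<delta> \<gamma> \<in> {\<gamma> \<in> \<Gamma>. U \<inter> psl3_act \<gamma> ` K \<noteq> {}}"
      using mult_mem assms(1) h(1) by simp
  qed
  ultimately show "infinite {\<gamma> \<in> \<Gamma>. U \<inter> psl3_act \<gamma> ` K \<noteq> {}}"
    using infinite_super by blast
qed

lemma act_kulkarni_limit_set:
  assumes "\<delta> \<in> \<Gamma>" "z \<in> kulkarni_limit_set \<Gamma>" shows "psl3_act \<delta> z \<in> kulkarni_limit_set \<Gamma>"
proof -
  have "psl3_act \<delta> z \<in> L0 \<Gamma>" if "z \<in> L0 \<Gamma>"
    using that act_infinite_isotropy[OF assms(1)] unfolding L0_def infinite_isotropy_def
    by (intro act_closure) auto
  moreover have "psl3_act \<delta> z \<in> L1 \<Gamma>" if "z \<in> L1 \<Gamma>"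
    using that act_cluster_points[OF assms(1)] unfolding L1_def
    by (intro act_closure) auto
  moreover have "psl3_act \<delta> z \<in> L2 \<Gamma>" if "z \<in> L2 \<Gamma>"
    using that act_cluster_points[OF assms(1)] unfolding L2_def
    by (intro act_closure) blast+
  ultimately show ?thesis using assms(2) unfolding kulkarni_limit_set_def by blast
qed

lemma prop_disc_kulkarni_region:
  assumes "kulkarni_region \<Gamma> \<noteq> {}" shows "prop_disc_region \<Gamma> (kulkarni_region \<Gamma>)"
  unfolding prop_disc_region_def
proof (intro conjI)
  show "open (kulkarni_region \<Gamma>)"
    unfolding kulkarni_region_def kulkarni_limit_set_def L0_def L1_def L2_def
    by (intro open_Compl closed_Un closed_closure)
  show "(\<Union>\<gamma>\<in>\<Gamma>. psl3_act \<gamma> ` kulkarni_region \<Gamma>) = kulkarni_region \<Gamma>"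
  proof (rule invariant_Union)
    fix \<gamma> z assume "\<gamma> \<in> \<Gamma>" "z \<in> kulkarni_region \<Gamma>"
    then show "psl3_act \<gamma> z \<in> kulkarni_region \<Gamma>"
      using act_kulkarni_limit_set[OF inv_mem, of \<gamma> "psl3_act \<gamma> z"]
      by (auto simp: kulkarni_region_def)
  qed
qed (use assms properly_discontinuous_on_kulkarni_region in blast)+

end

section \<open>The equicontinuity set and missing lines\<close>

lemma open_Eq: "open (Eq \<Gamma>)"
proof (subst open_subopen, rule ballI)
  fix z assume "z \<in> Eq \<Gamma>"
  then obtain U where "open U" "z \<in> U" "normal_family_on U (psl3_act ` \<Gamma>)"
    unfolding Eq_def by blast
  then show "\<exists>T. open T \<and> z \<in> T \<and> T \<subseteq> Eq \<Gamma>"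
    unfolding Eq_def by (intro exI[of _ U]) auto
qed

text \<open>
  Every line \<open>h\<close> pulls back to lines that converge to one through the point \<open>proj v\<close>, so a
  continuous limit would map that point into every line.
\<close>

lemma Eq_avoids_kernel:
  assumes A: "limit_matrix \<Gamma> A" and v: "v \<noteq> 0" "proj v \<in> Eq \<Gamma>"
  shows "A *v v \<noteq> 0"
proof
  assume Av: "A *v v = 0"
  obtain \<gamma> X where g: "range \<gamma> \<subseteq> \<Gamma>" "\<And>n::nat. represents (\<gamma> n) (X n)" "X \<longlonglongrightarrow> A"
    and "A \<noteq> 0" using A unfolding limit_matrix_def by blast
  obtain U where U: "open U" "proj v \<in> U" "normal_family_on U (psl3_act ` \<Gamma>)"
    using v(2) unfolding Eq_def by blast
  have "range (\<lambda>n. psl3_act (\<gamma> n)) \<subseteq> psl3_act ` \<Gamma>" using g(1) by auto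
  then obtain r g where r: "strict_mono r"
    and "\<forall>K. compact K \<and> K \<subseteq> U \<longrightarrow> uniform_limit K ((\<lambda>n. psl3_act (\<gamma> n)) \<circ> r) g sequentially"
    using U(3)[unfolded normal_family_on_def, rule_format, of "\<lambda>n. psl3_act (\<gamma> n)"] by auto
  moreover obtain e where e: "e > 0" "cball (proj v) e \<subseteq> U"
    using U open_contains_cball by blast
  moreover have "compact (cball (proj v) e)" by (rule compact_cp2) simp
  ultimately have ul: "uniform_limit (cball (proj v) e) (\<lambda>n. psl3_act (\<gamma> (r n))) g sequentially"
    by (simp add: o_def)
  have cont: "continuous_on (cball (proj v) e) g"
    by (rule uniform_limit_theorem[OF _ ul]) (simp_all add: continuous_on_psl3_act)
  obtain w where w: "w \<noteq> 0" "proj w = g (proj v)" using proj_surj by blast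
  \<comment> \<open>The condition on \<open>h\<close> ensures that the pulled-back lines
    \<open>h v* X (r n)\<close> converge to a genuine line.\<close>
  have kill: "dot h w = 0" if h: "h v* A \<noteq> 0" for h
  proof -
    have "(\<lambda>n. X (r n)) \<longlonglongrightarrow> A" using LIMSEQ_subseq_LIMSEQ[OF g(3) r] by (simp add: o_def)
    then have "(\<lambda>n. h v* X (r n)) \<longlonglongrightarrow> h v* A" by (intro tendsto_intros)
    moreover have "dot (h v* A) v = 0" using Av by (simp flip: dot_matrix_vector)
    ultimately obtain x where x: "x \<longlonglongrightarrow> v" "\<forall>\<^sub>F n in sequentially. dot (h v* X (r n)) (x n) = 0"
      using perturb_into_kernel h by blast
    have px: "(\<lambda>n. proj (x n)) \<longlonglongrightarrow> proj v" using tendsto_proj[OF x(1) v(1)] .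
    have inK: "\<forall>\<^sub>F n in sequentially. proj (x n) \<in> cball (proj v) e"
      using topological_tendstoD[OF px open_ball[of "proj v" e]] e(1)
      by (auto elim: eventually_mono)
    have gx: "(\<lambda>n. g (proj (x n))) \<longlonglongrightarrow> g (proj v)"
      using e(1) by (intro continuous_on_tendsto_compose[OF cont px _ inK]) simp
    have lim: "(\<lambda>n. psl3_act (\<gamma> (r n)) (proj (x n))) \<longlonglongrightarrow> g (proj v)"
    proof (rule tendstoI)
      fix \<epsilon> :: real assume "\<epsilon> > 0"
      then have "\<epsilon> / 2 > 0" by simp
      from uniform_limitD[OF ul this] tendstoD[OF gx this] inK
      show "\<forall>\<^sub>F n in sequentially. dist (psl3_act (\<gamma> (r n)) (proj (x n))) (g (proj v)) < \<epsilon>"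
      proof eventually_elim
        case (elim n)
        then show ?case by (metis dist_commute dist_triangle_half_r)
      qed
    qed
    have "\<forall>\<^sub>F n in sequentially. x n \<noteq> 0" using x(1) v(1) by (rule tendsto_imp_eventually_ne)
    then have "\<forall>\<^sub>F n in sequentially. psl3_act (\<gamma> (r n)) (proj (x n)) \<in> pline h"
      using x(2)
    proof eventually_elim
      case (elim n)
      then show ?case
        using represents_act[OF g(2) elim(1)] by (simp add: proj_in_pline dot_matrix_vector)
    qed
    then have "proj w \<in> pline h"
      unfolding w(2) by (rule Lim_in_closed_set[OF closed_pline _ trivial_limit_sequentially lim])
    then show ?thesis using proj_in_pline w(1) by blast
  qed
  obtain h0 where h0: "h0 v* A \<noteq> 0"
  proof -
    obtain u where "A *v u \<noteq> 0" using \<open>A \<noteq> 0\<close> by (metis matrix_vector_mult_0 matrix_eq)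
    then obtain h where "dot h (A *v u) = 1" using dot_separates by blast
    then have "h v* A \<noteq> 0" by (auto simp: dot_matrix_vector)
    then show ?thesis by (rule that)
  qed
  \<comment> \<open>A form killed by \<open>A\<close> is the difference of two forms that are not,
    \<open>h0 + h\<close> and \<open>h0\<close>.\<close>
  have "dot h w = 0" for h
  proof (cases "h v* A = 0")
    case True
    then have "(h0 + h) v* A \<noteq> 0" using h0 by (simp add: vector_matrix_left_distrib)
    then show ?thesis using kill[of "h0 + h"] kill[OF h0] by simp
  qed (rule kill)
  then show False using dot_ext w(1) by blast
qed

section \<open>The equicontinuity set as a region, and the existence of a missed line\<close>

context discrete_subgroup
begin

lemma act_Eq:
  assumes "\<gamma> \<in> \<Gamma>" "z \<in> Eq \<Gamma>" shows "psl3_act \<gamma> z \<in> Eq \<Gamma>"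
proof -
  obtain U where U: "open U" "z \<in> U" "normal_family_on U (psl3_act ` \<Gamma>)"
    using assms(2) unfolding Eq_def by blast
  have "normal_family_on (psl3_act \<gamma> ` U) (psl3_act ` \<Gamma>)"
    unfolding normal_family_on_def
  proof (intro allI impI)
    fix f :: "nat \<Rightarrow> cp2 \<Rightarrow> cp2" assume f: "range f \<subseteq> psl3_act ` \<Gamma>"
    have "range (\<lambda>n. f n \<circ> psl3_act \<gamma>) \<subseteq> psl3_act ` \<Gamma>"
    proof (rule image_subsetI)
      fix n
      obtain \<delta> where d: "\<delta> \<in> \<Gamma>" "f n = psl3_act \<delta>" using f by blast
      then have "f n \<circ> psl3_act \<gamma> = psl3_act (psl3_mult \<delta> \<gamma>)" by (auto simp: psl3_act_mult)
      then show "f n \<circ> psl3_act \<gamma> \<in> psl3_act ` \<Gamma>" using mult_mem d(1) assms(1) by simp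
    qed
    then obtain r g where r: "strict_mono r" and
      lim: "\<forall>K. compact K \<and> K \<subseteq> U \<longrightarrow> uniform_limit K ((\<lambda>n. f n \<circ> psl3_act \<gamma>) \<circ> r) g sequentially"
      using U(3)[unfolded normal_family_on_def, rule_format, of "\<lambda>n. f n \<circ> psl3_act \<gamma>"] by auto
    show "\<exists>r g. strict_mono r \<and>
        (\<forall>K. compact K \<and> K \<subseteq> psl3_act \<gamma> ` U \<longrightarrow> uniform_limit K (f \<circ> r) g sequentially)"
    proof (intro exI conjI allI impI)
      show "strict_mono r" by (rule r)
      fix K assume K: "compact K \<and> K \<subseteq> psl3_act \<gamma> ` U"
      let ?K = "psl3_act (pinv \<gamma>) ` K"
      have "compact ?K"
        using K compact_continuous_image continuous_on_psl3_act by blast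
      moreover have "?K \<subseteq> U" using K by force
      ultimately have "uniform_limit ?K ((\<lambda>n. f n \<circ> psl3_act \<gamma>) \<circ> r) g sequentially" using lim by simp
      then show "uniform_limit K (f \<circ> r) (g \<circ> psl3_act (pinv \<gamma>)) sequentially"
        unfolding uniform_limit_iff by simp
    qed
  qed
  moreover have "open (psl3_act \<gamma> ` U)" using U(1) by (rule open_psl3_act)
  ultimately show ?thesis unfolding Eq_def using U(2) by blast
qed

lemma prop_disc_Eq:
  assumes "Eq \<Gamma> \<noteq> {}" shows "prop_disc_region \<Gamma> (Eq \<Gamma>)"
  unfolding prop_disc_region_def
proof (intro conjI assms open_Eq allI impI)
  show "(\<Union>\<gamma>\<in>\<Gamma>. psl3_act \<gamma> ` Eq \<Gamma>) = Eq \<Gamma>"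
    by (rule invariant_Union) (rule act_Eq)
  fix K assume "compact K \<and> K \<subseteq> Eq \<Gamma>"
  then show "finite {\<gamma> \<in> \<Gamma>. psl3_act \<gamma> ` K \<inter> K \<noteq> {}}"
    by (intro finite_translates) (auto intro: compact_imp_closed dest: Eq_avoids_kernel)
qed

text \<open>Converse to \<open>Eq_avoids_kernel\<close>: where no limit matrix vanishes, convergence
  of lifts gives convergence of the maps, uniform on compact sets because any bad sequence of points
  has a convergent subsequence of unit lifts.\<close>

lemma outside_kernels_subset_Eq:
  assumes "closed C" "\<And>A v. limit_matrix \<Gamma> A \<Longrightarrow> v \<noteq> 0 \<Longrightarrow> proj v \<notin> C \<Longrightarrow> A *v v \<noteq> 0"
  shows "- C \<subseteq> Eq \<Gamma>"
proof -
  have "normal_family_on (- C) (psl3_act ` \<Gamma>)"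
    unfolding normal_family_on_def
  proof (intro allI impI)
    fix f :: "nat \<Rightarrow> cp2 \<Rightarrow> cp2" assume f: "range f \<subseteq> psl3_act ` \<Gamma>"
    have "\<forall>n. \<exists>\<gamma>. \<gamma> \<in> \<Gamma> \<and> f n = psl3_act \<gamma>" using f by blast
    from choice[OF this] obtain \<gamma> where g: "\<And>n. \<gamma> n \<in> \<Gamma>" "\<And>n. f n = psl3_act (\<gamma> n)" by blast
    show "\<exists>r g. strict_mono r \<and>
        (\<forall>K. compact K \<and> K \<subseteq> - C \<longrightarrow> uniform_limit K (f \<circ> r) g sequentially)"
    proof (rule constant_or_injective_subsequence[of \<gamma>])
      fix s c assume "strict_mono s" "\<And>n::nat. \<gamma> (s n) = c"
      then show ?thesis
        by (intro exI[of _ s] exI[of _ "psl3_act c"]) (simp add: g(2) o_def uniform_limit_const)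
    next
      fix s :: "nat \<Rightarrow> nat" assume s: "strict_mono s" "inj (\<gamma> \<circ> s)"
      have "range (\<gamma> \<circ> s) \<subseteq> \<Gamma>" using g(1) by auto
      from limit_pair[OF s(2) this] obtain r X A where r: "strict_mono r"
        "\<And>n. represents ((\<gamma> \<circ> s) (r n)) (X n)" "X \<longlonglongrightarrow> A" "limit_matrix \<Gamma> A" by metis
      \<comment> \<open>A fixed unit lift makes \<open>g\<close> total. Its value is arbitrary on
        the kernel of \<open>A\<close>; elsewhere \<open>g_proj\<close> frees it from the choice of
        lift.\<close>
      define g where "g z = proj (A *v (SOME v. norm v = 1 \<and> proj v = z))" for z
      have g_proj: "g (proj v) = proj (A *v v)" if v: "v \<noteq> 0" "A *v v \<noteq> 0" for v
      proof -
        define w where "w = (SOME w. norm w = 1 \<and> proj w = proj v)"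
        have w: "norm w = 1" "proj w = proj v"
          using someI_ex[OF proj_unit[of "proj v"]] by (auto simp: w_def)
        then have "w \<noteq> 0" by auto
        then obtain c where c: "w = c *s v"
          using proj_eq_iff[OF v(1) \<open>w \<noteq> 0\<close>] w(2) by auto
        then have "c \<noteq> 0" using \<open>w \<noteq> 0\<close> by auto
        have "g (proj v) = proj (A *v w)" unfolding g_def w_def ..
        also have "\<dots> = proj (c *s (A *v v))" by (simp add: c vec.scale)
        also have "\<dots> = proj (A *v v)" by (rule proj_smult) fact+
        finally show ?thesis .
      qed
      have "uniform_limit K (f \<circ> (s \<circ> r)) g sequentially" if K: "compact K" "K \<subseteq> - C" for K
      proof (rule ccontr)
        assume "\<not> ?thesis"
        then obtain e where e: "e > 0"
          "\<not> (\<forall>\<^sub>F n in sequentially. \<forall>x\<in>K. dist ((f \<circ> (s \<circ> r)) n x) (g x) < e)"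
          unfolding uniform_limit_iff by blast
        obtain t :: "nat \<Rightarrow> nat" where t: "strict_mono t"
          "\<And>n. \<not> (\<forall>x\<in>K. dist ((f \<circ> (s \<circ> r)) (t n) x) (g x) < e)"
          using not_eventually_sequentiallyD[OF e(2)] by blast
        have "\<forall>n. \<exists>v. norm v = 1 \<and> proj v \<in> K \<and>
            e \<le> dist (psl3_act (\<gamma> (s (r (t n)))) (proj v)) (g (proj v))"
        proof
          fix n
          obtain x where x: "x \<in> K" "\<not> dist ((f \<circ> (s \<circ> r)) (t n) x) (g x) < e"
            using t(2) by blast
          obtain v where "norm v = 1" "proj v = x" using proj_unit by blast
          then show "\<exists>v. norm v = 1 \<and> proj v \<in> K \<and>
            e \<le> dist (psl3_act (\<gamma> (s (r (t n)))) (proj v)) (g (proj v))"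
            using x by (intro exI[of _ v]) (simp add: g(2))
        qed
        from choice[OF this] obtain v where v: "\<And>n. norm (v n) = 1" "\<And>n. proj (v n) \<in> K"
          "\<And>n. e \<le> dist (psl3_act (\<gamma> (s (r (t n)))) (proj (v n))) (g (proj (v n)))" by blast
        obtain u w where u: "strict_mono u" "norm w = 1" "(\<lambda>n. v (u n)) \<longlonglongrightarrow> w"
          using unit_subsequence v(1) by blast
        have nz: "w \<noteq> 0" "v n \<noteq> 0" for n using u(2) v(1)[of n] by auto
        have "proj w \<in> K"
          by (rule closed_sequentially[OF compact_imp_closed[OF K(1)] _ tendsto_proj[OF u(3) nz(1)]])
             (rule v(2))
        then have Aw: "A *v w \<noteq> 0" using assms(2)[OF r(4) nz(1)] K(2) by blast
        have "(\<lambda>n. X (t (u n))) \<longlonglongrightarrow> A"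
          using LIMSEQ_subseq_LIMSEQ[OF r(3) strict_mono_o[OF t(1) u(1)]] by (simp add: o_def)
        \<comment> \<open>Both the maps and \<open>g\<close>, evaluated along the bad points, tend
          to \<open>proj (A *v w)\<close>, against the distance of at least
          \<open>e\<close>.\<close>
        then have "(\<lambda>n. dist (proj (X (t (u n)) *v v (u n))) (proj (A *v v (u n)))) \<longlonglongrightarrow>
            dist (proj (A *v w)) (proj (A *v w))"
          by (intro tendsto_dist tendsto_proj tendsto_matrix_vector u(3) Aw tendsto_const)
        then have "\<forall>\<^sub>F n in sequentially.
            dist (proj (X (t (u n)) *v v (u n))) (proj (A *v v (u n))) < e"
          using e(1) by (intro order_tendstoD(2)) auto
        moreover have "\<forall>\<^sub>F n in sequentially. A *v v (u n) \<noteq> 0"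
          by (rule tendsto_imp_eventually_ne[OF _ Aw]) (intro tendsto_matrix_vector tendsto_const u(3))
        ultimately have "\<forall>\<^sub>F n in sequentially. False"
        proof eventually_elim
          case (elim n)
          have "psl3_act (\<gamma> (s (r (t (u n))))) (proj (v (u n))) = proj (X (t (u n)) *v v (u n))"
            using represents_act(2)[OF r(2) nz(2)] by simp
          then show False using v(3)[of "u n"] elim g_proj[OF nz(2) elim(2)] by simp
        qed
        then show False by simp
      qed
      moreover have "strict_mono (s \<circ> r)" using s(1) r(1) by (rule strict_mono_o)
      ultimately show ?thesis by blast
    qed
  qed
  then show ?thesis unfolding Eq_def using assms(1) by (auto intro: exI[of _ "- C"])
qed

text \<open>If the kernel line of \<open>A\<close> meets \<Omega> at \<open>proj x\<close>, take a
  line \<open>pline h\<close> through that point. Its translates by \<open>\<gamma> n\<close>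
  converge to \<open>pline \<psi>\<close>. A point \<open>proj y\<close> of \<Omega> on this limit,
  other than \<open>proj a\<close>, would be a limit of translates of points of
  \<open>pline h\<close>. Those points can only accumulate on the kernel line, since elsewhere they
  are sent towards \<open>proj a\<close>; so they accumulate at \<open>proj x\<close>, against
  proper discontinuity near \<open>proj x\<close> and \<open>proj y\<close>.\<close>

lemma missing_line_rank_one:
  assumes \<Omega>: "prop_disc_region \<Gamma> \<Omega>" and inj: "inj \<gamma>" and mem: "\<And>n. \<gamma> n \<in> \<Gamma>"
    and X: "\<And>n::nat. represents (\<gamma> n) (X n)" and Y: "\<And>n. represents (pinv (\<gamma> n)) (Y n)"
    and A: "X \<longlonglongrightarrow> A" and B: "Y \<longlonglongrightarrow> B" "B \<noteq> 0" and AB: "A ** B = 0"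
    and rank: "A = outer a \<phi>" "a \<noteq> 0" "\<phi> \<noteq> 0"
  shows "\<exists>\<psi>. \<psi> \<noteq> 0 \<and> pline \<psi> \<inter> \<Omega> = {}"
proof (cases "pline \<phi> \<inter> \<Omega> = {}")
  case False
  have op: "open \<Omega>" using \<Omega> by (simp add: prop_disc_region_def)
  obtain u where u: "B *v u \<noteq> 0" using B(2) by (metis matrix_vector_mult_0 matrix_eq)
  define b where "b = B *v u"
  have "A *v b = 0" using AB by (simp add: b_def matrix_vector_mul_assoc)
  then have b: "b \<noteq> 0" "dot \<phi> b = 0" using u rank(2) by (auto simp: b_def rank(1) outer_mult_vec)
  obtain x0 where "x0 \<noteq> 0" "dot \<phi> x0 = 0" "proj x0 \<in> \<Omega>"
    using False unfolding pline_def by blast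
  \<comment> \<open>\<open>x\<close> must differ from \<open>b\<close>: then some form
    \<open>h\<close> vanishes at \<open>x\<close> but not at \<open>b\<close>, and since
    \<open>b\<close> is in the image of \<open>B\<close>, the limit form \<open>h v* B\<close> is
    nonzero.\<close>
  then obtain x where x: "x \<noteq> 0" "proj x \<in> \<Omega>" "dot \<phi> x = 0" "\<And>c. x \<noteq> c *s b"
    using avoid_point[OF op _ _ rank(3) _ b(1)] by metis
  have "b \<noteq> c *s x" for c
  proof
    assume bc: "b = c *s x"
    then have "c \<noteq> 0" using b(1) by auto
    then have "x = inverse c *s b" by (simp add: bc)
    then show False using x(4) by blast
  qed
  then obtain h where h: "dot h x = 0" "dot h b = 1" using separate x(1) by metis
  define \<psi> where "\<psi> = h v* B"
  have "dot \<psi> u = 1" using h(2) by (simp add: \<psi>_def b_def dot_matrix_vector)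
  then have "\<psi> \<noteq> 0" by auto
  moreover have "pline \<psi> \<inter> \<Omega> = {}"
  proof (rule ccontr)
    assume "\<not> ?thesis"
    then obtain y0 where "y0 \<noteq> 0" "dot \<psi> y0 = 0" "proj y0 \<in> \<Omega>"
      unfolding pline_def by blast
    then obtain y where y: "y \<noteq> 0" "proj y \<in> \<Omega>" "dot \<psi> y = 0" "\<And>c. y \<noteq> c *s a"
      using avoid_point[OF op _ _ \<open>\<psi> \<noteq> 0\<close> _ rank(2)] by metis
    have "(\<lambda>n. h v* Y n) \<longlonglongrightarrow> \<psi>" unfolding \<psi>_def by (intro tendsto_intros B(1))
    then obtain p where p: "p \<longlonglongrightarrow> y" "\<forall>\<^sub>F n in sequentially. dot (h v* Y n) (p n) = 0"
      using perturb_into_kernel \<open>\<psi> \<noteq> 0\<close> y(3) by blast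
    have py: "(\<lambda>n. proj (p n)) \<longlonglongrightarrow> proj y" using p(1) y(1) by (rule tendsto_proj)
    have "\<forall>n. \<exists>v. norm v = 1 \<and> proj v = psl3_act (pinv (\<gamma> n)) (proj (p n))"
      using proj_unit by blast
    from choice[OF this] obtain v where v: "\<And>n. norm (v n) = 1"
      "\<And>n. proj (v n) = psl3_act (pinv (\<gamma> n)) (proj (p n))" by blast
    have av: "psl3_act (\<gamma> n) (proj (v n)) = proj (p n)" for n by (simp add: v(2))
    obtain s w where s: "strict_mono s" "norm w = 1" "(\<lambda>n. v (s n)) \<longlonglongrightarrow> w"
      using unit_subsequence v(1) by blast
    have nz: "w \<noteq> 0" "v n \<noteq> 0" for n using s(2) v(1)[of n] by auto
    have vw: "(\<lambda>n. proj (v (s n))) \<longlonglongrightarrow> proj w" using s(3) nz(1) by (rule tendsto_proj)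
    have psy: "(\<lambda>n. proj (p (s n))) \<longlonglongrightarrow> proj y"
      using LIMSEQ_subseq_LIMSEQ[OF py s(1)] by (simp add: o_def)
    have "\<forall>\<^sub>F n in sequentially. p n \<noteq> 0" using p(1) y(1) by (rule tendsto_imp_eventually_ne)
    then have "\<forall>\<^sub>F n in sequentially. proj (v n) \<in> pline h"
      using p(2)
    proof eventually_elim
      case (elim n)
      then show ?case
        using represents_act[OF Y elim(1)] by (simp add: v(2) proj_in_pline dot_matrix_vector)
    qed
    then have "\<forall>\<^sub>F n in sequentially. proj (v (s n)) \<in> pline h"
      by (rule eventually_subseq[OF s(1)])
    then have "proj w \<in> pline h"
      by (rule Lim_in_closed_set[OF closed_pline _ trivial_limit_sequentially vw])
    then have hw: "dot h w = 0" using proj_in_pline nz(1) by blast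
    have fw: "dot \<phi> w = 0"
    proof (rule ccontr)
      assume n0: "dot \<phi> w \<noteq> 0"
      then have "A *v w \<noteq> 0" using rank(2) by (simp add: rank(1) outer_mult_vec)
      moreover have "(\<lambda>n. X (s n)) \<longlonglongrightarrow> A"
        using LIMSEQ_subseq_LIMSEQ[OF A s(1)] by (simp add: o_def)
      ultimately have "(\<lambda>n. proj (X (s n) *v v (s n))) \<longlonglongrightarrow> proj (A *v w)"
        by (intro tendsto_proj tendsto_matrix_vector s(3))
      moreover have "proj (X (s n) *v v (s n)) = proj (p (s n))" for n
        using represents_act(2)[OF X nz(2)] av by simp
      ultimately have "proj (A *v w) = proj y" using psy by (simp add: LIMSEQ_unique)
      moreover have "proj (A *v w) = proj a"
        using n0 rank(2) by (simp add: rank(1) outer_mult_vec proj_smult)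
      ultimately show False using proj_eq_iff[OF rank(2) y(1)] y(4) by metis
    qed
    \<comment> \<open>The forms \<phi> and \<open>h\<close> differ at \<open>b\<close>, so the two
      lines meet in a single point, and \<open>w\<close> and \<open>x\<close> both represent
      it.\<close>
    have "cross \<phi> h \<noteq> 0"
    proof
      assume "cross \<phi> h = 0"
      then obtain c where "h = c *s \<phi>" using cross_eq_0 rank(3) by blast
      then show False using h(2) b(2) by simp
    qed
    then obtain c d where "w = c *s cross \<phi> h" "x = d *s cross \<phi> h"
      using orthogonal_to_two hw fw h(1) x(3) by (metis dot_commute)
    then have "proj w = proj x"
      using nz(1) x(1) proj_smult[of c "cross \<phi> h"] proj_smult[of d "cross \<phi> h"]
      by (metis vec.scale_eq_0_iff)
    then have w: "proj w \<in> \<Omega>" using x(2) by simp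
    obtain d e where de: "d > 0" "cball (proj w) d \<subseteq> \<Omega>" "e > 0" "cball (proj y) e \<subseteq> \<Omega>"
      using op w y(2) open_contains_cball by metis
    \<comment> \<open>One compact set around both limits, since the points start near one and end
      near the other.\<close>
    let ?K = "cball (proj w) d \<union> cball (proj y) e"
    have "compact ?K" by (rule compact_cp2) (intro closed_Un closed_cball)
    then have fin: "finite {\<gamma> \<in> \<Gamma>. psl3_act \<gamma> ` ?K \<inter> ?K \<noteq> {}}"
      using \<Omega> de(2,4) unfolding prop_disc_region_def by blast
    have "\<forall>\<^sub>F n in sequentially. proj (v (s n)) \<in> ball (proj w) d"
      using topological_tendstoD[OF vw open_ball[of "proj w" d]] de(1) by simp
    moreover have "\<forall>\<^sub>F n in sequentially. proj (p (s n)) \<in> ball (proj y) e"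
      using topological_tendstoD[OF psy open_ball[of "proj y" e]] de(3) by simp
    ultimately have "\<forall>\<^sub>F n in sequentially. \<gamma> (s n) \<in> {\<gamma> \<in> \<Gamma>. psl3_act \<gamma> ` ?K \<inter> ?K \<noteq> {}}"
    proof eventually_elim
      case (elim n)
      have "proj (p (s n)) \<in> psl3_act (\<gamma> (s n)) ` ?K"
        using elim(1) av by (intro image_eqI[of _ _ "proj (v (s n))"]) auto
      moreover have "proj (p (s n)) \<in> ?K" using elim(2) by simp
      ultimately show ?case using mem by blast
    qed
    then obtain N where N: "\<And>n. n \<ge> N \<Longrightarrow> \<gamma> (s n) \<in> {\<gamma> \<in> \<Gamma>. psl3_act \<gamma> ` ?K \<inter> ?K \<noteq> {}}"
      unfolding eventually_sequentially by blast
    have "inj (\<gamma> \<circ> s)" by (rule inj_compose[OF inj strict_mono_imp_inj_on[OF s(1)]])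
    then have "infinite ((\<gamma> \<circ> s) ` {N..})"
      using finite_imageD[of "\<gamma> \<circ> s" "{N..}"] infinite_Ici inj_on_subset by blast
    moreover have "(\<gamma> \<circ> s) ` {N..} \<subseteq> {\<gamma> \<in> \<Gamma>. psl3_act \<gamma> ` ?K \<inter> ?K \<noteq> {}}"
      using N by (intro image_subsetI) simp
    ultimately show False using fin finite_subset by blast
  qed
  ultimately show ?thesis by blast
qed (use rank in blast)

lemma missing_line:
  assumes "prop_disc_region \<Gamma> \<Omega>" "infinite \<Gamma>"
  shows "\<exists>\<psi>. \<psi> \<noteq> 0 \<and> pline \<psi> \<inter> \<Omega> = {}"
proof -
  obtain \<gamma> :: "nat \<Rightarrow> psl3" where g: "inj \<gamma>" "range \<gamma> \<subseteq> \<Gamma>"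
    using assms(2) infinite_countable_subset by blast
  from limit_pair[OF this] obtain r X Y A B where r: "strict_mono r"
    "\<And>n. represents (\<gamma> (r n)) (X n)" "\<And>n. represents (pinv (\<gamma> (r n))) (Y n)"
    "X \<longlonglongrightarrow> A" "Y \<longlonglongrightarrow> B" "A \<noteq> 0" "B \<noteq> 0" "A ** B = 0" "B ** A = 0"
    by metis
  let ?g = "\<lambda>n. \<gamma> (r n)"
  have inj: "inj ?g"
    using inj_compose[OF g(1) strict_mono_imp_inj_on[OF r(1)]] by (simp add: o_def)
  have inj': "inj (\<lambda>n. pinv (?g n))"
    using inj_compose[OF inj_pinv inj] by (simp add: o_def)
  have mem: "?g n \<in> \<Gamma>" for n using g(2) by blast
  from rank_one_of_product_zero[OF r(6-8)] show ?thesis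
  proof (elim disjE exE conjE)
    fix a \<phi> assume "a \<noteq> 0" "\<phi> \<noteq> 0" "A = outer a \<phi>"
    then show ?thesis
      using missing_line_rank_one[OF assms(1) inj mem r(2-5,7,8)] by blast
  \<comment> \<open>If \<open>B\<close> has rank one instead, the sequence of inverses takes over,
    with \<open>A\<close> and \<open>B\<close> exchanged.\<close>
  next
    fix b \<phi> assume "b \<noteq> 0" "\<phi> \<noteq> 0" "B = outer b \<phi>"
    moreover have "represents (pinv (pinv (?g n))) (X n)" for n using r(2) by simp
    ultimately show ?thesis
      using missing_line_rank_one[OF assms(1) inj' inv_mem[OF mem] r(3) _ r(5,4,6,9)] by blast
  qed
qed

end

section \<open>Homologies with a common centre\<close>

text \<open>Centre \<open>proj e\<close>, axis \<open>pline \<psi>\<close>; the eigenvalue at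
  \<open>e\<close> is \<open>1 + dot \<psi> e\<close>, and an elation is the case where it is 1. The
  normalisation to be the identity on the kernel of \<psi> removes the freedom of a scalar.\<close>

definition homology :: "complex ^ 3 \<Rightarrow> complex ^ 3 \<Rightarrow> complex ^ 3 ^ 3" where
  "homology e \<psi> = mat 1 + outer e \<psi>"

lemma homology_mult_vec: "homology e \<psi> *v v = v + dot \<psi> v *s e"
  by (simp add: homology_def matrix_vector_mult_add_rdistrib outer_mult_vec)

lemma homology_mult: "homology e \<psi> ** homology e \<phi> = homology e (\<psi> + (1 + dot \<psi> e) *s \<phi>)"
proof -
  have "(homology e \<psi> ** homology e \<phi>) *v v = homology e (\<psi> + (1 + dot \<psi> e) *s \<phi>) *v v" for v
    by (simp add: homology_mult_vec vec_eq_iff algebra_simps flip: matrix_vector_mul_assoc)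
  then show ?thesis by (simp add: matrix_eq)
qed

lemma homology_zero: "homology e 0 = mat 1"
  by (simp add: homology_def outer_def vec_eq_iff)

lemma homology_unique:
  assumes "e \<noteq> 0" "homology e \<psi> = mat c ** homology e \<phi>" shows "\<psi> = \<phi>"
proof -
  have eq: "v + dot \<psi> v *s e = c *s (v + dot \<phi> v *s e)" for v
    using arg_cong[OF assms(2), of "\<lambda>M. M *v v"] by (simp add: homology_mult_vec mat_mult_vec)
  \<comment> \<open>The form \<open>p\<close> vanishes at \<open>e\<close>, so it sees only the
    scalar \<open>c\<close>; the form \<open>h\<close> below then reads off \<psi>.\<close>
  obtain p q where pq: "cross p q = e" using complementary_vectors assms(1) by blast
  then have p: "p \<noteq> 0" using assms(1) by (auto simp: vec_eq_iff forall_3)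
  have pe: "dot p e = 0" using pq by auto
  obtain v where "dot v p = 1" using dot_separates p by blast
  then have "c = 1"
    using arg_cong[OF eq[of v], of "dot p"] pe by (simp add: dot_commute)
  obtain h where h: "dot h e = 1" using dot_separates assms(1) by blast
  have "dot \<psi> v = dot \<phi> v" for v
    using arg_cong[OF eq[of v], of "dot h"] h \<open>c = 1\<close> by simp
  then have "\<psi> - \<phi> = 0" by (intro dot_ext) (simp add: dot_commute)
  then show ?thesis by simp
qed

lemma tendsto_homology:
  assumes "(f \<longlongrightarrow> \<psi>) F" shows "((\<lambda>x. homology e (f x)) \<longlongrightarrow> homology e \<psi>) F"
  unfolding homology_def outer_def by (intro tendsto_intros assms)

lemma independent_pair:
  assumes "cross p q \<noteq> 0" "s *s p + t *s q = 0" shows "s = 0" "t = 0"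
proof -
  have "cross p (s *s p + t *s q) = t *s cross p q" "cross (s *s p + t *s q) q = s *s cross p q"
    by (simp_all add: vec_eq_iff forall_3 algebra_simps)
  moreover have "cross p 0 = 0" "cross 0 q = 0" by (simp_all add: vec_eq_iff forall_3)
  ultimately show "s = 0" "t = 0" using assms by auto
qed

lemma independent_triple:
  assumes "dot (cross p q) r \<noteq> 0" "s *s p + t *s q + u *s r = 0" shows "s = 0" "t = 0" "u = 0"
proof -
  show u: "u = 0" using arg_cong[OF assms(2), of "dot (cross p q)"] assms(1) by simp
  have "cross p q \<noteq> 0" using assms(1) by auto
  then show "s = 0" "t = 0" using independent_pair[of p q s t] assms(2) u by simp_all
qed

text \<open>With a common eigenvalue \<open>c\<close>, the forms \<open>p\<close> and
  \<open>q\<close> annihilate the image of \<open>X - mat c\<close>, so this image is spanned by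
  \<open>cross p q\<close>, the intersection of the two lines.\<close>

lemma homology_of_two_eigenlines:
  assumes "cross p q \<noteq> 0" "p v* X = c *s p" "q v* X = c *s q" "det X \<noteq> 0"
  shows "\<exists>c \<psi>. c \<noteq> 0 \<and> X = mat c ** homology (cross p q) \<psi>"
proof -
  obtain h where h: "dot h (cross p q) = 1" using dot_separates assms(1) by blast
  define \<psi> where "\<psi> = h v* X - c *s h"
  have X: "X *v v = c *s v + dot \<psi> v *s cross p q" for v
  proof -
    have "dot (X *v v - c *s v) p = 0" "dot (X *v v - c *s v) q = 0"
      by (simp_all add: dot_commute[of _ p] dot_commute[of _ q] dot_matrix_vector assms(2,3))
    then obtain k where k: "X *v v - c *s v = k *s cross p q"
      using orthogonal_to_two assms(1) by blast
    have "dot \<psi> v = dot h (X *v v - c *s v)" by (simp add: \<psi>_def dot_matrix_vector)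
    also have "\<dots> = k" using h by (simp add: k)
    finally show ?thesis using k by (simp add: algebra_simps)
  qed
  have "c \<noteq> 0"
  proof
    assume "c = 0"
    \<comment> \<open>For \<open>c = 0\<close> the matrix would have rank at most one and kill any
      zero \<open>w\<close> of \<psi>, contradicting invertibility.\<close>
    obtain w where w: "w \<noteq> 0" "dot \<psi> w = 0"
    proof (cases "\<psi> = 0")
      case True
      then show ?thesis using that[of "axis 1 1"] by (simp add: axis_eq_0_iff)
    next
      case False
      then obtain a b where "cross a b = \<psi>" using complementary_vectors by blast
      moreover from this have "a \<noteq> 0" using False by (auto simp: vec_eq_iff forall_3)
      ultimately show ?thesis using that dot_cross_self(1) by blast
    qed
    then have "X *v w = 0" using X[of w] \<open>c = 0\<close> by simp
    then show False using nonsingular_mult_vec assms(4) w(1) by blast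
  qed
  moreover have "X *v v = (mat c ** homology (cross p q) ((1 / c) *s \<psi>)) *v v" for v
    using \<open>c \<noteq> 0\<close> by (simp add: X mat_mult_vec homology_mult_vec vec_eq_iff algebra_simps)
  then have "X = mat c ** homology (cross p q) ((1 / c) *s \<psi>)" by (simp add: matrix_eq)
  ultimately show ?thesis by blast
qed

lemma vector_matrix_add_scaled: "(a *s p + b *s q) v* X = a *s (p v* X) + b *s (q v* X)"
  for X :: "complex ^ 3 ^ 3"
  by (simp add: vec_eq_iff vector_matrix_mult_def sum_3 algebra_simps)

text \<open>Both coefficients of \<open>r\<close> are nonzero, so comparing components equates
  \<open>c1\<close> and \<open>c2\<close> with \<open>c3\<close>.\<close>

lemma homology_of_three_concurrent_eigenlines:
  assumes "cross p q \<noteq> 0" "r = a *s p + b *s q" "a \<noteq> 0" "b \<noteq> 0"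
    and "p v* X = c1 *s p" "q v* X = c2 *s q" "r v* X = c3 *s r" "det X \<noteq> 0"
  shows "\<exists>c \<psi>. c \<noteq> 0 \<and> X = mat c ** homology (cross p q) \<psi>"
proof -
  have "(a * (c1 - c3)) *s p + (b * (c2 - c3)) *s q = 0"
    using assms(7) unfolding assms(2) vector_matrix_add_scaled assms(5,6)
    by (simp add: vec_eq_iff algebra_simps)
  then have "c1 = c2" using independent_pair[OF assms(1)] assms(3,4) by fastforce
  then show ?thesis using homology_of_two_eigenlines assms(1,5,6,8) by blast
qed

text \<open>The centre is the intersection of two lines selected from the configuration alone,
  before \<open>X\<close> is given; hence one \<open>e\<close> serves a whole group.\<close>

lemma homology_of_four_eigenlines:
  assumes "cross p q \<noteq> 0" "cross p r \<noteq> 0" "cross q r \<noteq> 0"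
    "cross p s \<noteq> 0" "cross q s \<noteq> 0" "cross r s \<noteq> 0"
  obtains e where "e \<noteq> 0" "\<And>X. det X \<noteq> 0 \<Longrightarrow> (\<And>\<phi>. \<phi> \<in> {p, q, r, s} \<Longrightarrow> \<exists>c. \<phi> v* X = c *s \<phi>) \<Longrightarrow>
    \<exists>c \<psi>. c \<noteq> 0 \<and> X = mat c ** homology e \<psi>"
proof -
  have three: "\<exists>c \<psi>. c \<noteq> 0 \<and> X = mat c ** homology (cross u v) \<psi>"
    if "cross u v \<noteq> 0" "cross u w \<noteq> 0" "cross v w \<noteq> 0" "w = a *s u + b *s v" "det X \<noteq> 0"
      "\<exists>c. u v* X = c *s u" "\<exists>c. v v* X = c *s v" "\<exists>c. w v* X = c *s w" for u v w a b X
  proof -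
    have "a \<noteq> 0" using that(3,4) by (auto simp: vec_eq_iff forall_3)
    moreover have "b \<noteq> 0" using that(2,4) by (auto simp: vec_eq_iff forall_3)
    ultimately show ?thesis
      using homology_of_three_concurrent_eigenlines that(1,4-8) by metis
  qed
  show ?thesis
  proof (cases "dot (cross p q) r = 0")
    case True
    then obtain a b where "r = a *s p + b *s q" using in_span_of_two assms(1) by blast
    then show ?thesis by (intro that[OF assms(1)]) (rule three[OF assms(1-3)], (assumption | blast)+)
  next
    case False
    define d where "d = dot (cross p q) r"
    define a b c where "a = dot (cross s q) r / d" "b = dot (cross p s) r / d"
      "c = dot (cross p q) s / d"
    have "d *s s = dot (cross s q) r *s p + dot (cross p s) r *s q + dot (cross p q) s *s r"
      by (simp add: d_def vec_eq_iff forall_3 dot_3 algebra_simps)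
    then have s: "s = a *s p + b *s q + c *s r"
      using False by (simp add: a_b_c_def d_def vec_eq_iff field_simps)
    consider "a = 0" | "b = 0" | "a \<noteq> 0" "b \<noteq> 0" by blast
    then show ?thesis
    proof cases
      case 1
      then have "s = b *s q + c *s r" using s by simp
      then show ?thesis by (intro that[OF assms(3)]) (rule three[OF assms(3,5,6)], (assumption | blast)+)
    next
      case 2
      then have "s = a *s p + c *s r" using s by simp
      then show ?thesis by (intro that[OF assms(2)]) (rule three[OF assms(2,4,6)], (assumption | blast)+)
    next
      \<comment> \<open>The coefficient \<open>c\<close> of \<open>r\<close> may vanish here;
        \<open>a\<close> and \<open>b\<close> alone equate the eigenvalues of \<open>p\<close> and
        \<open>q\<close> with that of \<open>s\<close>.\<close>
      case 3
      have "\<exists>c \<psi>. c \<noteq> 0 \<and> X = mat c ** homology (cross p q) \<psi>"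
        if X: "det X \<noteq> 0" "\<And>\<phi>. \<phi> \<in> {p, q, r, s} \<Longrightarrow> \<exists>c. \<phi> v* X = c *s \<phi>" for X
      proof -
        obtain k1 k2 k3 k4 where k: "p v* X = k1 *s p" "q v* X = k2 *s q" "r v* X = k3 *s r"
          "s v* X = k4 *s s" using X(2) by (metis insertCI)
        have "s v* X = a *s (p v* X) + b *s (q v* X) + c *s (r v* X)"
          unfolding s using vector_matrix_add_scaled[of 1 "a *s p + b *s q" c r X]
          by (simp add: vector_matrix_add_scaled)
        then have "k4 *s (a *s p + b *s q + c *s r) = a *s (k1 *s p) + b *s (k2 *s q) + c *s (k3 *s r)"
          unfolding k using s by metis
        then have "(a * (k1 - k4)) *s p + (b * (k2 - k4)) *s q + (c * (k3 - k4)) *s r = 0"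
          by (simp add: vec_eq_iff algebra_simps)
        then have "k1 = k2" using independent_triple[OF False] 3 by fastforce
        then show ?thesis using homology_of_two_eigenlines assms(1) k X(1) by blast
      qed
      then show ?thesis by (rule that[OF assms(1)])
    qed
  qed
qed

text \<open>Finite index is expressed by a finite set \<open>G\<close> of representatives whose left
  translates of \<open>\<Delta>'\<close> cover \<Delta>.\<close>

lemma finite_index_infinite:
  assumes "infinite \<Delta>" "finite G" "\<And>\<gamma>. \<gamma> \<in> \<Delta> \<Longrightarrow> \<exists>g\<in>G. psl3_mult (pinv g) \<gamma> \<in> \<Delta>'"
  shows "infinite \<Delta>'"
proof
  assume "finite \<Delta>'"
  then have "finite (\<Union>g\<in>G. psl3_mult g ` \<Delta>')" using assms(2) by blast
  moreover have "\<Delta> \<subseteq> (\<Union>g\<in>G. psl3_mult g ` \<Delta>')"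
  proof
    fix \<gamma> assume "\<gamma> \<in> \<Delta>"
    then obtain g where g: "g \<in> G" "psl3_mult (pinv g) \<gamma> \<in> \<Delta>'" using assms(3) by blast
    then have "\<gamma> \<in> psl3_mult g ` \<Delta>'" by (intro image_eqI[of _ _ "psl3_mult (pinv g) \<gamma>"]) simp_all
    then show "\<gamma> \<in> (\<Union>g\<in>G. psl3_mult g ` \<Delta>')" using g(1) by blast
  qed
  ultimately show False using assms(1) finite_subset by blast
qed

lemma finite_index_trans:
  assumes "finite G" "G \<subseteq> \<Gamma>" "\<And>\<gamma>. \<gamma> \<in> \<Gamma> \<Longrightarrow> \<exists>g\<in>G. psl3_mult (pinv g) \<gamma> \<in> \<Delta>"
    and "finite H" "H \<subseteq> \<Delta>" "\<And>\<gamma>. \<gamma> \<in> \<Delta> \<Longrightarrow> \<exists>g\<in>H. psl3_mult (pinv g) \<gamma> \<in> \<Delta>'"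
    and \<gamma>: "\<gamma> \<in> \<Gamma>"
  shows "\<exists>k\<in>(\<lambda>(g, h). psl3_mult g h) ` (G \<times> H). psl3_mult (pinv k) \<gamma> \<in> \<Delta>'"
proof -
  obtain g where g: "g \<in> G" "psl3_mult (pinv g) \<gamma> \<in> \<Delta>" using assms(3) \<gamma> by blast
  then obtain h where h: "h \<in> H" "psl3_mult (pinv h) (psl3_mult (pinv g) \<gamma>) \<in> \<Delta>'"
    using assms(6) by blast
  have "psl3_mult (pinv (psl3_mult g h)) \<gamma> = psl3_mult (pinv h) (psl3_mult (pinv g) \<gamma>)"
    using PSL3.inv_mult_group[of g h] PSL3.m_assoc[of "pinv h" "pinv g" \<gamma>] by (simp add: PSL3_def)
  then show ?thesis using g(1) h by force
qed

section \<open>Discrete groups of homologies with a common centre\<close>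

locale homology_group = discrete_subgroup +
  fixes \<Delta> :: "psl3 set" and e :: "complex ^ 3"
  assumes sub: "\<Delta> \<subseteq> \<Gamma>" and mult_closed: "\<gamma> \<in> \<Delta> \<Longrightarrow> \<delta> \<in> \<Delta> \<Longrightarrow> psl3_mult \<gamma> \<delta> \<in> \<Delta>"
    and inv_closed: "\<delta> \<in> \<Delta> \<Longrightarrow> pinv \<delta> \<in> \<Delta>"
    and center: "e \<noteq> 0" and represented: "\<delta> \<in> \<Delta> \<Longrightarrow> \<exists>\<psi>. represents \<delta> (homology e \<psi>)"
    and infinite_Delta: "infinite \<Delta>"
begin

definition psi :: "psl3 \<Rightarrow> complex ^ 3" where
  "psi \<delta> = (SOME \<psi>. represents \<delta> (homology e \<psi>))"

text \<open>The eigenvalue at \<open>e\<close>: a character of \<Delta> with the elations as kernel.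
  By \<open>psi_mult\<close>, \<open>psi\<close> is a cocycle for it, and so additive on
  elations.\<close>

definition mult_factor :: "psl3 \<Rightarrow> complex" where
  "mult_factor \<delta> = 1 + dot (psi \<delta>) e"

lemma psi_represents: "\<delta> \<in> \<Delta> \<Longrightarrow> represents \<delta> (homology e (psi \<delta>))"
  unfolding psi_def using represented by (rule someI_ex)

lemma psi_eq: "\<delta> \<in> \<Delta> \<Longrightarrow> represents \<delta> (homology e \<psi>) \<Longrightarrow> psi \<delta> = \<psi>"
  using represents_unique[OF _ psi_represents, of \<delta> "homology e \<psi>"] homology_unique[OF center] by blast

lemma psi_inj: "\<gamma> \<in> \<Delta> \<Longrightarrow> \<delta> \<in> \<Delta> \<Longrightarrow> psi \<gamma> = psi \<delta> \<Longrightarrow> \<gamma> = \<delta>"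
  using represents_inj psi_represents by metis

lemma psi_mult:
  "\<gamma> \<in> \<Delta> \<Longrightarrow> \<delta> \<in> \<Delta> \<Longrightarrow> psi (psl3_mult \<gamma> \<delta>) = psi \<gamma> + mult_factor \<gamma> *s psi \<delta>"
  using represents_mult[OF psi_represents psi_represents] mult_closed
  by (simp add: psi_eq homology_mult mult_factor_def)

lemma mult_factor_mult:
  "\<gamma> \<in> \<Delta> \<Longrightarrow> \<delta> \<in> \<Delta> \<Longrightarrow> mult_factor (psl3_mult \<gamma> \<delta>) = mult_factor \<gamma> * mult_factor \<delta>"
  by (simp add: psi_mult mult_factor_def algebra_simps)

lemma one_in: "psl3_one \<in> \<Delta>"
proof -
  obtain \<delta> where "\<delta> \<in> \<Delta>" using infinite_Delta by fastforce
  then show ?thesis using mult_closed[OF _ inv_closed, of \<delta> \<delta>] by simp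
qed

lemma psi_one: "psi psl3_one = 0"
  by (rule psi_eq[OF one_in]) (auto simp: homology_zero represents_one intro: exI[of _ 1])

lemma mult_factor_one: "mult_factor psl3_one = 1"
  by (simp add: mult_factor_def psi_one)

lemma mult_factor_inv: "\<delta> \<in> \<Delta> \<Longrightarrow> mult_factor \<delta> * mult_factor (pinv \<delta>) = 1"
  using mult_factor_mult[OF _ inv_closed, of \<delta> \<delta>] by (simp add: mult_factor_one)

lemma psi_inv: "\<delta> \<in> \<Delta> \<Longrightarrow> psi \<delta> + mult_factor \<delta> *s psi (pinv \<delta>) = 0"
  using psi_mult[OF _ inv_closed, of \<delta> \<delta>] by (simp add: psi_one)

definition elations :: "psl3 set" where
  "elations = {\<delta> \<in> \<Delta>. mult_factor \<delta> = 1}"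

lemma elations_mult:
  "\<gamma> \<in> elations \<Longrightarrow> \<delta> \<in> elations \<Longrightarrow>
     psl3_mult \<gamma> \<delta> \<in> elations \<and> psi (psl3_mult \<gamma> \<delta>) = psi \<gamma> + psi \<delta>"
  by (simp add: elations_def mult_closed mult_factor_mult psi_mult)

lemma elations_multiple:
  assumes "\<delta> \<in> elations" shows "\<exists>\<gamma>\<in>elations. psi \<gamma> = of_nat n *s psi \<delta>"
proof (induction n)
  case 0
  have "psl3_one \<in> elations" by (simp add: elations_def one_in mult_factor_one)
  then show ?case using psi_one by auto
next
  case (Suc n)
  then obtain \<gamma> where "\<gamma> \<in> elations" "psi \<gamma> = of_nat n *s psi \<delta>" by blast
  then show ?case
    using elations_mult[of \<delta> \<gamma>] assms
    by (intro bexI[of _ "psl3_mult \<delta> \<gamma>"]) (auto simp: vec.scale_left_distrib)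
qed

text \<open>Conjugation keeps the character at 1, and the two outer contributions to the cocycle
  cancel by \<open>psi_inv\<close>. This lets the discreteness of elations restrict the multipliers
  of all of \<Delta>.\<close>

lemma elations_conj:
  assumes "\<gamma> \<in> \<Delta>" "\<delta> \<in> elations"
  shows "\<exists>\<delta>'\<in>elations. psi \<delta>' = mult_factor \<gamma> *s psi \<delta>"
proof -
  let ?c = "psl3_mult (psl3_mult \<gamma> \<delta>) (pinv \<gamma>)"
  have d: "\<delta> \<in> \<Delta>" "mult_factor \<delta> = 1" using assms(2) by (auto simp: elations_def)
  have m: "psl3_mult \<gamma> \<delta> \<in> \<Delta>" "pinv \<gamma> \<in> \<Delta>" using assms(1) d mult_closed inv_closed by auto
  have "?c \<in> elations"
    unfolding elations_def using assms(1) d m mult_closed mult_factor_inv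
    by (simp add: mult_factor_mult)
  moreover have "psi ?c = mult_factor \<gamma> *s psi \<delta> + (psi \<gamma> + mult_factor \<gamma> *s psi (pinv \<gamma>))"
    using assms(1) d m by (simp add: psi_mult mult_factor_mult algebra_simps)
  then have "psi ?c = mult_factor \<gamma> *s psi \<delta>" using psi_inv assms(1) by simp
  ultimately show ?thesis by blast
qed

text \<open>Infinitely many bounded forms would have a convergent subsequence; quotients of its
  consecutive elations have the differences as forms, so they are nontrivial but tend to the
  identity.\<close>

lemma finite_bounded_elations: "finite {\<delta> \<in> elations. norm (psi \<delta>) \<le> M}"
proof (rule ccontr)
  assume "infinite {\<delta> \<in> elations. norm (psi \<delta>) \<le> M}"
  then obtain \<gamma> :: "nat \<Rightarrow> psl3" where g: "inj \<gamma>"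
    "range \<gamma> \<subseteq> {\<delta> \<in> elations. norm (psi \<delta>) \<le> M}"
    using infinite_countable_subset by blast
  have tr: "\<gamma> n \<in> elations" "norm (psi (\<gamma> n)) \<le> M" for n using g(2) by auto
  then have D: "\<gamma> n \<in> \<Delta>" "mult_factor (\<gamma> n) = 1" for n by (auto simp: elations_def)
  have "bounded (range (\<lambda>n. psi (\<gamma> n)))" using tr(2) by (auto simp: bounded_iff)
  then obtain l r where r: "strict_mono r" "((\<lambda>n. psi (\<gamma> n)) \<circ> r) \<longlonglongrightarrow> l"
    using bounded_imp_convergent_subsequence by blast
  let ?d = "\<lambda>n. psl3_mult (pinv (\<gamma> (r n))) (\<gamma> (r (Suc n)))"
  have dD: "?d n \<in> \<Delta>" for n using D mult_closed inv_closed by blast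
  have "psi (?d n) = psi (\<gamma> (r (Suc n))) - psi (\<gamma> (r n))" for n
  proof -
    have "psi (pinv (\<gamma> (r n))) = - psi (\<gamma> (r n))"
      using psi_inv[OF D(1)] D(2) by (simp add: eq_neg_iff_add_eq_0 add.commute)
    moreover have "mult_factor (pinv (\<gamma> (r n))) = 1"
      using mult_factor_inv[OF D(1)] D(2) by simp
    ultimately show ?thesis using D inv_closed by (simp add: psi_mult)
  qed
  moreover have "(\<lambda>n. psi (\<gamma> (r (Suc n))) - psi (\<gamma> (r n))) \<longlonglongrightarrow> l - l"
    using r(2) by (intro tendsto_diff LIMSEQ_Suc) (simp_all add: o_def)
  ultimately have "(\<lambda>n. homology e (psi (?d n))) \<longlonglongrightarrow> mat 1"
    using tendsto_homology[of "\<lambda>n. psi (?d n)" 0] by (simp add: homology_zero)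
  moreover have "?d n \<noteq> psl3_one" for n
  proof
    assume "?d n = psl3_one"
    then have "\<gamma> (r (Suc n)) = \<gamma> (r n)"
      using psl3_mult_cancel[of "pinv (\<gamma> (r n))" "\<gamma> (r (Suc n))" "\<gamma> (r n)"] by simp
    then show False using g(1) r(1) by (metis inj_eq n_not_Suc_n strict_mono_eq)
  qed
  ultimately have "(1 :: complex) = 0"
    using dD sub by (intro scalar_limit_zero[of ?d "\<lambda>n. homology e (psi (?d n))"])
      (auto intro: psi_represents)
  then show False by simp
qed

text \<open>Powers of the elation have the forms \<open>of_nat n *s psi \<delta>\<close>, all
  distinct, and all fix its axis pointwise.\<close>

lemma pline_elation:
  assumes "\<delta> \<in> elations" "psi \<delta> \<noteq> 0" shows "pline (psi \<delta>) \<subseteq> infinite_isotropy \<Gamma>"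
proof
  fix z assume "z \<in> pline (psi \<delta>)"
  then obtain v where v: "v \<noteq> 0" "dot (psi \<delta>) v = 0" "z = proj v" unfolding pline_def by blast
  have "\<forall>n. \<exists>\<gamma>. \<gamma> \<in> elations \<and> psi \<gamma> = of_nat n *s psi \<delta>"
    using elations_multiple[OF assms(1)] by blast
  from choice[OF this] obtain \<gamma> where g: "\<And>n. \<gamma> n \<in> elations"
    "\<And>n. psi (\<gamma> n) = of_nat n *s psi \<delta>" by blast
  have "inj \<gamma>"
  proof (rule injI)
    fix m n assume "\<gamma> m = \<gamma> n"
    then have "of_nat m *s psi \<delta> = (of_nat n :: complex) *s psi \<delta>" using g(2) by metis
    then show "m = n" using assms(2) by simp
  qed
  moreover have "\<gamma> n \<in> {\<gamma> \<in> \<Gamma>. psl3_act \<gamma> z = z}" for n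
  proof -
    have "\<gamma> n \<in> \<Delta>" using g(1) by (simp add: elations_def)
    then show ?thesis
      using represents_act(2)[OF psi_represents v(1)] sub by (auto simp: v g(2) homology_mult_vec)
  qed
  ultimately show "z \<in> infinite_isotropy \<Gamma>"
    unfolding infinite_isotropy_def
    by (metis (mono_tags, lifting) finite_subset image_subsetI mem_Collect_eq range_inj_infinite)
qed

text \<open>The sums \<open>psi \<delta> + of_nat n *s psi \<gamma>\<close> are forms of elations
  and pairwise non-proportional, so their axes are distinct.\<close>

lemma infinitely_many_isotropy_lines:
  assumes "\<gamma> \<in> elations" "psi \<gamma> \<noteq> 0" "\<delta> \<in> elations" "\<And>c. psi \<delta> \<noteq> c *s psi \<gamma>"
  shows "infinite {l. complex_line l \<and> l \<subseteq> infinite_isotropy \<Gamma>}"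
proof -
  let ?f = "\<lambda>n :: nat. psi \<delta> + of_nat n *s psi \<gamma>"
  have nz: "?f n \<noteq> 0" for n
  proof
    assume "?f n = 0"
    then have "psi \<delta> = (- of_nat n) *s psi \<gamma>" by (simp add: add_eq_0_iff)
    then show False using assms(4) by blast
  qed
  have "inj (\<lambda>n. pline (?f n))"
  proof (rule injI)
    fix m n assume "pline (?f m) = pline (?f n)"
    then obtain c where c: "?f n = c *s ?f m" using pline_eqD[OF _ nz] by blast
    have eq: "(1 - c) *s psi \<delta> = (c * of_nat m - of_nat n) *s psi \<gamma>"
      using c by (simp add: vec_eq_iff algebra_simps)
    have "c = 1"
    proof (rule ccontr)
      assume "c \<noteq> 1"
      then have "psi \<delta> = ((c * of_nat m - of_nat n) / (1 - c)) *s psi \<gamma>"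
        using eq by (simp add: vec_eq_iff field_simps)
      then show False using assms(4) by blast
    qed
    then show "m = n" using eq assms(2) by simp
  qed
  moreover have "pline (?f n) \<in> {l. complex_line l \<and> l \<subseteq> infinite_isotropy \<Gamma>}" for n
  proof -
    obtain \<gamma>' where g': "\<gamma>' \<in> elations" "psi \<gamma>' = of_nat n *s psi \<gamma>"
      using elations_multiple[OF assms(1)] by blast
    then have "psl3_mult \<delta> \<gamma>' \<in> elations" "psi (psl3_mult \<delta> \<gamma>') = ?f n"
      using elations_mult[OF assms(3)] by simp_all
    then show ?thesis using pline_elation nz[of n] complex_line_iff by (metis mem_Collect_eq)
  qed
  ultimately show ?thesis
    by (metis (no_types, lifting) finite_subset image_subsetI range_inj_infinite)
qed

text \<open>A multiplier of norm below 1 would, through repeated conjugation, shrink the form of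
  \<delta> to infinitely many distinct bounded ones. The same bound for the inverse gives
  equality.\<close>

lemma norm_mult_factor:
  assumes "\<gamma> \<in> \<Delta>" "\<delta> \<in> elations" "psi \<delta> \<noteq> 0" shows "norm (mult_factor \<gamma>) = 1"
proof -
  have ge: "norm (mult_factor \<gamma>) \<ge> 1" if g: "\<gamma> \<in> \<Delta>" for \<gamma>
  proof (rule ccontr)
    assume "\<not> ?thesis"
    then have lt: "norm (mult_factor \<gamma>) < 1" by simp
    have nz: "mult_factor \<gamma> \<noteq> 0" using mult_factor_inv[OF g] by auto
    have "\<exists>\<delta>'. \<delta>' \<in> elations \<and> psi \<delta>' = mult_factor \<gamma> ^ n *s psi \<delta>" for n
    proof (induction n)
      case 0
      then show ?case using assms(2) by (intro exI[of _ \<delta>]) simp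
    next
      case (Suc n)
      then obtain \<delta>' where "\<delta>' \<in> elations" "psi \<delta>' = mult_factor \<gamma> ^ n *s psi \<delta>" by blast
      then show ?case using elations_conj[OF g, of \<delta>'] by (auto simp: vector_smult_assoc)
    qed
    then have "\<forall>n. \<exists>\<delta>'. \<delta>' \<in> elations \<and> psi \<delta>' = mult_factor \<gamma> ^ n *s psi \<delta>" by blast
    from choice[OF this] obtain d where d: "\<And>n. d n \<in> elations"
      "\<And>n. psi (d n) = mult_factor \<gamma> ^ n *s psi \<delta>" by blast
    have norm_smult: "norm (c *s v) = norm c * norm v" for c and v :: "complex ^ 3"
      by (simp add: norm_vec_def L2_set_def norm_mult power_mult_distrib real_sqrt_mult
          flip: sum_distrib_left)
    have "inj d"
    proof (rule linorder_injI)
      fix m n :: nat assume "m < n"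
      then have "norm (mult_factor \<gamma>) ^ n < norm (mult_factor \<gamma>) ^ m"
        using lt nz by (intro power_strict_decreasing) auto
      then have "mult_factor \<gamma> ^ n \<noteq> mult_factor \<gamma> ^ m" by (metis norm_power order_less_irrefl)
      then have "psi (d n) \<noteq> psi (d m)" using d(2) assms(3) by simp
      then show "d m \<noteq> d n" by metis
    qed
    moreover have "d n \<in> {\<delta>' \<in> elations. norm (psi \<delta>') \<le> norm (psi \<delta>)}" for n
      using d lt by (simp add: norm_smult norm_power power_le_one mult_left_le_one_le)
    then have "range d \<subseteq> {\<delta>' \<in> elations. norm (psi \<delta>') \<le> norm (psi \<delta>)}" by blast
    ultimately show False
      using finite_subset[OF _ finite_bounded_elations] range_inj_infinite by blast
  qed
  have "norm (mult_factor \<gamma>) * norm (mult_factor (pinv \<gamma>)) = 1"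
    using mult_factor_inv[OF assms(1)] by (metis norm_mult norm_one)
  then show ?thesis
    using ge[OF assms(1)] ge[OF inv_closed[OF assms(1)]]
    by (metis mult_cancel_left1 mult_left_mono order_antisym mult.right_neutral norm_ge_zero)
qed

text \<open>With a nontrivial elation present, \<open>\<Delta>'\<close> consists of the elations,
  whose index is the number of multipliers. With none, \<open>\<Delta>' = \<Delta>\<close>:
  commutators have multiplier 1, so \<Delta> is abelian.\<close>

lemma dichotomy:
  assumes "finite {l. complex_line l \<and> l \<subseteq> infinite_isotropy \<Gamma>}"
  obtains \<Delta>' G \<psi> where "finite G" "G \<subseteq> \<Delta>"
    "\<And>\<delta>. \<delta> \<in> \<Delta> \<Longrightarrow> \<exists>g\<in>G. psl3_mult (pinv g) \<delta> \<in> \<Delta>'"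
    "\<psi> \<noteq> 0" "\<And>\<delta>. \<delta> \<in> \<Delta>' \<Longrightarrow> \<delta> \<in> \<Delta> \<and> (\<exists>s. represents \<delta> (homology e (s *s \<psi>)))"
proof (cases "\<exists>\<gamma>\<in>elations. psi \<gamma> \<noteq> 0")
  case True
  then obtain \<gamma> where g: "\<gamma> \<in> elations" "psi \<gamma> \<noteq> 0" by blast
  have multiples: "\<exists>s. psi \<delta> = s *s psi \<gamma>" if "\<delta> \<in> elations" for \<delta>
    using infinitely_many_isotropy_lines[OF g that] assms by blast
  \<comment> \<open>Each multiplier has norm 1, so its product with \<open>psi \<gamma>\<close> is
    the form of an elation of bounded norm; there are finitely many of these.\<close>
  have "(\<lambda>k. k *s psi \<gamma>) ` mult_factor ` \<Delta> \<subseteq>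
      psi ` {\<delta> \<in> elations. norm (psi \<delta>) \<le> norm (psi \<gamma>)}"
  proof (clarify)
    fix \<delta> assume d: "\<delta> \<in> \<Delta>"
    obtain \<delta>' where d': "\<delta>' \<in> elations" "psi \<delta>' = mult_factor \<delta> *s psi \<gamma>"
      using elations_conj[OF d g(1)] by blast
    have "norm (psi \<delta>') = norm (psi \<gamma>)"
      using norm_mult_factor[OF d g]
      by (simp add: d'(2) norm_vec_def L2_set_def norm_mult)
    then show "mult_factor \<delta> *s psi \<gamma> \<in> psi ` {\<delta> \<in> elations. norm (psi \<delta>) \<le> norm (psi \<gamma>)}"
      using d' by (intro image_eqI[of _ _ \<delta>']) auto
  qed
  then have "finite ((\<lambda>k. k *s psi \<gamma>) ` mult_factor ` \<Delta>)"
    using finite_bounded_elations finite_surj by blast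
  moreover have "inj_on (\<lambda>k. k *s psi \<gamma>) (mult_factor ` \<Delta>)" using g(2) by (simp add: inj_on_def)
  ultimately have "finite (mult_factor ` \<Delta>)" by (rule finite_imageD)
  then obtain G where G: "G \<subseteq> \<Delta>" "finite G" "mult_factor ` \<Delta> = mult_factor ` G"
    using finite_subset_image[of "mult_factor ` \<Delta>" mult_factor \<Delta>] by blast
  show ?thesis
  proof (rule that[OF G(2,1) _ g(2), of elations])
    fix \<delta> assume d: "\<delta> \<in> \<Delta>"
    then have "mult_factor \<delta> \<in> mult_factor ` G" using G(3) by blast
    then obtain h where h: "h \<in> G" "mult_factor h = mult_factor \<delta>" by force
    have "h \<in> \<Delta>" using h(1) G(1) by blast
    then have "psl3_mult (pinv h) \<delta> \<in> elations"
      unfolding elations_def using mult_closed[OF inv_closed d] mult_factor_mult[OF inv_closed d]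
        mult_factor_inv[of h] h(2) by (simp add: mult.commute)
    then show "\<exists>g\<in>G. psl3_mult (pinv g) \<delta> \<in> elations" using h(1) by blast
  next
    fix \<delta> assume d: "\<delta> \<in> elations"
    then have "\<delta> \<in> \<Delta>" by (simp add: elations_def)
    then show "\<delta> \<in> \<Delta> \<and> (\<exists>s. represents \<delta> (homology e (s *s psi \<gamma>)))"
      using multiples[OF d] psi_represents by metis
  qed
next
  case False
  obtain \<gamma> where g: "\<gamma> \<in> \<Delta>" "\<gamma> \<noteq> psl3_one"
    using infinite_Delta by (metis finite.emptyI finite.insertI finite_subset singletonI subsetI)
  then have nz: "psi \<gamma> \<noteq> 0" using psi_inj[OF g(1) one_in] psi_one by metis
  then have "\<gamma> \<notin> elations" using False by blast
  then have de: "dot (psi \<gamma>) e \<noteq> 0" using g(1) by (simp add: elations_def mult_factor_def)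
  have multiples: "psi \<delta> = (dot (psi \<delta>) e / dot (psi \<gamma>) e) *s psi \<gamma>" if d: "\<delta> \<in> \<Delta>" for \<delta>
  proof -
    let ?a = "psl3_mult \<delta> \<gamma>" and ?b = "psl3_mult \<gamma> \<delta>"
    have m: "?a \<in> \<Delta>" "?b \<in> \<Delta>" "psl3_mult (pinv ?b) ?a \<in> \<Delta>"
      using d g(1) mult_closed inv_closed by auto
    have "mult_factor (psl3_mult (pinv ?b) ?a) = 1"
      using mult_factor_mult[OF inv_closed[OF m(2)] m(1)] mult_factor_inv[OF m(2)]
        mult_factor_mult d g(1) by (simp add: mult.commute)
    then have "psl3_mult (pinv ?b) ?a \<in> elations" using m(3) by (simp add: elations_def)
    then have "psi (psl3_mult (pinv ?b) ?a) = psi psl3_one" using False psi_one by auto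
    then have "psl3_mult (pinv ?b) ?a = psl3_one" using psi_inj m(3) one_in by blast
    then have "?a = ?b" using psl3_mult_cancel[of "pinv ?b" ?a ?b] by simp
    \<comment> \<open>The cocycle evaluated on both orders of the product; as
      \<open>dot (psi \<gamma>) e\<close> is nonzero, this solves for
      \<open>psi \<delta>\<close>.\<close>
    then have "psi \<delta> + mult_factor \<delta> *s psi \<gamma> = psi \<gamma> + mult_factor \<gamma> *s psi \<delta>"
      using psi_mult d g(1) by metis
    then have "dot (psi \<delta>) e *s psi \<gamma> = dot (psi \<gamma>) e *s psi \<delta>"
      by (simp add: mult_factor_def vec.scale_left_distrib)
    then show ?thesis using de by (simp add: vec_eq_iff field_simps)
  qed
  show ?thesis
  proof (rule that[of "{psl3_one}" \<Delta> "psi \<gamma>"])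
    fix \<delta> assume d: "\<delta> \<in> \<Delta>"
    have "pinv psl3_one = psl3_one" using PSL3.inv_one by (simp add: PSL3_def)
    then show "\<exists>g\<in>{psl3_one}. psl3_mult (pinv g) \<delta> \<in> \<Delta>" using d by simp
    show "\<delta> \<in> \<Delta> \<and> (\<exists>s. represents \<delta> (homology e (s *s psi \<gamma>)))"
      using d psi_represents[OF d] multiples[OF d] by metis
  qed (use one_in nz in auto)
qed

end

section \<open>The number of lines\<close>

lemma lines_outside_eq: "lines_outside \<Omega> = {pline \<phi> |\<phi>. \<phi> \<noteq> 0 \<and> pline \<phi> \<inter> \<Omega> = {}}"
  unfolding lines_outside_def complex_line_iff by auto

text \<open>Disposes of an empty \<open>Eq \<Gamma>\<close> or Kulkarni region, which is not a
  region of proper discontinuity but has \<open>Li\<close> infinite.\<close>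

lemma infinite_lines_outside_empty: "infinite (lines_outside {})"
proof -
  let ?f = "\<lambda>n :: nat. vector [1, of_nat n, 0] :: complex ^ 3"
  have nz: "?f n \<noteq> 0" for n by (auto simp: vec_eq_iff forall_3)
  have "inj (\<lambda>n. pline (?f n))"
  proof (rule injI)
    fix m n assume "pline (?f m) = pline (?f n)"
    then obtain c where "?f n = c *s ?f m" using pline_eqD[OF _ nz] by blast
    then show "m = n" by (auto simp: vec_eq_iff forall_3)
  qed
  moreover have "range (\<lambda>n. pline (?f n)) \<subseteq> lines_outside {}"
    using nz unfolding lines_outside_eq by blast
  ultimately show ?thesis using finite_subset range_inj_infinite by blast
qed

lemma line_subset_line_Un_point:
  assumes "\<phi> \<noteq> 0" "\<psi> \<noteq> 0" "e \<noteq> 0" "pline \<phi> \<subseteq> pline \<psi> \<union> {proj e}"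
  shows "pline \<phi> = pline \<psi>"
proof -
  have "dot \<psi> v = 0" if v: "dot \<phi> v = 0" for v
  proof (rule ccontr)
    assume n: "dot \<psi> v \<noteq> 0"
    then have "v \<noteq> 0" by auto
    then have "proj v \<in> - pline \<psi>" using n by (simp add: proj_in_pline)
    moreover have "open (- pline \<psi>)" using closed_pline by (simp add: open_Compl)
    ultimately obtain y where y: "y \<noteq> 0" "proj y \<in> - pline \<psi>" "dot \<phi> y = 0" "\<And>c. y \<noteq> c *s e"
      using avoid_point[of "- pline \<psi>" v \<phi> e] \<open>v \<noteq> 0\<close> assms(1,3) v by metis
    have "proj y \<in> pline \<phi>" using y(1,3) proj_in_pline by blast
    then have "proj e = proj y" using y(2) assms(4) by auto
    then show False using proj_eq_iff[OF assms(3) y(1)] y(4) by blast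
  qed
  then obtain c where c: "\<psi> = c *s \<phi>" using proportional assms(1) by blast
  then have "c \<noteq> 0" using assms(2) by auto
  then show ?thesis unfolding c by (simp add: pline_smult)
qed

lemma act_pline:
  assumes "represents \<gamma> X" "represents (pinv \<gamma>) Y"
  shows "psl3_act \<gamma> ` pline \<phi> = pline (\<phi> v* Y)" "\<phi> \<noteq> 0 \<Longrightarrow> \<phi> v* Y \<noteq> 0"
proof -
  have in_iff: "psl3_act (pinv \<gamma>) z \<in> pline \<phi> \<longleftrightarrow> z \<in> pline (\<phi> v* Y)" for z
  proof -
    obtain v where v: "v \<noteq> 0" "proj v = z" using proj_surj by blast
    then show ?thesis
      using represents_act[OF assms(2) v(1)] by (auto simp: proj_in_pline dot_matrix_vector)
  qed
  have "z \<in> psl3_act \<gamma> ` pline \<phi> \<longleftrightarrow> psl3_act (pinv \<gamma>) z \<in> pline \<phi>" for z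
  proof
    assume "psl3_act (pinv \<gamma>) z \<in> pline \<phi>"
    then show "z \<in> psl3_act \<gamma> ` pline \<phi>"
      by (intro image_eqI[of _ _ "psl3_act (pinv \<gamma>) z"]) simp_all
  qed auto
  then show "psl3_act \<gamma> ` pline \<phi> = pline (\<phi> v* Y)" using in_iff by blast
  show "\<phi> v* Y \<noteq> 0" if nz: "\<phi> \<noteq> 0"
  proof
    assume Y0: "\<phi> v* Y = 0"
    obtain c where c: "c \<noteq> 0" "Y ** X = mat c" using represents_inverse(2)[OF assms] by blast
    obtain v where v: "dot v \<phi> = 1" using dot_separates nz by blast
    have "dot \<phi> (Y *v (X *v v)) = 0" using Y0 by (simp add: dot_matrix_vector)
    moreover have "Y *v (X *v v) = c *s v"
      using mat_mult_vec[of c "mat 1" v] c(2) by (simp add: matrix_vector_mul_assoc)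
    ultimately show False using c(1) v by (simp add: dot_commute)
  qed
qed

lemma eigenline:
  assumes "represents \<gamma> X" "\<phi> \<noteq> 0" "psl3_act \<gamma> ` pline \<phi> = pline \<phi>"
  shows "\<exists>c. \<phi> v* X = c *s \<phi>"
proof (rule proportional[OF assms(2)])
  fix v assume v: "dot \<phi> v = 0"
  show "dot (\<phi> v* X) v = 0"
  proof (cases "v = 0")
    case False
    then have "proj v \<in> pline \<phi>" using v proj_in_pline by blast
    then have "psl3_act \<gamma> (proj v) \<in> pline \<phi>" using assms(3) by blast
    then show ?thesis
      using represents_act[OF assms(1) False] by (simp add: proj_in_pline dot_matrix_vector)
  qed simp
qed

section \<open>Regions missing at least four lines\<close>

context discrete_subgroup
begin

lemma region_of_homology_group:
  assumes \<psi>: "\<psi> \<noteq> 0" and e: "e \<noteq> 0"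
    and homologies: "\<And>\<delta>. \<delta> \<in> \<Delta> \<Longrightarrow> \<delta> \<in> \<Gamma> \<and> (\<exists>s. represents \<delta> (homology e (s *s \<psi>)))"
    and G: "finite G" "\<And>\<gamma>. \<gamma> \<in> \<Gamma> \<Longrightarrow> \<exists>g\<in>G. psl3_mult (pinv g) \<gamma> \<in> \<Delta>"
    and inf: "infinite \<Gamma>"
    and \<Omega>: "\<Omega> = Eq \<Gamma> \<or> \<Omega> = kulkarni_region \<Gamma> \<or> maximal_prop_disc_region \<Gamma> \<Omega>"
    and pd: "prop_disc_region \<Gamma> \<Omega>"
  shows "lines_outside \<Omega> = {pline \<psi>}"
proof -
  define C where "C = pline \<psi> \<union> {proj e}"
  have closed: "closed C" unfolding C_def by (intro closed_Un closed_pline closed_singleton)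
  have "infinite \<Delta>" using finite_index_infinite[OF inf G] .
  have fixed: "psl3_act \<delta> z = z" if d: "\<delta> \<in> \<Delta>" and z: "z \<in> C" for \<delta> z
  proof -
    obtain s where s: "represents \<delta> (homology e (s *s \<psi>))" using homologies d by blast
    consider v where "v \<noteq> 0" "dot \<psi> v = 0" "z = proj v" | "z = proj e"
      using z unfolding C_def pline_def by blast
    then show ?thesis
    proof cases
      case 1
      then show ?thesis using represents_act(2)[OF s 1(1)] by (simp add: homology_mult_vec)
    next
      case 2
      have eq: "homology e (s *s \<psi>) *v e = (1 + s * dot \<psi> e) *s e"
        by (simp add: homology_mult_vec vec.scale_left_distrib)
      have "(1 + s * dot \<psi> e) *s e \<noteq> 0" using represents_act(1)[OF s e] unfolding eq .
      then have "1 + s * dot \<psi> e \<noteq> 0" by (metis vec.scale_zero_left)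
      then have "psl3_act \<delta> (proj e) = proj e"
        using represents_act(2)[OF s e] unfolding eq by (metis proj_smult e)
      then show ?thesis using 2 by simp
    qed
  qed
  have C_iso: "C \<subseteq> infinite_isotropy \<Gamma>"
  proof
    fix z assume "z \<in> C"
    then have "\<Delta> \<subseteq> {\<gamma> \<in> \<Gamma>. psl3_act \<gamma> z = z}" using fixed homologies by blast
    then show "z \<in> infinite_isotropy \<Gamma>"
      unfolding infinite_isotropy_def using \<open>infinite \<Delta>\<close> finite_subset by blast
  qed
  \<comment> \<open>Up to a coset representative, the lifts are \<open>t n\<close> times homologies
    with forms \<open>s n *s \<psi>\<close>. If they tend to 0 at one point off \<open>C\<close>,
    then both \<open>t n\<close> and \<open>t n * s n\<close> tend to 0, and with them the whole
    matrix.\<close>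
  have kernels: "A *v v \<noteq> 0" if A: "limit_matrix \<Gamma> A" and v: "v \<noteq> 0" "proj v \<notin> C" for A v
  proof
    assume Av: "A *v v = 0"
    obtain \<gamma> X where g: "range \<gamma> \<subseteq> \<Gamma>" "\<And>n::nat. represents (\<gamma> n) (X n)" "X \<longlonglongrightarrow> A"
      and "A \<noteq> 0" using A unfolding limit_matrix_def by blast
    have "\<forall>n. \<exists>h. h \<in> G \<and> psl3_mult (pinv h) (\<gamma> n) \<in> \<Delta>" using G(2) g(1) by blast
    from choice[OF this] obtain h where h: "\<And>n. h n \<in> G" "\<And>n. psl3_mult (pinv (h n)) (\<gamma> n) \<in> \<Delta>"
      by blast
    have "range h \<subseteq> G" using h(1) by auto
    then have "finite (range h)" using G(1) by (rule finite_subset)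
    then obtain k where "infinite {n \<in> UNIV. h n = h k}"
      using pigeonhole_infinite[of "UNIV :: nat set" h] by auto
    \<comment> \<open>Along this subsequence a single representative \<open>h k\<close>
      occurs.\<close>
    then obtain r :: "nat \<Rightarrow> nat" where r: "strict_mono r" "\<And>n. r n \<in> {n \<in> UNIV. h n = h k}"
      using infinite_enumerate by blast
    obtain H H' where H: "represents (h k) H" "represents (pinv (h k)) H'"
      using represents_exists by blast
    obtain d where d: "d \<noteq> 0" "H ** H' = mat d" using represents_inverse(1)[OF H] by blast
    define Z where "Z n = H' ** X (r n)" for n
    have "(\<lambda>n. X (r n)) \<longlonglongrightarrow> A" using LIMSEQ_subseq_LIMSEQ[OF g(3) r(1)] by (simp add: o_def)
    then have Zlim: "Z \<longlonglongrightarrow> H' ** A" unfolding Z_def by (intro tendsto_intros)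
    have "\<forall>n. \<exists>t. \<exists>s. Z n = mat t ** homology e (s *s \<psi>)"
    proof
      fix n
      have "represents (psl3_mult (pinv (h k)) (\<gamma> (r n))) (Z n)"
        unfolding Z_def by (rule represents_mult[OF H(2) g(2)])
      moreover have "psl3_mult (pinv (h k)) (\<gamma> (r n)) \<in> \<Delta>" using h(2)[of "r n"] r(2)[of n] by simp
      ultimately show "\<exists>t s. Z n = mat t ** homology e (s *s \<psi>)"
        using homologies represents_unique by blast
    qed
    from choice[OF this] obtain t where "\<forall>n. \<exists>s. Z n = mat (t n) ** homology e (s *s \<psi>)" by blast
    from choice[OF this] obtain s where Z: "\<And>n. Z n = mat (t n) ** homology e (s n *s \<psi>)" by blast
    have Zu: "Z n *v u = t n *s u + (t n * s n * dot \<psi> u) *s e" for n u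
      by (simp add: Z mat_mult_vec homology_mult_vec vec_eq_iff algebra_simps)
    have "(H' ** A) *v v = 0" using Av by (simp flip: matrix_vector_mul_assoc)
    then have Zv: "(\<lambda>n. Z n *v v) \<longlonglongrightarrow> 0"
      using tendsto_matrix_vector[OF Zlim tendsto_const[of v]] by simp
    have ne: "v \<noteq> c *s e" for c
    proof
      assume "v = c *s e"
      then have "proj e = proj v" using proj_eq_iff[OF e v(1)] by blast
      then show False using v(2) by (simp add: C_def)
    qed
    have pv: "dot \<psi> v \<noteq> 0" using v proj_in_pline by (auto simp: C_def)
    \<comment> \<open>As \<open>v\<close> is not a multiple of \<open>e\<close>, a form can ignore
      \<open>e\<close> and isolate \<open>t n\<close>; next \<open>q\<close>, together with
      \<open>dot \<psi> v \<noteq> 0\<close>, isolates \<open>t n * s n\<close>.\<close>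
    obtain p where p: "dot p e = 0" "dot p v = 1" using separate[OF e ne] by blast
    have "(\<lambda>n. dot p (Z n *v v)) \<longlonglongrightarrow> dot p 0" by (intro tendsto_intros Zv)
    then have t0: "t \<longlonglongrightarrow> 0" by (simp add: Zu p)
    obtain q where q: "dot q e = 1" using dot_separates e by blast
    have "(\<lambda>n. (dot q (Z n *v v) - t n * dot q v) / dot \<psi> v) \<longlonglongrightarrow> (dot q 0 - 0 * dot q v) / dot \<psi> v"
      by (intro tendsto_intros Zv t0) (rule pv)
    then have ts0: "(\<lambda>n. t n * s n) \<longlonglongrightarrow> 0" using pv by (simp add: Zu q)
    have "(H' ** A) *v u = 0" for u
    proof (rule LIMSEQ_unique)
      show "(\<lambda>n. Z n *v u) \<longlonglongrightarrow> (H' ** A) *v u" by (intro tendsto_intros Zlim)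
      have "(\<lambda>n. t n *s u + (t n * s n * dot \<psi> u) *s e) \<longlonglongrightarrow> 0 *s u + (0 * dot \<psi> u) *s e"
        by (intro tendsto_intros t0 ts0)
      then show "(\<lambda>n. Z n *v u) \<longlonglongrightarrow> 0" by (simp add: Zu)
    qed
    then have "H' ** A = 0" by (simp add: matrix_eq)
    then have "mat d ** A = 0" using d(2) by (metis matrix_mul_assoc times0_right)
    then have "d * A $ i $ j = 0" for i j by (metis mat_mult_nth zero_index)
    then have "A = 0" using d(1) by (simp add: vec_eq_iff)
    then show False using \<open>A \<noteq> 0\<close> by simp
  qed
  have pd_C: "properly_discontinuous_on \<Gamma> (- C)"
  proof (intro allI impI)
    fix K assume "compact K \<and> K \<subseteq> - C"
    then show "finite {\<gamma> \<in> \<Gamma>. psl3_act \<gamma> ` K \<inter> K \<noteq> {}}"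
      using kernels by (intro finite_translates) (auto intro: compact_imp_closed)
  qed
  \<comment> \<open>This identity yields both the invariance of \<open>C\<close> under \<Gamma> and
    the inclusion of \<Omega> in its complement.\<close>
  have C_eq: "C = infinite_isotropy \<Gamma>" using C_iso infinite_isotropy_outside[OF pd_C] by blast
  have sub: "\<Omega> \<subseteq> - C"
    using infinite_isotropy_outside[of \<Omega> \<Gamma>] pd unfolding C_eq prop_disc_region_def by blast
  have "prop_disc_region \<Gamma> (- C)"
    unfolding prop_disc_region_def
  proof (intro conjI pd_C)
    have "\<Omega> \<noteq> {}" using pd by (simp add: prop_disc_region_def)
    then show "- C \<noteq> {}" using sub by blast
    show "open (- C)" using closed by (rule open_Compl)
    show "(\<Union>\<gamma>\<in>\<Gamma>. psl3_act \<gamma> ` (- C)) = - C"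
    proof (rule invariant_Union)
      fix \<gamma> z assume "\<gamma> \<in> \<Gamma>" "z \<in> - C"
      then show "psl3_act \<gamma> z \<in> - C"
        using act_infinite_isotropy[OF inv_mem, of \<gamma> "psl3_act \<gamma> z"] by (auto simp: C_eq)
    qed
  qed
  \<comment> \<open>The reverse inclusion uses a different reason for each kind: equicontinuity off
    the kernels, \<open>L0 \<Gamma> = C\<close>, or maximality against the region
    \<open>- C\<close>.\<close>
  with \<Omega> have "\<Omega> = - C"
  proof (elim disjE)
    assume "\<Omega> = Eq \<Gamma>"
    then show ?thesis using outside_kernels_subset_Eq[OF closed kernels] sub by blast
  next
    assume "\<Omega> = kulkarni_region \<Gamma>"
    then show ?thesis using kulkarni_region_eq[OF closed C_iso pd_C] by simp
  next
    assume "maximal_prop_disc_region \<Gamma> \<Omega>"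
    then show ?thesis
      using sub \<open>prop_disc_region \<Gamma> (- C)\<close> unfolding maximal_prop_disc_region_def by blast
  qed
  then have "lines_outside \<Omega> = {pline \<phi> |\<phi>. \<phi> \<noteq> 0 \<and> pline \<phi> \<subseteq> C}"
    unfolding lines_outside_eq by auto
  also have "\<dots> = {pline \<psi>}"
  proof (intro equalityI subsetI)
    fix l assume "l \<in> {pline \<phi> |\<phi>. \<phi> \<noteq> 0 \<and> pline \<phi> \<subseteq> C}"
    then obtain \<phi> where "l = pline \<phi>" "\<phi> \<noteq> 0" "pline \<phi> \<subseteq> pline \<psi> \<union> {proj e}"
      unfolding C_def by blast
    then show "l \<in> {pline \<psi>}" using line_subset_line_Un_point \<psi> e by blast
  qed (use \<psi> in \<open>auto simp: C_def\<close>)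
  finally show ?thesis .
qed

lemma act_lines_outside:
  assumes "prop_disc_region \<Gamma> \<Omega>" "\<gamma> \<in> \<Gamma>" "l \<in> lines_outside \<Omega>"
  shows "psl3_act \<gamma> ` l \<in> lines_outside \<Omega>"
proof -
  obtain \<phi> where f: "\<phi> \<noteq> 0" "l = pline \<phi>" "pline \<phi> \<inter> \<Omega> = {}"
    using assms(3) unfolding lines_outside_eq by blast
  obtain X Y where XY: "represents \<gamma> X" "represents (pinv \<gamma>) Y" using represents_exists by blast
  have inv: "(\<Union>\<gamma>\<in>\<Gamma>. psl3_act \<gamma> ` \<Omega>) = \<Omega>" using assms(1) by (simp add: prop_disc_region_def)
  have "psl3_act \<gamma> ` l \<inter> \<Omega> = {}"
  proof (rule ccontr)
    assume "\<not> ?thesis"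
    then obtain z where z: "z \<in> l" "psl3_act \<gamma> z \<in> \<Omega>" by blast
    then have "psl3_act (pinv \<gamma>) (psl3_act \<gamma> z) \<in> \<Omega>"
      using inv inv_mem[OF assms(2)] by blast
    then show False using z(1) f by auto
  qed
  then show ?thesis
    using act_pline[OF XY, of \<phi>] f(1) unfolding f(2) lines_outside_eq by auto
qed

text \<open>\<Gamma> acts on the finite set of missed lines; \<open>G\<close> contains an element
  for every map of this set that occurs.\<close>

lemma finite_index_line_stabilizer:
  assumes "prop_disc_region \<Gamma> \<Omega>" "finite (lines_outside \<Omega>)"
  obtains G where "finite G" "G \<subseteq> \<Gamma>" "\<And>\<gamma>. \<gamma> \<in> \<Gamma> \<Longrightarrow>
    \<exists>g\<in>G. psl3_mult (pinv g) \<gamma> \<in> {\<gamma> \<in> \<Gamma>. \<forall>l\<in>lines_outside \<Omega>. psl3_act \<gamma> ` l = l}"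
proof -
  let ?L = "lines_outside \<Omega>"
  let ?f = "\<lambda>\<gamma>. restrict (\<lambda>l. psl3_act \<gamma> ` l) ?L"
  have "?f ` \<Gamma> \<subseteq> ?L \<rightarrow>\<^sub>E ?L" using act_lines_outside[OF assms(1)] by auto
  then have "finite (?f ` \<Gamma>)" using assms(2) finite_PiE finite_subset by metis
  then obtain G where G: "G \<subseteq> \<Gamma>" "finite G" "?f ` \<Gamma> = ?f ` G"
    using finite_subset_image[of "?f ` \<Gamma>" ?f \<Gamma>] by blast
  show ?thesis
  proof (rule that[OF G(2,1)])
    fix \<gamma> assume g: "\<gamma> \<in> \<Gamma>"
    then have "?f \<gamma> \<in> ?f ` G" using G(3) by blast
    then obtain h where h: "h \<in> G" "?f \<gamma> = ?f h" by blast
    have "psl3_act (psl3_mult (pinv h) \<gamma>) ` l = l" if l: "l \<in> ?L" for l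
    proof -
      have "psl3_act \<gamma> ` l = psl3_act h ` l" using fun_cong[OF h(2), of l] l by simp
      then have "psl3_act (pinv h) ` psl3_act \<gamma> ` l = l" by (simp add: image_image)
      then show ?thesis by (simp add: image_image psl3_act_mult)
    qed
    moreover have "psl3_mult (pinv h) \<gamma> \<in> \<Gamma>" using mult_mem inv_mem g h(1) G(1) by blast
    ultimately show "\<exists>g\<in>G. psl3_mult (pinv g) \<gamma> \<in> {\<gamma> \<in> \<Gamma>. \<forall>l\<in>?L. psl3_act \<gamma> ` l = l}"
      using h(1) by blast
  qed
qed

lemma line_stabilizer_homologies:
  assumes "card (lines_outside \<Omega>) \<ge> 4"
  obtains e where "e \<noteq> 0" "\<And>\<gamma>. \<forall>l\<in>lines_outside \<Omega>. psl3_act \<gamma> ` l = l \<Longrightarrow>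
    \<exists>\<psi>. represents \<gamma> (homology e \<psi>)"
proof -
  obtain S where S: "S \<subseteq> lines_outside \<Omega>" "card S = 4"
    using obtain_subset_with_card_n[OF assms] by metis
  then obtain L where L: "set L = S" "distinct L" "length L = 4"
    using finite_distinct_list[of S] distinct_card by (metis card_ge_0_finite zero_less_numeral)
  then obtain l1 l2 l3 l4 where "L = [l1, l2, l3, l4]"
    by (auto simp: numeral_eq_Suc length_Suc_conv)
  then have l: "S = {l1, l2, l3, l4}" "distinct [l1, l2, l3, l4]" using L by auto
  have "\<forall>l\<in>S. \<exists>\<phi>. \<phi> \<noteq> 0 \<and> l = pline \<phi>" using S(1) unfolding lines_outside_eq by blast
  from bchoice[OF this] obtain f where f: "\<forall>l\<in>S. f l \<noteq> 0 \<and> l = pline (f l)" by blast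
  have cr: "cross (f l) (f l') \<noteq> 0" if ll: "l \<in> S" "l' \<in> S" "l \<noteq> l'" for l l'
  proof
    assume "cross (f l) (f l') = 0"
    then obtain c where c: "f l' = c *s f l" using cross_eq_0 f ll(1) by blast
    then have "c \<noteq> 0" using f ll(2) by auto
    then have "pline (f l') = pline (f l)" unfolding c by (rule pline_smult)
    then show False using f ll by metis
  qed
  obtain e where e: "e \<noteq> 0"
    "\<And>X. det X \<noteq> 0 \<Longrightarrow> (\<And>\<phi>. \<phi> \<in> {f l1, f l2, f l3, f l4} \<Longrightarrow> \<exists>c. \<phi> v* X = c *s \<phi>) \<Longrightarrow>
      \<exists>c \<psi>. c \<noteq> 0 \<and> X = mat c ** homology e \<psi>"
    by (rule homology_of_four_eigenlines[of "f l1" "f l2" "f l3" "f l4"])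
       (use cr l in auto)
  show ?thesis
  proof (rule that[OF e(1)])
    fix \<gamma> assume g: "\<forall>l\<in>lines_outside \<Omega>. psl3_act \<gamma> ` l = l"
    obtain X where X: "represents \<gamma> X" using represents_exists by blast
    have ev: "\<exists>c. f l v* X = c *s f l" if ls: "l \<in> S" for l
    proof (rule eigenline[OF X])
      show "f l \<noteq> 0" using f that by blast
      have "pline (f l) = l" using f that by simp
      then show "psl3_act \<gamma> ` pline (f l) = pline (f l)" using g S(1) that by auto
    qed
    have "\<exists>c \<psi>. c \<noteq> 0 \<and> X = mat c ** homology e \<psi>"
      by (rule e(2)[OF represents_det[OF X]]) (use ev l(1) in blast)
    then obtain c \<psi> where c: "c \<noteq> 0" "X = mat c ** homology e \<psi>" by blast
    then have "mat (1 / c) ** X = homology e \<psi>" by (simp add: matrix_mul_assoc mat_mult_mat)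
    then show "\<exists>\<psi>. represents \<gamma> (homology e \<psi>)"
      using represents_scale[OF X, of "1 / c"] c(1) by auto
  qed
qed

lemma card_lines_outside_less_4:
  assumes inf: "infinite \<Gamma>" and pd: "prop_disc_region \<Gamma> \<Omega>"
    and \<Omega>: "\<Omega> = Eq \<Gamma> \<or> \<Omega> = kulkarni_region \<Gamma> \<or> maximal_prop_disc_region \<Gamma> \<Omega>"
    and fin: "finite (lines_outside \<Omega>)"
  shows "card (lines_outside \<Omega>) < 4"
proof (rule ccontr)
  assume "\<not> ?thesis"
  then have four: "card (lines_outside \<Omega>) \<ge> 4" by simp
  define \<Delta> where "\<Delta> = {\<gamma> \<in> \<Gamma>. \<forall>l\<in>lines_outside \<Omega>. psl3_act \<gamma> ` l = l}"
  obtain G where G: "finite G" "G \<subseteq> \<Gamma>" "\<And>\<gamma>. \<gamma> \<in> \<Gamma> \<Longrightarrow> \<exists>g\<in>G. psl3_mult (pinv g) \<gamma> \<in> \<Delta>"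
    using finite_index_line_stabilizer[OF pd fin] unfolding \<Delta>_def by blast
  obtain e where e: "e \<noteq> 0" "\<And>\<gamma>. \<forall>l\<in>lines_outside \<Omega>. psl3_act \<gamma> ` l = l \<Longrightarrow>
    \<exists>\<psi>. represents \<gamma> (homology e \<psi>)"
    using line_stabilizer_homologies[OF four] by metis
  interpret homology_group \<Gamma> \<Delta> e
  proof unfold_locales
    show "psl3_mult \<gamma> \<delta> \<in> \<Delta>" if "\<gamma> \<in> \<Delta>" "\<delta> \<in> \<Delta>" for \<gamma> \<delta>
    proof -
      have "psl3_act (psl3_mult \<gamma> \<delta>) ` l = psl3_act \<gamma> ` psl3_act \<delta> ` l" for l
        by (simp add: image_image psl3_act_mult)
      then show ?thesis using that mult_mem unfolding \<Delta>_def by simp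
    qed
    show "pinv \<delta> \<in> \<Delta>" if d: "\<delta> \<in> \<Delta>" for \<delta>
    proof -
      have "psl3_act (pinv \<delta>) ` l = l" if "l \<in> lines_outside \<Omega>" for l
      proof -
        have "psl3_act \<delta> ` l = l" using d that by (simp add: \<Delta>_def)
        then have "psl3_act (pinv \<delta>) ` l = psl3_act (pinv \<delta>) ` psl3_act \<delta> ` l" by simp
        then show ?thesis by (simp add: image_image)
      qed
      then show ?thesis using d inv_mem unfolding \<Delta>_def by simp
    qed
    show "infinite \<Delta>" using finite_index_infinite[OF inf G(1,3)] .
  qed (use e in \<open>auto simp: \<Delta>_def\<close>)
  have "infinite_isotropy \<Gamma> \<subseteq> - \<Omega>"
    using infinite_isotropy_outside[of \<Omega> \<Gamma>] pd unfolding prop_disc_region_def by blast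
  \<comment> \<open>Finiteness of the missed lines is what rules out independent elations in
    \<open>dichotomy\<close>.\<close>
  then have "{l. complex_line l \<and> l \<subseteq> infinite_isotropy \<Gamma>} \<subseteq> lines_outside \<Omega>"
    unfolding lines_outside_def by auto
  then have "finite {l. complex_line l \<and> l \<subseteq> infinite_isotropy \<Gamma>}" using fin finite_subset by blast
  from dichotomy[OF this] obtain \<Delta>' H \<psi> where H: "finite H" "H \<subseteq> \<Delta>"
    "\<And>\<delta>. \<delta> \<in> \<Delta> \<Longrightarrow> \<exists>g\<in>H. psl3_mult (pinv g) \<delta> \<in> \<Delta>'" "\<psi> \<noteq> 0"
    "\<And>\<delta>. \<delta> \<in> \<Delta>' \<Longrightarrow> \<delta> \<in> \<Delta> \<and> (\<exists>s. represents \<delta> (homology e (s *s \<psi>)))" by metis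
  have "lines_outside \<Omega> = {pline \<psi>}"
  proof (rule region_of_homology_group[OF H(4) e(1) _ _ finite_index_trans[OF G H(1-3)] inf \<Omega> pd])
    show "\<delta> \<in> \<Gamma> \<and> (\<exists>s. represents \<delta> (homology e (s *s \<psi>)))" if "\<delta> \<in> \<Delta>'" for \<delta>
      using H(5)[OF that] sub by blast
    show "finite ((\<lambda>(g, h). psl3_mult g h) ` (G \<times> H))" using G(1) H(1) by simp
  qed
  then show False using four by simp
qed

end

theorem theorem0p1:
  fixes \<Gamma> :: "psl3 set" and \<Omega> :: "cp2 set"
  assumes "subgroup \<Gamma> PSL3" and "discrete \<Gamma>" and "infinite \<Gamma>"
    and "\<Omega> = Eq \<Gamma> \<or> \<Omega> = kulkarni_region \<Gamma> \<or> maximal_prop_disc_region \<Gamma> \<Omega>"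
  shows "Li \<Omega> \<in> {1, 2, 3, \<infinity>}"
proof -
  interpret discrete_subgroup \<Gamma> by (rule discrete_subgroup.intro[OF assms(1,2)])
  show ?thesis
  proof (cases "finite (lines_outside \<Omega>)")
    case False
    then show ?thesis by (simp add: Li_def)
  next
    case True
    \<comment> \<open>Nonemptiness turns the equicontinuity set and the Kulkarni region into regions
      of proper discontinuity.\<close>
    then have "\<Omega> \<noteq> {}" using infinite_lines_outside_empty by blast
    then have pd: "prop_disc_region \<Gamma> \<Omega>"
      using assms(4) prop_disc_Eq prop_disc_kulkarni_region
      unfolding maximal_prop_disc_region_def by blast
    have "lines_outside \<Omega> \<noteq> {}"
      using missing_line[OF pd assms(3)] unfolding lines_outside_eq by blast
    then have "card (lines_outside \<Omega>) \<noteq> 0" using True by simp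
    moreover have "card (lines_outside \<Omega>) < 4"
      by (rule card_lines_outside_less_4[OF assms(3) pd assms(4) True])
    ultimately have "card (lines_outside \<Omega>) \<in> {1, 2, 3}" by auto
    then show ?thesis using True by (auto simp: Li_def one_enat_def numeral_eq_enat)
  qed
qed

end
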